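(* Suppose that: (a) $X$ satisfies the $s_0$-sparse restricted isometry property: $\inf\{\frac{u^TS_{xx}u}{u^T\Sigma^0_{xx}u}: u\neq 0,\|u\|_0\le s_0\}\ge 0.5$, $\ \sup\{\frac{u^TS_{xx}u}{u^T\Sigma^0_{xx}u}: u\neq 0,\|u\|_0\le s_0\}\le 1.5$, and $\frac{\lambda_{\max}[(\Theta^0)^TS_{xx}\Theta^0]}{\lambda_{\max}[(\Theta^0)^T\Sigma^0_{xx}\Theta^0]}\le 1.4$; (b) $n>(p+s_0)\log(p+q)/\varepsilon_0$, where $\varepsilon_0\in(0,1)$ is a constant; (i) the hyperparameters satisfy $\frac{1}{n\nu_0}\in\mathcal O\big(\sqrt{\log(p+q)/n}\big)$, $\frac{1}{n\nu_1}\in\mathcal O\big(\sqrt{\log(p+q)/n}\big)$ and $1/\nu_1>2\|\nabla l(\Theta^0,\Lambda^0)\|_\infty$; (ii) $R<\frac{2\lambda_{\max}(\Lambda^0)\sqrt{r_0}}{\epsilon_n}$, where $R$ is the matrix norm bound for $\Lambda$ and $\epsilon_n$ is defined below. Then, with probability at least $1-\epsilon_0$, for any $(\Theta,\Lambda)\in HPD$, $$\|(\Theta,\Lambda)-(\Theta^0,\Lambda^0)\|_F\le \epsilon_n:=\frac{C}{\beta_0}\sqrt{\frac{|S^0_{row}|\log(p+q)}{n}}\longrightarrow 0,$$ where $C>0$ is a constant and $\epsilon_0$ is a constant in $(0,1)$.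
   Context: Model and data. There are $p$ responses $Y\in\mathbb R^p$ and $q$ covariates $X\in\mathbb R^q$. The Gaussian conditional random field model has $p(Y|X,\Lambda,\Theta)\propto\sqrt{\det\Lambda}\exp\{-\frac12Y^T\Lambda Y-X^T\Theta Y\}$, i.e. $Y|X\sim N(BX,\Lambda^{-1})$ with $B=-\Lambda^{-1}\Theta^T$, where $\Theta$ is $q\times p$ and $\Lambda$ is $p\times p$ symmetric positive definite. The data are a random sample $(X_i,Y_i)_{i=1}^n$ generated based on fixed true parameters $(\Theta^0,\Lambda^0)$; the true data-generating distribution is sub-Gaussian and the random covariate vector $X$ has covariance $\Sigma^0_{xx}$. Put $S_{yy}=\frac1n\sum_iY_iY_i^T$, $S_{xy}=\frac1n\sum_iX_iY_i^T$, $S_{xx}=\frac1n\sum_iX_iX_i^T$. The log-likelihood is $$l(\Theta,\Lambda)=\frac n2\Big(\log\det\Lambda-\mathrm{tr}(S_{yy}\Lambda+2S_{xy}^T\Theta+\Lambda^{-1}\Theta^TS_{xx}\Theta)\Big).$$ Prior and posterior. Let $LP(x,\nu)=\frac1{2\nu}e^{-|x|/\nu}$. With spike scale $\nu_0$ and slab scale $\nu_1$ ($\nu_0<\nu_1$), and mixing weights $\eta$ and $\rho$ (the same $\nu_0,\nu_1,\eta$ are used for $\Theta$ and $\Lambda$), the priors are $$\Pi(\Theta)=\prod_{i=1}^q\Big[\rho\prod_{j=1}^p\big(\eta LP(\Theta_{ij},\nu_1)+(1-\eta)LP(\Theta_{ij},\nu_0)\big)+(1-\rho)\prod_{j=1}^pLP(\Theta_{ij},\nu_0)\Big],$$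 $$\Pi(\Lambda)=\prod_{i<j}\big(\eta LP(\Lambda_{ij},\nu_1)+(1-\eta)LP(\Lambda_{ij},\nu_0)\big)$$ (the diagonal of $\Lambda$ has a uniform prior, contributing only a constant). The negative log-posterior is $L(\Theta,\Lambda)=-l(\Theta,\Lambda)-\log\Pi(\Theta)-\log\Pi(\Lambda)+\text{const}$, considered over $\Theta\in\mathbb R^{q\times p}$ and symmetric positive definite $\Lambda$ with spectral norm $\|\Lambda\|_2<R$. The high posterior density region is $HPD=\{(\Theta,\Lambda):L(\Theta,\Lambda)\le L(\Theta^0,\Lambda^0)\}$ (within this parameter space). Notation. $S^\Lambda=\{(i,j):\Lambda^0_{ij}\ne0\}$; $S^\Theta_{row}=\{(i,j):\Theta^0_{i\cdot}\ne\vec 0\}$ (all positions in nonzero rows of $\Theta^0$); $S^0_{row}=S^\Theta_{row}\cup S^\Lambda$ (disjoint index sets for the two matrices). $\lambda_{\max},\lambda_{\min}$ are largest/smallest eigenvalues, $\|\cdot\|_F$ is the Frobenius norm, $\|\cdot\|_\infty$ is the elementwise maximum absolute value, and $\|u\|_0$ is the number of nonzero entries. Further: $\alpha=1+2\nu_1/\nu_0$; $\rho_1=0.5\min(\lambda_{\max}(\Lambda^0)^{-1},\lambda_{\min}(\Sigma^0_{xx}))$; $\rho_2=1.5\lambda_{\max}(\Sigma^0_{xx})$; $s_0=|S^0_{row}|+\lceil4(\rho_2/\rho_1)\alpha^2|S^0_{row}|\rceil$; $r_0=\min\big[0.5\lambda_{\min}(\Lambda^0),\,0.13\sqrt{\lambda_{\max}[(\Theta^0)^T\Sigma^0_{xx}\Theta^0]/\rho_2}\big]$;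 $\beta_0=\frac{\rho_1}{40\lambda_{\max}(\Lambda^0)}\min\Big[1,\frac{\lambda_{\min}(3\Lambda^0)}{16\lambda_{\max}[(\Theta^0)^T\Sigma^0_{xx}\Theta^0]}\Big]$. The quantities $\nu_0,\nu_1,R,p,q,|S^0_{row}|$ may all grow with $n$; asymptotic statements are as $n\to\infty$.
   Formalization: The limit ε_n → 0, which can fail under (a), (b), (i), (ii) with a fixed constant in (b), is proved assuming that (b) holds for large n for every constant in (0,1) and that β_0 is bounded away from 0; the error bound needs neither. *)

theory Defs
  imports
    "HOL-Probability.Probability"
    "HOL-Library.Landau_Symbols"
    "Jordan_Normal_Form.Determinant"
    "Jordan_Normal_Form.Gauss_Jordan_Elimination"
    "Jordan_Normal_Form.Char_Poly"
begin

text \<open>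
  The dimensions grow with the sample size, so vectors and matrices with carrier dimensions are
  used. Random vectors take values in \<open>nat \<Rightarrow> real\<close>, with the product \<open>\<sigma>\<close>-algebra on the first
  \<open>q\<close> (respectively \<open>p\<close>) coordinates. A data set of size \<open>n\<close> is a pair of functions
  \<open>x, y :: nat \<Rightarrow> nat \<Rightarrow> real\<close>, where \<open>x i j\<close> is coordinate \<open>j\<close> of observation \<open>i < n\<close>.
\<close>

section \<open>Matrices\<close>

definition mat_trace :: "real mat \<Rightarrow> real" where
  "mat_trace A = (\<Sum>i<dim_row A. A $$ (i, i))"

definition mat_inv :: "real mat \<Rightarrow> real mat" where
  "mat_inv A = the (mat_inverse A)"

text \<open>Only applied to symmetric matrices of positive dimension.\<close>

definition eig_max :: "real mat \<Rightarrow> real" where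
  "eig_max A = Max {k. eigenvalue A k}"

definition eig_min :: "real mat \<Rightarrow> real" where
  "eig_min A = Min {k. eigenvalue A k}"

definition spectral_norm :: "real mat \<Rightarrow> real" where
  "spectral_norm A = sqrt (eig_max (transpose_mat A * A))"

definition frob_norm :: "real mat \<Rightarrow> real" where
  "frob_norm A = sqrt (\<Sum>i<dim_row A. \<Sum>j<dim_col A. (A $$ (i, j))\<^sup>2)"

definition pair_frob_dist :: "real mat \<times> real mat \<Rightarrow> real mat \<times> real mat \<Rightarrow> real" where
  "pair_frob_dist a b =
     sqrt ((frob_norm (fst a - fst b))\<^sup>2 + (frob_norm (snd a - snd b))\<^sup>2)"

definition max_abs :: "real mat \<Rightarrow> real" where
  "max_abs A = Max {\<bar>A $$ (i, j)\<bar> | i j. i < dim_row A \<and> j < dim_col A}"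

definition quad_form :: "real mat \<Rightarrow> real vec \<Rightarrow> real" where
  "quad_form A u = scalar_prod u (A *\<^sub>v u)"

definition l0_norm :: "real vec \<Rightarrow> nat" where
  "l0_norm u = card {i. i < dim_vec u \<and> vec_index u i \<noteq> 0}"

definition sym_pos_def :: "nat \<Rightarrow> real mat \<Rightarrow> bool" where
  "sym_pos_def d A \<longleftrightarrow>
     A \<in> carrier_mat d d \<and> transpose_mat A = A \<and>
     (\<forall>u\<in>carrier_vec d. u \<noteq> 0\<^sub>v d \<longrightarrow> quad_form A u > 0)"

definition unit_entry_mat :: "nat \<Rightarrow> nat \<Rightarrow> nat \<Rightarrow> nat \<Rightarrow> real mat" where
  "unit_entry_mat r c i j = mat r c (\<lambda>ab. if ab = (i, j) then 1 else 0)"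


section \<open>Likelihood, prior and posterior\<close>

text \<open>The (uncentred) matrix \<open>(1/n) \<Sum>\<^sub>i x\<^sub>i y\<^sub>i\<^sup>T\<close>.\<close>

definition moment_mat ::
  "nat \<Rightarrow> nat \<Rightarrow> nat \<Rightarrow> (nat \<Rightarrow> nat \<Rightarrow> real) \<Rightarrow> (nat \<Rightarrow> nat \<Rightarrow> real) \<Rightarrow> real mat" where
  "moment_mat n a b x y = mat a b (\<lambda>(j, k). (\<Sum>i<n. x i j * y i k) / real n)"

definition loglik ::
  "nat \<Rightarrow> nat \<Rightarrow> nat \<Rightarrow> (nat \<Rightarrow> nat \<Rightarrow> real) \<Rightarrow> (nat \<Rightarrow> nat \<Rightarrow> real) \<Rightarrow>
   real mat \<Rightarrow> real mat \<Rightarrow> real" where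
  "loglik n p q x y \<Theta> \<Lambda> =
     (let Syy = moment_mat n p p y y; Sxy = moment_mat n q p x y; Sxx = moment_mat n q q x x
      in real n / 2 *
           (ln (Determinant.det \<Lambda>)
            - mat_trace (Syy * \<Lambda> + 2 \<cdot>\<^sub>m (transpose_mat Sxy * \<Theta>)
                         + mat_inv \<Lambda> * transpose_mat \<Theta> * Sxx * \<Theta>)))"

text \<open>
  The gradient is the matrix of partial derivatives with respect to the individual entries; the
  entries \<open>(i, j)\<close> and \<open>(j, i)\<close> of \<open>\<Lambda>\<close> are separate variables, as usual in matrix calculus.
\<close>

definition grad_Theta ::
  "nat \<Rightarrow> nat \<Rightarrow> nat \<Rightarrow> (nat \<Rightarrow> nat \<Rightarrow> real) \<Rightarrow> (nat \<Rightarrow> nat \<Rightarrow> real) \<Rightarrow>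
   real mat \<Rightarrow> real mat \<Rightarrow> real mat" where
  "grad_Theta n p q x y \<Theta> \<Lambda> = mat q p (\<lambda>(i, j).
     deriv (\<lambda>t. loglik n p q x y (\<Theta> + t \<cdot>\<^sub>m unit_entry_mat q p i j) \<Lambda>) 0)"

definition grad_Lambda ::
  "nat \<Rightarrow> nat \<Rightarrow> nat \<Rightarrow> (nat \<Rightarrow> nat \<Rightarrow> real) \<Rightarrow> (nat \<Rightarrow> nat \<Rightarrow> real) \<Rightarrow>
   real mat \<Rightarrow> real mat \<Rightarrow> real mat" where
  "grad_Lambda n p q x y \<Theta> \<Lambda> = mat p p (\<lambda>(i, j).
     deriv (\<lambda>t. loglik n p q x y \<Theta> (\<Lambda> + t \<cdot>\<^sub>m unit_entry_mat p p i j)) 0)"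

definition grad_sup_norm ::
  "nat \<Rightarrow> nat \<Rightarrow> nat \<Rightarrow> (nat \<Rightarrow> nat \<Rightarrow> real) \<Rightarrow> (nat \<Rightarrow> nat \<Rightarrow> real) \<Rightarrow>
   real mat \<Rightarrow> real mat \<Rightarrow> real" where
  "grad_sup_norm n p q x y \<Theta> \<Lambda> =
     max (max_abs (grad_Theta n p q x y \<Theta> \<Lambda>)) (max_abs (grad_Lambda n p q x y \<Theta> \<Lambda>))"

definition LP :: "real \<Rightarrow> real \<Rightarrow> real" where
  "LP x \<nu> = 1 / (2 * \<nu>) * exp (- \<bar>x\<bar> / \<nu>)"

definition spike_slab :: "real \<Rightarrow> real \<Rightarrow> real \<Rightarrow> real \<Rightarrow> real" where
  "spike_slab \<nu>0 \<nu>1 \<eta> x = \<eta> * LP x \<nu>1 + (1 - \<eta>) * LP x \<nu>0"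

definition prior_Theta ::
  "nat \<Rightarrow> nat \<Rightarrow> real \<Rightarrow> real \<Rightarrow> real \<Rightarrow> real \<Rightarrow> real mat \<Rightarrow> real" where
  "prior_Theta p q \<nu>0 \<nu>1 \<eta> \<rho> \<Theta> =
     (\<Prod>i<q. \<rho> * (\<Prod>j<p. spike_slab \<nu>0 \<nu>1 \<eta> (\<Theta> $$ (i, j)))
             + (1 - \<rho>) * (\<Prod>j<p. LP (\<Theta> $$ (i, j)) \<nu>0))"

definition prior_Lambda :: "nat \<Rightarrow> real \<Rightarrow> real \<Rightarrow> real \<Rightarrow> real mat \<Rightarrow> real" where
  "prior_Lambda p \<nu>0 \<nu>1 \<eta> \<Lambda> =
     (\<Prod>(i, j)\<in>{(i, j). i < j \<and> j < p}. spike_slab \<nu>0 \<nu>1 \<eta> (\<Lambda> $$ (i, j)))"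

text \<open>The additive constant of the negative log-posterior does not affect \<open>HPD\<close>; it is \<open>0\<close> here.\<close>

definition neg_log_post ::
  "nat \<Rightarrow> nat \<Rightarrow> nat \<Rightarrow> (nat \<Rightarrow> nat \<Rightarrow> real) \<Rightarrow> (nat \<Rightarrow> nat \<Rightarrow> real) \<Rightarrow>
   real \<Rightarrow> real \<Rightarrow> real \<Rightarrow> real \<Rightarrow> real mat \<Rightarrow> real mat \<Rightarrow> real" where
  "neg_log_post n p q x y \<nu>0 \<nu>1 \<eta> \<rho> \<Theta> \<Lambda> =
     - loglik n p q x y \<Theta> \<Lambda>
     - ln (prior_Theta p q \<nu>0 \<nu>1 \<eta> \<rho> \<Theta>) - ln (prior_Lambda p \<nu>0 \<nu>1 \<eta> \<Lambda>)"

definition param_space :: "nat \<Rightarrow> nat \<Rightarrow> real \<Rightarrow> (real mat \<times> real mat) set" where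
  "param_space p q R =
     {(\<Theta>, \<Lambda>). \<Theta> \<in> carrier_mat q p \<and> sym_pos_def p \<Lambda> \<and> spectral_norm \<Lambda> < R}"

definition HPD ::
  "nat \<Rightarrow> nat \<Rightarrow> nat \<Rightarrow> (nat \<Rightarrow> nat \<Rightarrow> real) \<Rightarrow> (nat \<Rightarrow> nat \<Rightarrow> real) \<Rightarrow>
   real \<Rightarrow> real \<Rightarrow> real \<Rightarrow> real \<Rightarrow> real \<Rightarrow> real mat \<Rightarrow> real mat \<Rightarrow> (real mat \<times> real mat) set" where
  "HPD n p q x y \<nu>0 \<nu>1 \<eta> \<rho> R \<Theta>0 \<Lambda>0 =
     {(\<Theta>, \<Lambda>) \<in> param_space p q R.
        neg_log_post n p q x y \<nu>0 \<nu>1 \<eta> \<rho> \<Theta> \<Lambda> \<le> neg_log_post n p q x y \<nu>0 \<nu>1 \<eta> \<rho> \<Theta>0 \<Lambda>0}"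


section \<open>Derived constants\<close>

definition supp_Lambda :: "real mat \<Rightarrow> (nat \<times> nat) set" where
  "supp_Lambda \<Lambda>0 = {(i, j). i < dim_row \<Lambda>0 \<and> j < dim_col \<Lambda>0 \<and> \<Lambda>0 $$ (i, j) \<noteq> 0}"

definition row_supp_Theta :: "real mat \<Rightarrow> (nat \<times> nat) set" where
  "row_supp_Theta \<Theta>0 =
     {(i, j). i < dim_row \<Theta>0 \<and> j < dim_col \<Theta>0 \<and> row \<Theta>0 i \<noteq> 0\<^sub>v (dim_col \<Theta>0)}"

text \<open>The disjoint sum keeps the positions of \<open>\<Theta>\<close> apart from those of \<open>\<Lambda>\<close>.\<close>

definition S_row :: "real mat \<Rightarrow> real mat \<Rightarrow> (nat \<times> nat + nat \<times> nat) set" where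
  "S_row \<Theta>0 \<Lambda>0 = row_supp_Theta \<Theta>0 <+> supp_Lambda \<Lambda>0"

definition alpha_const :: "real \<Rightarrow> real \<Rightarrow> real" where
  "alpha_const \<nu>0 \<nu>1 = 1 + 2 * \<nu>1 / \<nu>0"

definition rho1 :: "real mat \<Rightarrow> real mat \<Rightarrow> real" where
  "rho1 \<Lambda>0 Sig0 = 0.5 * min (inverse (eig_max \<Lambda>0)) (eig_min Sig0)"

definition rho2 :: "real mat \<Rightarrow> real" where
  "rho2 Sig0 = 1.5 * eig_max Sig0"

definition s0_const :: "real \<Rightarrow> real \<Rightarrow> real mat \<Rightarrow> real mat \<Rightarrow> real mat \<Rightarrow> nat" where
  "s0_const \<nu>0 \<nu>1 \<Theta>0 \<Lambda>0 Sig0 =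
     card (S_row \<Theta>0 \<Lambda>0) +
     nat \<lceil>4 * (rho2 Sig0 / rho1 \<Lambda>0 Sig0) * (alpha_const \<nu>0 \<nu>1)\<^sup>2 * real (card (S_row \<Theta>0 \<Lambda>0))\<rceil>"

definition signal_mat :: "real mat \<Rightarrow> real mat \<Rightarrow> real mat" where
  "signal_mat \<Theta>0 S = transpose_mat \<Theta>0 * S * \<Theta>0"

definition r0_const :: "real mat \<Rightarrow> real mat \<Rightarrow> real mat \<Rightarrow> real" where
  "r0_const \<Theta>0 \<Lambda>0 Sig0 =
     min (0.5 * eig_min \<Lambda>0) (0.13 * sqrt (eig_max (signal_mat \<Theta>0 Sig0) / rho2 Sig0))"

definition beta0 :: "real mat \<Rightarrow> real mat \<Rightarrow> real mat \<Rightarrow> real" where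
  "beta0 \<Theta>0 \<Lambda>0 Sig0 =
     rho1 \<Lambda>0 Sig0 / (40 * eig_max \<Lambda>0) *
     min 1 (eig_min (3 \<cdot>\<^sub>m \<Lambda>0) / (16 * eig_max (signal_mat \<Theta>0 Sig0)))"

definition eps_rate ::
  "real \<Rightarrow> nat \<Rightarrow> nat \<Rightarrow> nat \<Rightarrow> real mat \<Rightarrow> real mat \<Rightarrow> real mat \<Rightarrow> real" where
  "eps_rate C n p q \<Theta>0 \<Lambda>0 Sig0 =
     C / beta0 \<Theta>0 \<Lambda>0 Sig0 *
     sqrt (real (card (S_row \<Theta>0 \<Lambda>0)) * ln (real (p + q)) / real n)"


section \<open>Conditions of the theorem\<close>

definition sparse_ratios :: "nat \<Rightarrow> nat \<Rightarrow> real mat \<Rightarrow> real mat \<Rightarrow> real set" where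
  "sparse_ratios q s Sxx Sig0 =
     {quad_form Sxx u / quad_form Sig0 u | u. u \<in> carrier_vec q \<and> u \<noteq> 0\<^sub>v q \<and> l0_norm u \<le> s}"

definition sparse_RIP :: "nat \<Rightarrow> nat \<Rightarrow> real mat \<Rightarrow> real mat \<Rightarrow> real mat \<Rightarrow> bool" where
  "sparse_RIP q s Sxx Sig0 \<Theta>0 \<longleftrightarrow>
     Inf (sparse_ratios q s Sxx Sig0) \<ge> 0.5 \<and>
     Sup (sparse_ratios q s Sxx Sig0) \<le> 1.5 \<and>
     eig_max (signal_mat \<Theta>0 Sxx) / eig_max (signal_mat \<Theta>0 Sig0) \<le> 1.4"

definition sample_size_cond ::
  "real \<Rightarrow> nat \<Rightarrow> nat \<Rightarrow> nat \<Rightarrow> nat \<Rightarrow> bool" where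
  "sample_size_cond e n p q s \<longleftrightarrow> real n > real (p + s) * ln (real (p + q)) / e"

text \<open>
  "Probability at least \<open>c\<close>" is understood as inner probability, since the events in question
  quantify over uncountably many parameters and \<^const>\<open>measure\<close> is \<open>0\<close> on non-measurable sets.
\<close>

definition with_prob_at_least :: "'a measure \<Rightarrow> real \<Rightarrow> ('a \<Rightarrow> bool) \<Rightarrow> bool" where
  "with_prob_at_least M c P \<longleftrightarrow> (\<exists>E\<in>sets M. (\<forall>\<omega>\<in>E. P \<omega>) \<and> measure M E \<ge> c)"


section \<open>The data-generating distribution\<close>

abbreviation coord_algebra :: "nat \<Rightarrow> (nat \<Rightarrow> real) measure" where
  "coord_algebra d \<equiv> Pi\<^sub>M {..<d} (\<lambda>_. borel)"

definition sub_gaussian :: "'a measure \<Rightarrow> real \<Rightarrow> ('a \<Rightarrow> real) \<Rightarrow> bool" where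
  "sub_gaussian M K Z \<longleftrightarrow>
     integrable M Z \<and>
     (\<forall>t. integrable M (\<lambda>\<omega>. exp (t * (Z \<omega> - integral\<^sup>L M Z))) \<and>
          integral\<^sup>L M (\<lambda>\<omega>. exp (t * (Z \<omega> - integral\<^sup>L M Z))) \<le> exp (K\<^sup>2 * t\<^sup>2 / 2))"

definition sub_gaussian_pair ::
  "'a measure \<Rightarrow> nat \<Rightarrow> nat \<Rightarrow> ('a \<Rightarrow> nat \<Rightarrow> real) \<Rightarrow> ('a \<Rightarrow> nat \<Rightarrow> real) \<Rightarrow> bool" where
  "sub_gaussian_pair M q p X Y \<longleftrightarrow>
     (\<exists>K>0. \<forall>a b. (\<Sum>j<q. (a j)\<^sup>2) + (\<Sum>j<p. (b j)\<^sup>2) = (1::real) \<longrightarrow>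
        sub_gaussian M K (\<lambda>\<omega>. (\<Sum>j<q. a j * X \<omega> j) + (\<Sum>j<p. b j * Y \<omega> j)))"

text \<open>
  The Gaussian conditional model \<open>Y | X \<sim> N(B X, \<Lambda>\<^sup>-\<^sup>1)\<close> with \<open>B = - \<Lambda>\<^sup>-\<^sup>1 \<Theta>\<^sup>T\<close> need not be the true
  distribution, which is only sub-Gaussian: the true parameters enter through the conditional mean
  and the conditional covariance of \<open>Y\<close> given \<open>X\<close>.
\<close>

definition data_model ::
  "'a measure \<Rightarrow> nat \<Rightarrow> nat \<Rightarrow> nat \<Rightarrow> (nat \<Rightarrow> 'a \<Rightarrow> nat \<Rightarrow> real) \<Rightarrow> (nat \<Rightarrow> 'a \<Rightarrow> nat \<Rightarrow> real) \<Rightarrow>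
   real mat \<Rightarrow> real mat \<Rightarrow> real mat \<Rightarrow> bool" where
  "data_model M n p q X Y \<Theta>0 \<Lambda>0 Sig0 \<longleftrightarrow>
     (let A = coord_algebra q \<Otimes>\<^sub>M coord_algebra p;
          Z = (\<lambda>i \<omega>. (X i \<omega>, Y i \<omega>));
          B = - (mat_inv \<Lambda>0 * transpose_mat \<Theta>0);
          resid = (\<lambda>i j \<omega>. Y i \<omega> j - (\<Sum>k<q. B $$ (j, k) * X i \<omega> k))
      in prob_space M \<and>
         prob_space.indep_vars M (\<lambda>_. A) Z {..<n} \<and>
         (\<forall>i<n. distr M A (Z i) = distr M A (Z 0)) \<and>
         (\<forall>i<n. sub_gaussian_pair M q p (X i) (Y i)) \<and>
         (\<forall>i<n. \<forall>j<q. \<forall>k<q. Sig0 $$ (j, k) =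
            integral\<^sup>L M (\<lambda>\<omega>. (X i \<omega> j - integral\<^sup>L M (\<lambda>\<omega>'. X i \<omega>' j)) *
                               (X i \<omega> k - integral\<^sup>L M (\<lambda>\<omega>'. X i \<omega>' k)))) \<and>
         (\<forall>i<n. let F = vimage_algebra (space M) (X i) (coord_algebra q) in
            (\<forall>j<p. AE \<omega> in M. real_cond_exp M F (resid i j) \<omega> = 0) \<and>
            (\<forall>j<p. \<forall>k<p. AE \<omega> in M.
               real_cond_exp M F (\<lambda>\<omega>'. resid i j \<omega>' * resid i k \<omega>') \<omega> = mat_inv \<Lambda>0 $$ (j, k))))"

end

theory Submission
  imports Defs
begin

text \<open>
  The argument is deterministic on the event where the restricted isometry property and the
  gradient bound hold. Choose a basis \<open>P\<close> with \<open>P\<^sup>T \<Lambda>0 P = 1\<close> and \<open>P\<^sup>T \<Lambda> P = diag d\<close>. In this basis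
  the remainder of the first order expansion of the log-likelihood at \<open>(\<Theta>0, \<Lambda>0)\<close> is, up to the
  factor \<open>n / 2\<close>, exactly
  \<open>(\<Sum>i. (d\<^sub>i - 1) - ln d\<^sub>i) + (\<Sum>i. \<bar>X (\<Theta> - \<Theta>0) p\<^sub>i - (d\<^sub>i - 1) X \<Theta>0 p\<^sub>i\<bar>\<^sup>2 / (n d\<^sub>i))\<close>.
  This gives global lower bounds, quadratic near \<open>\<Lambda>0\<close> and linear far from it, without
  localization and without using convexity.

  From above, the remainder is controlled by the prior: the log-prior loses at least \<open>1 / \<nu>1\<close> per
  unit of 1-norm off the support and gains at most \<open>1 / \<nu>0\<close> on it, and the gradient is below
  \<open>1 / (2 \<nu>1)\<close>. Since the strict upper triangle carries the prior of \<open>\<Lambda>\<close>, the off-support penalty of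
  \<open>\<Lambda>\<close> is used up by the gradient, but a cone condition remains for \<open>\<Theta>\<close>, which is all that the
  restricted isometry property needs. The linear regime is excluded because the bound on \<open>R\<close>
  and the sample size condition together force the squared rate to be small compared with \<open>\<beta>0\<close>.
\<close>

section \<open>Bilinear forms on finite sequences\<close>

text \<open>The region \<open>HPD\<close> is restricted only through \<open>R\<close>, so no
  smallness of the error may be assumed, and a second order expansion would need Hessian bounds
  along a whole segment. An exact remainder formula avoids this: the matrices S_yy and S_xy enter
  the log-likelihood linearly, cancel against the gradient, and leave an expression in which only X
  occurs. All information about the responses is then contained in the gradient bound.

  Each constant of the statement is consumed at one place. \<open>alpha_const\<close> is the opening
  of the cone for \<open>\<Theta> - \<Theta>0\<close>; the second summand of \<open>s0_const\<close>
  is the block length in the restricted isometry argument; \<open>beta0\<close> is the curvature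
  against the squared Frobenius error; \<open>r0_const\<close> enters through the bound on
  \<open>R\<close>. Since that bound refers to the rate and thereby to \<open>C\<close>, the
  constant must be fixed before data, true parameters and \<open>R\<close>; this works because
  \<open>C = 1 + 288 * K\<^sup>2\<close> depends only on the constant \<open>K\<close> behind the
  growth of 1/(n \<nu>0).\<close>

definition dot :: "nat \<Rightarrow> (nat \<Rightarrow> real) \<Rightarrow> (nat \<Rightarrow> real) \<Rightarrow> real" where
  "dot n u v = (\<Sum>i<n. u i * v i)"

definition app :: "nat \<Rightarrow> (nat \<Rightarrow> nat \<Rightarrow> real) \<Rightarrow> (nat \<Rightarrow> real) \<Rightarrow> nat \<Rightarrow> real" where
  "app n A u i = (\<Sum>j<n. A i j * u j)"

text \<open>Vectors and matrices are plain functions with the dimension as a parameter, so that no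
  carrier conditions arise and double sums can be reordered freely; only arguments below
  \<open>n\<close> matter.\<close>

definition bil :: "nat \<Rightarrow> (nat \<Rightarrow> nat \<Rightarrow> real) \<Rightarrow> (nat \<Rightarrow> real) \<Rightarrow> (nat \<Rightarrow> real) \<Rightarrow> real" where
  "bil n A u v = dot n u (app n A v)"

lemma dot_commute: "dot n u v = dot n v u"
  by (simp add: dot_def mult.commute)

lemma dot_add_right: "dot n u (\<lambda>i. v i + w i) = dot n u v + dot n u w"
  by (simp add: dot_def algebra_simps sum.distrib)

lemma dot_scale_right: "dot n u (\<lambda>i. c * v i) = c * dot n u v"
  by (simp add: dot_def sum_distrib_left algebra_simps)

lemma dot_sum_right: "dot n u (\<lambda>i. \<Sum>k\<in>K. v k i) = (\<Sum>k\<in>K. dot n u (v k))"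
proof -
  have "dot n u (\<lambda>i. \<Sum>k\<in>K. v k i) = (\<Sum>i<n. \<Sum>k\<in>K. u i * v k i)"
    by (simp add: dot_def sum_distrib_left)
  then show ?thesis by (simp add: dot_def sum.swap[of _ K])
qed

lemma dot_nonneg: "dot n u u \<ge> 0"
  by (auto simp: dot_def intro: sum_nonneg)

lemma dot_eq_0_iff: "dot n u u = 0 \<longleftrightarrow> (\<forall>i<n. u i = 0)"
  by (auto simp: dot_def sum_nonneg_eq_0_iff)

lemma dot_cong: "(\<And>i. i < n \<Longrightarrow> u i = u' i) \<Longrightarrow> (\<And>i. i < n \<Longrightarrow> v i = v' i) \<Longrightarrow> dot n u v = dot n u' v'"
  by (auto simp: dot_def)

lemma dot_cauchy_schwarz: "(dot n u v)\<^sup>2 \<le> dot n u u * dot n v v"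
  using Cauchy_Schwarz_ineq_sum[where a = u and b = v and I = "{..<n}"] by (simp add: dot_def power2_eq_square)

lemma app_add: "app n A (\<lambda>i. v i + w i) = (\<lambda>i. app n A v i + app n A w i)"
  by (auto simp: app_def algebra_simps sum.distrib)

lemma app_scale: "app n A (\<lambda>i. c * v i) = (\<lambda>i. c * app n A v i)"
  by (auto simp: app_def sum_distrib_left algebra_simps)

lemma app_sum: "app n A (\<lambda>i. \<Sum>k\<in>K. v k i) = (\<lambda>i. \<Sum>k\<in>K. app n A (v k) i)"
proof
  fix i
  have "app n A (\<lambda>i. \<Sum>k\<in>K. v k i) i = (\<Sum>j<n. \<Sum>k\<in>K. A i j * v k j)"
    by (simp add: app_def sum_distrib_left)
  then show "app n A (\<lambda>i. \<Sum>k\<in>K. v k i) i = (\<Sum>k\<in>K. app n A (v k) i)"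
    by (simp add: app_def sum.swap[of _ K])
qed

lemma bil_expand: "bil n A u v = (\<Sum>i<n. \<Sum>j<n. u i * A i j * v j)"
  by (simp add: bil_def dot_def app_def sum_distrib_left mult.assoc)

lemma bil_commute:
  assumes "\<And>i j. i < n \<Longrightarrow> j < n \<Longrightarrow> A i j = A j i"
  shows "bil n A u v = bil n A v u"
proof -
  have "bil n A u v = (\<Sum>j<n. \<Sum>i<n. u i * A i j * v j)"
    by (subst sum.swap) (simp add: bil_expand)
  also have "\<dots> = bil n A v u"
    unfolding bil_expand using assms by (intro sum.cong refl) (auto simp: mult_ac)
  finally show ?thesis .
qed

lemma bil_add_right: "bil n A u (\<lambda>i. v i + w i) = bil n A u v + bil n A u w"
  by (simp add: bil_def app_add dot_add_right)

lemma bil_scale_right: "bil n A u (\<lambda>i. c * v i) = c * bil n A u v"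
  by (simp add: bil_def app_scale dot_scale_right)

lemma bil_add_left: "bil n A (\<lambda>i. v i + w i) u = bil n A v u + bil n A w u"
  by (simp add: bil_def dot_def algebra_simps sum.distrib)

lemma bil_scale_left: "bil n A (\<lambda>i. c * v i) u = c * bil n A v u"
  by (simp add: bil_def dot_def sum_distrib_left algebra_simps)

lemma bil_diff_mat: "bil n (\<lambda>i j. c * A i j - B i j) u v = c * bil n A u v - bil n B u v"
  by (simp add: bil_expand sum_subtractf sum_distrib_left algebra_simps)

lemma bil_cong: "(\<And>i. i < n \<Longrightarrow> u i = u' i) \<Longrightarrow> (\<And>i. i < n \<Longrightarrow> v i = v' i) \<Longrightarrow> bil n A u v = bil n A u' v'"
  by (auto simp: bil_expand)

lemma bil_eigen: "(\<And>i. i < n \<Longrightarrow> app n A v i = c * app n B v i) \<Longrightarrow> bil n A u v = c * bil n B u v"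
  unfolding bil_def using dot_cong[of n u u "app n A v" "\<lambda>i. c * app n B v i"]
  by (simp add: dot_scale_right)

section \<open>Lower bounds for quadratic forms and Rayleigh quotients\<close>

lemma psd_cauchy_schwarz:
  assumes sym: "\<And>i j. i < n \<Longrightarrow> j < n \<Longrightarrow> A i j = A j i"
    and psd: "\<And>u. bil n A u u \<ge> 0"
  shows "(bil n A u v)\<^sup>2 \<le> bil n A u u * bil n A v v"
proof -
  have q: "bil n A u u + 2 * t * bil n A u v + t\<^sup>2 * bil n A v v \<ge> 0" for t
    using psd[of "\<lambda>i. u i + t * v i"] bil_commute[of n A, OF sym, of u v]
    by (simp add: bil_add_right bil_add_left bil_scale_left bil_scale_right algebra_simps power2_eq_square)
  show ?thesis
  proof (cases "bil n A v v = 0")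
    case True
    have "bil n A u v = 0"
    proof (rule ccontr)
      assume "bil n A u v \<noteq> 0"
      \<comment> \<open>With \<open>bil n A v v = 0\<close> the quadratic in \<open>t\<close> is
        affine, and at this \<open>t\<close> its value is -1.\<close>
      then show False using q[of "- (bil n A u u + 1) / (2 * bil n A u v)"] True by (simp add: field_simps)
    qed
    then show ?thesis using True by simp
  next
    case False
    then have "bil n A v v > 0" using psd[of v] by simp
    then show ?thesis using q[of "- bil n A u v / bil n A v v"]
      by (simp add: field_simps power2_eq_square)
  qed
qed

lemma app_norm_bound: "\<exists>c>0. \<forall>u. dot n (app n A u) (app n A u) \<le> c * dot n u u"
proof -
  \<comment> \<open>The squared Frobenius norm of \<open>A\<close>; the summand 1 keeps the constant
    positive when \<open>A\<close> vanishes.\<close>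
  define c where "c = (\<Sum>i<n. \<Sum>j<n. (A i j)\<^sup>2) + 1"
  have "c > 0" unfolding c_def by (smt (verit) sum_nonneg zero_le_power2)
  moreover have "dot n (app n A u) (app n A u) \<le> c * dot n u u" for u
  proof -
    have "(app n A u i)\<^sup>2 \<le> (\<Sum>j<n. (A i j)\<^sup>2) * dot n u u" for i
      using Cauchy_Schwarz_ineq_sum[where a = "A i" and b = u and I = "{..<n}"] by (simp add: app_def dot_def power2_eq_square)
    then have "dot n (app n A u) (app n A u) \<le> (\<Sum>i<n. (\<Sum>j<n. (A i j)\<^sup>2) * dot n u u)"
      unfolding dot_def[of n "app n A u"] by (intro sum_mono) (simp add: power2_eq_square)
    also have "\<dots> \<le> c * dot n u u"
      using dot_nonneg[of n u] by (simp add: c_def sum_distrib_right[symmetric] distrib_right)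
    finally show ?thesis .
  qed
  ultimately show ?thesis by blast
qed

lemma bil_bound: "\<exists>c>0. \<forall>u. \<bar>bil n A u u\<bar> \<le> c * dot n u u"
proof -
  obtain c where c: "c > 0" "\<And>u. dot n (app n A u) (app n A u) \<le> c * dot n u u"
    using app_norm_bound by blast
  have "\<bar>bil n A u u\<bar> \<le> (sqrt c) * dot n u u" for u
  proof -
    have "(bil n A u u)\<^sup>2 \<le> dot n u u * (c * dot n u u)"
      unfolding bil_def
      by (rule order_trans[OF dot_cauchy_schwarz mult_left_mono[OF c(2) dot_nonneg]])
    also have "\<dots> = (sqrt c * dot n u u)\<^sup>2" using c(1) by (simp add: power2_eq_square)
    finally show ?thesis using c(1) dot_nonneg[of n u]
      by (simp add: abs_le_square_iff[symmetric])
  qed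
  then show ?thesis using c(1) by (intro exI[of _ "sqrt c"]) auto
qed

lemma app_to_mat:
  "mat n n (\<lambda>(i, j). A i j) *\<^sub>v vec n u = vec n (app n A u)"
  by (auto simp: app_def scalar_prod_def atLeast0LessThan intro!: eq_vecI sum.cong)

text \<open>The constant is a norm bound for the inverse matrix, which exists because injectivity
  makes the determinant nonzero.\<close>

lemma injective_app_lower_bound:
  assumes inj: "\<And>u. (\<forall>i<n. app n A u i = 0) \<Longrightarrow> (\<forall>i<n. u i = 0)"
  shows "\<exists>c>0. \<forall>u. dot n u u \<le> c * dot n (app n A u) (app n A u)"
proof -
  define Am where "Am = mat n n (\<lambda>(i, j). A i j)"
  have Am: "Am \<in> carrier_mat n n" by (simp add: Am_def)
  have "Determinant.det Am \<noteq> 0"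
  proof
    assume "Determinant.det Am = 0"
    then obtain v where v: "v \<in> carrier_vec n" "v \<noteq> 0\<^sub>v n" "Am *\<^sub>v v = 0\<^sub>v n"
      using det_0_iff_vec_prod_zero[OF Am] by blast
    have "vec n (\<lambda>i. v $ i) = v" using v(1) by auto
    then have "vec n (app n A (\<lambda>i. v $ i)) = 0\<^sub>v n"
      using v(3) app_to_mat[of n A "\<lambda>i. v $ i"] by (simp add: Am_def)
    then have "\<forall>i<n. app n A (\<lambda>i. v $ i) i = 0" by (metis index_vec index_zero_vec(1))
    then have "\<forall>i<n. v $ i = 0" using inj by blast
    then have "v = 0\<^sub>v n" using v(1) by auto
    then show False using v(2) by simp
  qed
  then obtain N where N: "N \<in> carrier_mat n n" "N * Am = 1\<^sub>m n"
    using det_non_zero_imp_unit[OF Am, of "()"] by (auto simp: Units_def ring_mat_def)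
  define B where "B = (\<lambda>i j. N $$ (i, j))"
  have BN: "mat n n (\<lambda>(i, j). B i j) = N" using N(1) by (auto simp: B_def)
  have inv: "app n B (app n A u) i = u i" if "i < n" for u i
  proof -
    have "vec n (app n B (app n A u)) = N *\<^sub>v (Am *\<^sub>v vec n u)"
      unfolding Am_def app_to_mat using app_to_mat[of n B] by (simp add: BN)
    also have "\<dots> = vec n u" using N Am by (simp add: assoc_mult_mat_vec[symmetric, of _ n n])
    finally show ?thesis using that by (metis index_vec)
  qed
  obtain c where c: "c > 0" "\<And>u. dot n (app n B u) (app n B u) \<le> c * dot n u u"
    using app_norm_bound by blast
  have "dot n u u \<le> c * dot n (app n A u) (app n A u)" for u
    using c(2)[of "app n A u"] dot_cong[of n "app n B (app n A u)" u "app n B (app n A u)" u] inv by simp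
  then show ?thesis using c(1) by blast
qed

text \<open>Cauchy-Schwarz for the form \<open>A\<close> between Au and u bounds the square of
  |Au|^2 by a multiple of |Au|^2 times the form at u. Cancelling gives |Au|^2 below a multiple of
  the form, and injectivity bounds |u|^2 by a multiple of |Au|^2.\<close>

lemma psd_injective_lower_bound:
  assumes sym: "\<And>i j. i < n \<Longrightarrow> j < n \<Longrightarrow> A i j = A j i"
    and psd: "\<And>u. bil n A u u \<ge> 0"
    and inj: "\<And>u. (\<forall>i<n. app n A u i = 0) \<Longrightarrow> (\<forall>i<n. u i = 0)"
  shows "\<exists>b>0. \<forall>u. b * dot n u u \<le> bil n A u u"
proof -
  obtain c where c: "c > 0" "\<And>u. dot n u u \<le> c * dot n (app n A u) (app n A u)"
    using injective_app_lower_bound[OF inj] by blast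
  obtain k where k: "k > 0" "\<And>u. \<bar>bil n A u u\<bar> \<le> k * dot n u u"
    using bil_bound by blast
  have le: "dot n (app n A u) (app n A u) \<le> k * bil n A u u" for u
  proof -
    define d where "d = dot n (app n A u) (app n A u)"
    have "bil n A (app n A u) u = d" by (simp add: bil_def d_def)
    then have "d\<^sup>2 \<le> bil n A (app n A u) (app n A u) * bil n A u u"
      using psd_cauchy_schwarz[OF sym psd, of "app n A u" u] by simp
    also have "\<dots> \<le> (k * d) * bil n A u u"
      using k(2)[of "app n A u"] psd[of u] by (intro mult_right_mono) (auto simp: d_def)
    finally have "d * d \<le> d * (k * bil n A u u)" by (simp add: power2_eq_square algebra_simps)
    moreover have "d \<ge> 0" by (simp add: d_def dot_nonneg)
    ultimately show ?thesis using k(1) psd[of u] by (cases "d = 0") (auto simp: d_def)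
  qed
  have "dot n u u \<le> c * (k * bil n A u u)" for u
    by (rule order_trans[OF c(2) mult_left_mono[OF le]]) (use c in auto)
  then show ?thesis using c(1) k(1) by (intro exI[of _ "1 / (c * k)"]) (auto simp: field_simps)
qed

lemma pd_injective:
  assumes "\<And>u. (\<exists>i<n. u i \<noteq> 0) \<Longrightarrow> bil n B u u > 0" and "\<forall>i<n. app n B u i = 0"
  shows "\<forall>i<n. u i = 0"
proof (rule ccontr)
  assume "\<not> ?thesis"
  then have "bil n B u u > 0" using assms(1) by blast
  moreover have "bil n B u u = 0" using assms(2) by (simp add: bil_def dot_def)
  ultimately show False by simp
qed

text \<open>Pointwise positivity becomes uniform without compactness of the sphere: a definite form
  is injective, so the semidefinite bound applies.\<close>

lemma pd_lower_bound:
  assumes sym: "\<And>i j. i < n \<Longrightarrow> j < n \<Longrightarrow> B i j = B j i"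
    and pd: "\<And>u. (\<exists>i<n. u i \<noteq> 0) \<Longrightarrow> bil n B u u > 0"
  shows "\<exists>b>0. \<forall>u. b * dot n u u \<le> bil n B u u"
proof (rule psd_injective_lower_bound[OF sym])
  show "bil n B u u \<ge> 0" for u
  proof (cases "\<exists>i<n. u i \<noteq> 0")
    case False
    then show ?thesis by (auto simp: bil_expand)
  qed (use pd in force)
qed (use pd_injective[OF pd] in blast)+

text \<open>
  If \<open>\<mu>\<close> is the supremum of the generalized Rayleigh quotient, then \<open>\<mu> B - A\<close> is positive
  semidefinite but not bounded below, hence singular; so the supremum is attained at an eigenvector.
\<close>

lemma generalized_Rayleigh_max:
  assumes n: "n \<ge> 1"
    and symA: "\<And>i j. i < n \<Longrightarrow> j < n \<Longrightarrow> A i j = A j i"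
    and symB: "\<And>i j. i < n \<Longrightarrow> j < n \<Longrightarrow> B i j = B j i"
    and pd: "\<And>u. (\<exists>i<n. u i \<noteq> 0) \<Longrightarrow> bil n B u u > 0"
  shows "\<exists>\<mu> v. (\<exists>i<n. v i \<noteq> 0) \<and> (\<forall>i<n. app n A v i = \<mu> * app n B v i) \<and>
    (\<forall>u. bil n A u u \<le> \<mu> * bil n B u u)"
proof -
  obtain b where b: "b > 0" "\<And>u. b * dot n u u \<le> bil n B u u"
    using pd_lower_bound[OF symB pd] by blast
  obtain k where k: "k > 0" "\<And>u. \<bar>bil n A u u\<bar> \<le> k * dot n u u" using bil_bound by blast
  obtain kB where kB: "kB > 0" "\<And>u. \<bar>bil n B u u\<bar> \<le> kB * dot n u u" using bil_bound by blast
  define Q where "Q = {bil n A u u / bil n B u u | u. \<exists>i<n. u i \<noteq> 0}"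
  have ne: "Q \<noteq> {}" unfolding Q_def using n by (auto intro!: exI[of _ "\<lambda>_. 1"] exI[of _ 0])
  have bdd: "bdd_above Q"
  proof (rule bdd_aboveI)
    fix z assume "z \<in> Q"
    then obtain u where u: "\<exists>i<n. u i \<noteq> 0" "z = bil n A u u / bil n B u u" by (auto simp: Q_def)
    have "bil n A u u \<le> k * dot n u u" using k(2)[of u] by simp
    also have "\<dots> \<le> k * (bil n B u u / b)"
      using b k by (intro mult_left_mono) (auto simp: field_simps)
    finally have "bil n A u u \<le> (k / b) * bil n B u u" by simp
    then show "z \<le> k / b" using pd[OF u(1)] u(2) by (simp only: pos_divide_le_eq)
  qed
  define \<mu> where "\<mu> = Sup Q"
  have up: "bil n A u u \<le> \<mu> * bil n B u u" for u
  proof (cases "\<exists>i<n. u i \<noteq> 0")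
    case True
    then have "bil n A u u / bil n B u u \<le> \<mu>"
      unfolding \<mu>_def by (intro cSup_upper bdd) (auto simp: Q_def)
    then show ?thesis using pd[OF True] by (simp add: field_simps)
  qed (auto simp: bil_expand)
  define P where "P = (\<lambda>i j. \<mu> * B i j - A i j)"
  have P: "bil n P u v = \<mu> * bil n B u v - bil n A u v" for u v
    by (simp add: P_def bil_diff_mat)
  have "\<exists>u. (\<forall>i<n. app n P u i = 0) \<and> (\<exists>i<n. u i \<noteq> 0)"
  proof (rule ccontr)
    assume "\<not> ?thesis"
    then have "\<And>u. (\<forall>i<n. app n P u i = 0) \<Longrightarrow> (\<forall>i<n. u i = 0)" by blast
    then obtain c where c: "c > 0" "\<And>u. c * dot n u u \<le> bil n P u u"
      using psd_injective_lower_bound[of n P] symA symB up unfolding P by (auto simp: P_def)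
    \<comment> \<open>The constant \<open>kB\<close> turns the Euclidean lower bound into one
      relative to the form \<open>B\<close>, so every quotient would stay a fixed distance below the
      supremum.\<close>
    have "z \<le> \<mu> - c / kB" if z: "z \<in> Q" for z
    proof -
      obtain u where u: "\<exists>i<n. u i \<noteq> 0" "z = bil n A u u / bil n B u u"
        using z by (auto simp: Q_def)
      have "c * (bil n B u u / kB) \<le> c * dot n u u"
        using kB(2)[of u] kB(1) c(1) by (intro mult_left_mono) (auto simp: field_simps)
      also have "\<dots> \<le> \<mu> * bil n B u u - bil n A u u" using c(2) P by simp
      finally have "bil n A u u \<le> (\<mu> - c / kB) * bil n B u u" by (simp add: left_diff_distrib)
      then show ?thesis using pd[OF u(1)] u(2) by (simp only: pos_divide_le_eq)
    qed
    then have "\<mu> \<le> \<mu> - c / kB" unfolding \<mu>_def using ne by (intro cSup_least) auto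
    then show False using c(1) kB(1) by (simp add: field_simps)
  qed
  then obtain v where v: "\<And>i. i < n \<Longrightarrow> app n P v i = 0" "\<exists>i<n. v i \<noteq> 0" by blast
  have "app n A v i = \<mu> * app n B v i" if "i < n" for i
    using v(1)[OF that] by (simp add: P_def app_def left_diff_distrib sum_subtractf sum_distrib_left mult.assoc)
  then show ?thesis using v(2) up by blast
qed

section \<open>Simultaneous diagonalization\<close>

text \<open>Padding the \<open>k\<close> vectors with zero rows gives a square matrix whose row
  \<open>k\<close> vanishes; its determinant is zero, and a kernel vector is orthogonal to all of
  them.\<close>

lemma exists_orthogonal_vector:
  assumes "k < n"
  shows "\<exists>z. (\<exists>i<n. z i \<noteq> 0) \<and> (\<forall>l<k. dot n (w l) z = 0)"
proof -
  define M where "M = mat n n (\<lambda>(i, j). if i < k then w i j else 0 :: real)"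
  have M: "M \<in> carrier_mat n n" by (simp add: M_def)
  have "Determinant.det M = 0"
    using laplace_expansion_row[OF M assms] assms by (simp add: M_def)
  then obtain v where v: "v \<in> carrier_vec n" "v \<noteq> 0\<^sub>v n" "M *\<^sub>v v = 0\<^sub>v n"
    using det_0_iff_vec_prod_zero[OF M] by blast
  have "\<exists>i<n. v $ i \<noteq> 0" using v(1,2) by (metis carrier_vecD eq_vecI index_zero_vec)
  moreover have "dot n (w l) (\<lambda>i. v $ i) = 0" if "l < k" for l
  proof -
    have "(M *\<^sub>v v) $ l = dot n (w l) (\<lambda>i. v $ i)"
      using that assms v(1) by (auto simp: M_def dot_def scalar_prod_def atLeast0LessThan)
    then show ?thesis using v(3) that assms by simp
  qed
  ultimately show ?thesis by (intro exI[of _ "\<lambda>i. v $ i"]) auto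
qed

text \<open>
  Each step applies the Rayleigh maximum to \<open>A\<close> deflated along the eigenvectors found so far; the
  shift \<open>c\<close> is so large that the new eigenvalue differs from the deflated ones.
\<close>

lemma generalized_eigenbasis:
  assumes symA: "\<And>i j. i < n \<Longrightarrow> j < n \<Longrightarrow> A i j = A j i"
    and symB: "\<And>i j. i < n \<Longrightarrow> j < n \<Longrightarrow> B i j = B j i"
    and pd: "\<And>u. (\<exists>i<n. u i \<noteq> 0) \<Longrightarrow> bil n B u u > 0"
    and "k \<le> n"
  shows "\<exists>P d. (\<forall>i<k. \<forall>j<k. bil n B (P i) (P j) = (if i = j then 1 else 0)) \<and>
               (\<forall>i<k. \<forall>a<n. app n A (P i) a = d i * app n B (P i) a)"
  using \<open>k \<le> n\<close>
proof (induction k)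
  case 0
  then show ?case by simp
next
  case (Suc k)
  then obtain P d where
    P: "\<And>i j. i < k \<Longrightarrow> j < k \<Longrightarrow> bil n B (P i) (P j) = (if i = j then 1 else 0)"
    and d: "\<And>i a. i < k \<Longrightarrow> a < n \<Longrightarrow> app n A (P i) a = d i * app n B (P i) a"
    by (metis Suc_leD)
  obtain K where K: "K > 0" "\<And>u. \<bar>bil n A u u\<bar> \<le> K * bil n B u u"
  proof -
    obtain k where k: "k > 0" "\<And>u. \<bar>bil n A u u\<bar> \<le> k * dot n u u" using bil_bound by blast
    obtain b where b: "b > 0" "\<And>u. b * dot n u u \<le> bil n B u u"
      using pd_lower_bound[OF symB pd] by blast
    have "\<bar>bil n A u u\<bar> \<le> k / b * bil n B u u" for u
    proof -
      have "k * dot n u u \<le> k * (bil n B u u / b)"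
        using k(1) b by (intro mult_left_mono) (auto simp: field_simps)
      then show ?thesis using k(2)[of u] by simp
    qed
    then show ?thesis using that[of "k / b"] k(1) b(1) by simp
  qed
  \<comment> \<open>The earlier eigenvalues are at most \<open>K\<close> and move to at most
    \<open>- K - 1\<close>, while the new maximum turns out to be at least
    \<open>- K\<close>.\<close>
  define c where "c = 2 * K + 1"
  define A' where "A' = (\<lambda>i j. A i j - c * (\<Sum>l<k. app n B (P l) i * app n B (P l) j))"
  have dotB: "dot n (app n B (P l)) u = bil n B u (P l)" for l u
    by (simp add: bil_def dot_commute)
  have app': "app n A' u a = app n A u a - c * (\<Sum>l<k. app n B (P l) a * bil n B u (P l))" for u a
  proof -
    have "(\<Sum>j<n. (\<Sum>l<k. app n B (P l) a * app n B (P l) j) * u j)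
        = (\<Sum>l<k. app n B (P l) a * dot n (app n B (P l)) u)"
      unfolding dot_def sum_distrib_left sum_distrib_right
      by (subst sum.swap) (simp add: mult.assoc)
    moreover have "app n A' u a = (\<Sum>j<n. A a j * u j - c * ((\<Sum>l<k. app n B (P l) a * app n B (P l) j) * u j))"
      unfolding app_def[of n A' u a] by (intro sum.cong refl) (simp add: A'_def algebra_simps)
    ultimately show ?thesis
      by (simp add: sum_subtractf sum_distrib_left[symmetric] app_def[of n A] dotB)
  qed
  have symA': "A' i j = A' j i" if "i < n" "j < n" for i j
    using symA[OF that] by (simp add: A'_def mult.commute)
  have n: "1 \<le> n" using Suc.prems by simp
  obtain \<mu> v where v: "\<exists>i<n. v i \<noteq> 0" "\<And>i. i < n \<Longrightarrow> app n A' v i = \<mu> * app n B v i"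
    "\<And>u. bil n A' u u \<le> \<mu> * bil n B u u"
    using generalized_Rayleigh_max[OF n, of A' B, OF symA' symB pd] by blast
  \<comment> \<open>A nonzero vector that is \<open>B\<close>-orthogonal to the earlier eigenvectors
    exists since \<open>k < n\<close>, and the deflation does not act on it.\<close>
  have "\<mu> \<ge> - K"
  proof -
    obtain z where z: "\<exists>i<n. z i \<noteq> 0" "\<forall>l<k. dot n (app n B (P l)) z = 0"
      using exists_orthogonal_vector[of k n "\<lambda>l. app n B (P l)"] Suc.prems by auto
    have "app n A' z a = app n A z a" for a using z(2) by (simp add: app' dotB)
    then have "bil n A' z z = bil n A z z" by (simp add: bil_def dot_def)
    then have "- K * bil n B z z \<le> \<mu> * bil n B z z"
      using K(2)[of z] v(3)[of z] by simp
    then show ?thesis using pd[OF z(1)] by (simp only: mult_le_cancel_right_pos)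
  qed
  \<comment> \<open>Both \<open>v\<close> and \<open>P l\<close> are eigenvectors of the deflated
    form relative to \<open>B\<close>, with different eigenvalues, hence
    \<open>B\<close>-orthogonal. The deflation therefore vanishes at \<open>v\<close>, which makes
    \<open>v\<close> an eigenvector of \<open>A\<close> itself.\<close>
  have orth: "bil n B v (P l) = 0" if l: "l < k" for l
  proof -
    have "d l = bil n A (P l) (P l)"
      using bil_eigen[of n A "P l" "d l" B "P l"] d l P by simp
    then have "d l \<le> K" using K(2)[of "P l"] P[OF l l] by simp
    have "(\<Sum>l'<k. app n B (P l') a * bil n B (P l) (P l')) = app n B (P l) a" for a
    proof -
      have "(\<Sum>l'<k. app n B (P l') a * bil n B (P l) (P l'))
          = (\<Sum>l'<k. if l = l' then app n B (P l') a else 0)"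
        using P l by (intro sum.cong refl) auto
      then show ?thesis using l by simp
    qed
    then have "app n A' (P l) a = (d l - c) * app n B (P l) a" if "a < n" for a
      using d[OF l that] by (simp add: app' algebra_simps)
    then have "bil n A' v (P l) = (d l - c) * bil n B v (P l)" by (rule bil_eigen)
    moreover have "bil n A' (P l) v = \<mu> * bil n B (P l) v" using v(2) by (rule bil_eigen)
    ultimately have "(d l - c) * bil n B v (P l) = \<mu> * bil n B v (P l)"
      using bil_commute[of n A', OF symA', of v "P l"] bil_commute[of n B, OF symB, of v "P l"] by metis
    then have "bil n B v (P l) = 0 \<or> d l - c = \<mu>" by (simp only: mult_cancel_right)
    then show ?thesis using \<open>\<mu> \<ge> - K\<close> \<open>d l \<le> K\<close> K(1) by (auto simp: c_def)
  qed
  define r where "r = bil n B v v"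
  have "r > 0" using pd[OF v(1)] by (simp add: r_def)
  define u where "u = (\<lambda>i. (1 / sqrt r) * v i)"
  have uu: "bil n B u u = 1"
    using \<open>r > 0\<close> unfolding u_def bil_scale_left bil_scale_right r_def[symmetric] by simp
  have uP: "bil n B u (P l) = 0" "bil n B (P l) u = 0" if "l < k" for l
    using orth[OF that] bil_commute[of n B, OF symB, of "P l" v]
    unfolding u_def bil_scale_left bil_scale_right by simp_all
  have uA: "app n A u a = \<mu> * app n B u a" if "a < n" for a
    using v(2)[OF that] orth unfolding u_def app_scale by (simp add: app')
  show ?case
  proof (intro exI conjI)
    show "\<forall>i<Suc k. \<forall>j<Suc k. bil n B ((P(k := u)) i) ((P(k := u)) j) = (if i = j then 1 else 0)"
      using P uu uP by (auto simp: less_Suc_eq)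
    show "\<forall>i<Suc k. \<forall>a<n. app n A ((P(k := u)) i) a = (d(k := \<mu>)) i * app n B ((P(k := u)) i) a"
      using d uA by (auto simp: less_Suc_eq)
  qed
qed

section \<open>Eigenvalues of symmetric matrices\<close>

abbreviation entries :: "real mat \<Rightarrow> nat \<Rightarrow> nat \<Rightarrow> real" where
  "entries A \<equiv> \<lambda>i j. A $$ (i, j)"

lemma quad_form_vec:
  "A \<in> carrier_mat n n \<Longrightarrow> quad_form A (vec n u) = bil n (entries A) u u"
  by (auto simp: quad_form_def bil_def dot_def app_def scalar_prod_def atLeast0LessThan
      intro!: sum.cong)

lemma sym_pos_def_sym:
  assumes "sym_pos_def n A" "i < n" "j < n"
  shows "A $$ (i, j) = A $$ (j, i)"
  using assms unfolding sym_pos_def_def by (metis carrier_matD index_transpose_mat(1))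

lemma sym_pos_def_pd:
  assumes "sym_pos_def n A" "\<exists>i<n. u i \<noteq> 0"
  shows "bil n (entries A) u u > 0"
proof -
  have "vec n u \<noteq> 0\<^sub>v n" using assms(2) by (metis index_vec index_zero_vec(1))
  then show ?thesis using assms(1) quad_form_vec[of A n u] by (auto simp: sym_pos_def_def)
qed

lemma eigenvalue_iff_app:
  assumes A: "A \<in> carrier_mat n n"
  shows "eigenvalue A k \<longleftrightarrow> (\<exists>v. (\<exists>i<n. v i \<noteq> 0) \<and> (\<forall>i<n. app n (entries A) v i = k * v i))"
proof
  assume "eigenvalue A k"
  then obtain v where v: "v \<in> carrier_vec n" "v \<noteq> 0\<^sub>v n" "A *\<^sub>v v = k \<cdot>\<^sub>v v"
    using A by (auto simp: eigenvalue_def eigenvector_def)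
  have "\<exists>i<n. v $ i \<noteq> 0" using v(1,2) by (metis carrier_vecD eq_vecI index_zero_vec)
  moreover have "app n (entries A) (\<lambda>i. v $ i) i = k * v $ i" if "i < n" for i
  proof -
    have "(A *\<^sub>v v) $ i = app n (entries A) (\<lambda>i. v $ i) i"
      using that v(1) A by (auto simp: app_def scalar_prod_def atLeast0LessThan)
    then show ?thesis using v that by simp
  qed
  ultimately show "\<exists>v. (\<exists>i<n. v i \<noteq> 0) \<and> (\<forall>i<n. app n (entries A) v i = k * v i)"
    by (intro exI[of _ "\<lambda>i. v $ i"]) auto
next
  assume "\<exists>v. (\<exists>i<n. v i \<noteq> 0) \<and> (\<forall>i<n. app n (entries A) v i = k * v i)"
  then obtain v where v: "\<exists>i<n. v i \<noteq> 0" "\<And>i. i < n \<Longrightarrow> app n (entries A) v i = k * v i" by blast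
  have "vec n v \<noteq> 0\<^sub>v n" using v(1) by (metis index_vec index_zero_vec(1))
  moreover have "A *\<^sub>v vec n v = k \<cdot>\<^sub>v vec n v"
    using A v(2) by (intro eq_vecI) (auto simp: app_def scalar_prod_def atLeast0LessThan)
  ultimately show "eigenvalue A k"
    using A unfolding eigenvalue_def eigenvector_def by (intro exI[of _ "vec n v"]) auto
qed

text \<open>Without finiteness the \<open>Max\<close> and \<open>Min\<close> in
  \<open>eig_max\<close> and \<open>eig_min\<close> would be arbitrary values.\<close>

lemma finite_eigenvalues:
  assumes A: "A \<in> carrier_mat n n"
  shows "finite {k. eigenvalue A (k :: real)}"
proof -
  have "char_poly A \<noteq> 0" using degree_monic_char_poly[OF A] by auto
  then show ?thesis using eigenvalue_root_char_poly[OF A] poly_roots_finite[of "char_poly A"] by simp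
qed

lemma Rayleigh_max:
  assumes n: "n \<ge> 1" and sym: "\<And>i j. i < n \<Longrightarrow> j < n \<Longrightarrow> A i j = A j i"
  shows "\<exists>\<mu> v. (\<exists>i<n. v i \<noteq> 0) \<and> (\<forall>i<n. app n A v i = \<mu> * v i) \<and>
    (\<forall>u. bil n A u u \<le> \<mu> * dot n u u)"
proof -
  define I where "I = (\<lambda>i j :: nat. if i = j then 1 else 0 :: real)"
  have app: "app n I u i = u i" if "i < n" for u i
    using that by (simp add: app_def I_def if_distrib[of "\<lambda>z. z * _"] cong: if_cong)
  have bil: "bil n I u u = dot n u u" for u
    unfolding bil_def by (rule dot_cong) (auto simp: app)
  have "dot n u u > 0" if "\<exists>i<n. u i \<noteq> 0" for u
    using dot_nonneg[of n u] dot_eq_0_iff[of n u] that by (auto simp: less_le)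
  then have pd: "bil n I u u > 0" if "\<exists>i<n. u i \<noteq> 0" for u
    using that unfolding bil .
  have "I i j = I j i" for i j by (simp add: I_def)
  then obtain \<mu> v where v: "\<exists>i<n. v i \<noteq> 0" "\<forall>i<n. app n A v i = \<mu> * app n I v i"
    "\<forall>u. bil n A u u \<le> \<mu> * bil n I u u"
    using generalized_Rayleigh_max[OF n, of A I, OF sym _ pd] by blast
  show ?thesis
    using v by (intro exI[of _ \<mu>] exI[of _ v]) (simp add: app bil)
qed

lemma bil_eigenvector:
  "(\<And>i. i < n \<Longrightarrow> app n A v i = k * v i) \<Longrightarrow> bil n A v v = k * dot n v v"
  unfolding bil_def using dot_cong[of n v v "app n A v" "\<lambda>i. k * v i"] by (simp add: dot_scale_right)

lemma dot_pos: "\<exists>i<n. u i \<noteq> 0 \<Longrightarrow> dot n u u > 0"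
  using dot_nonneg[of n u] dot_eq_0_iff[of n u] by (auto simp: less_le)

text \<open>The Rayleigh maximum is an eigenvalue and dominates all others, which identifies it with
  the \<open>Max\<close> in \<open>eig_max\<close>.\<close>

lemma eig_max_symmetric:
  assumes n: "n \<ge> 1" and A: "A \<in> carrier_mat n n"
    and sym: "\<And>i j. i < n \<Longrightarrow> j < n \<Longrightarrow> A $$ (i, j) = A $$ (j, i)"
  shows "bil n (entries A) u u \<le> eig_max A * dot n u u" and "eigenvalue A (eig_max A)"
    and "eigenvalue A k \<Longrightarrow> k \<le> eig_max A"
proof -
  obtain \<mu> v where v: "\<exists>i<n. v i \<noteq> 0" "\<And>i. i < n \<Longrightarrow> app n (entries A) v i = \<mu> * v i"
    "\<And>u. bil n (entries A) u u \<le> \<mu> * dot n u u"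
    using Rayleigh_max[OF n, of "entries A", OF sym] by blast
  have ev: "eigenvalue A \<mu>" using eigenvalue_iff_app[OF A] v(1,2) by blast
  have "k \<le> \<mu>" if k: "eigenvalue A k" for k
  proof -
    obtain w where w: "\<exists>i<n. w i \<noteq> 0" "\<forall>i<n. app n (entries A) w i = k * w i"
      using k eigenvalue_iff_app[OF A] by blast
    then have "k * dot n w w \<le> \<mu> * dot n w w"
      using bil_eigenvector[of n "entries A" w k] v(3)[of w] by simp
    then show ?thesis using dot_pos[OF w(1)] by simp
  qed
  then have "eig_max A = \<mu>"
    unfolding eig_max_def using finite_eigenvalues[OF A] ev by (intro Max_eqI) auto
  then show "bil n (entries A) u u \<le> eig_max A * dot n u u" "eigenvalue A (eig_max A)"
    using v(3) ev by auto
  show "k \<le> eig_max A" if "eigenvalue A k"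
    unfolding eig_max_def using finite_eigenvalues[OF A] that by simp
qed

lemma eig_min_symmetric:
  assumes n: "n \<ge> 1" and A: "A \<in> carrier_mat n n"
    and sym: "\<And>i j. i < n \<Longrightarrow> j < n \<Longrightarrow> A $$ (i, j) = A $$ (j, i)"
  shows "bil n (entries A) u u \<ge> eig_min A * dot n u u" and "eigenvalue A (eig_min A)"
    and "eigenvalue A k \<Longrightarrow> eig_min A \<le> k"
proof -
  have neg: "app n (\<lambda>i j. - A $$ (i, j)) u i = - app n (entries A) u i"
    "bil n (\<lambda>i j. - A $$ (i, j)) u u = - bil n (entries A) u u" for u i
    by (simp_all add: app_def bil_expand sum_negf)
  obtain \<mu> v where v: "\<exists>i<n. v i \<noteq> 0"
    "\<And>i. i < n \<Longrightarrow> app n (\<lambda>i j. - A $$ (i, j)) v i = \<mu> * v i"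
    "\<And>u. bil n (\<lambda>i j. - A $$ (i, j)) u u \<le> \<mu> * dot n u u"
    using Rayleigh_max[OF n, of "\<lambda>i j. - A $$ (i, j)"] sym by auto
  have "app n (entries A) v i = - \<mu> * v i" if "i < n" for i using v(2)[OF that] neg by simp
  then have ev: "eigenvalue A (- \<mu>)" using eigenvalue_iff_app[OF A] v(1) by blast
  have lo: "bil n (entries A) u u \<ge> - \<mu> * dot n u u" for u using v(3)[of u] neg by simp
  have "- \<mu> \<le> k" if k: "eigenvalue A k" for k
  proof -
    obtain w where w: "\<exists>i<n. w i \<noteq> 0" "\<forall>i<n. app n (entries A) w i = k * w i"
      using k eigenvalue_iff_app[OF A] by blast
    then have "- \<mu> * dot n w w \<le> k * dot n w w"
      using bil_eigenvector[of n "entries A" w k] lo[of w] by simp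
    then show ?thesis using dot_pos[OF w(1)] by (simp only: mult_le_cancel_right_pos)
  qed
  then have "eig_min A = - \<mu>"
    unfolding eig_min_def using finite_eigenvalues[OF A] ev by (intro Min_eqI) auto
  then show "bil n (entries A) u u \<ge> eig_min A * dot n u u" "eigenvalue A (eig_min A)"
    using lo ev by auto
  show "eig_min A \<le> k" if "eigenvalue A k"
    unfolding eig_min_def using finite_eigenvalues[OF A] that by simp
qed

lemma eigenvalue_pos_def:
  assumes "sym_pos_def n A" "eigenvalue A k"
  shows "k > 0"
proof -
  have A: "A \<in> carrier_mat n n" using assms(1) by (simp add: sym_pos_def_def)
  obtain w where w: "\<exists>i<n. w i \<noteq> 0" "\<forall>i<n. app n (entries A) w i = k * w i"
    using assms(2) eigenvalue_iff_app[OF A] by blast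
  then have "k * dot n w w > 0"
    using bil_eigenvector[of n "entries A" w k] sym_pos_def_pd[OF assms(1) w(1)] by simp
  then show ?thesis using dot_pos[OF w(1)] by (simp add: zero_less_mult_iff)
qed

lemma eigenvalue_smult:
  fixes A :: "real mat"
  assumes A: "A \<in> carrier_mat n n" and "eigenvalue A k"
  shows "eigenvalue (c \<cdot>\<^sub>m A) (c * k)"
proof -
  obtain w where w: "\<exists>i<n. w i \<noteq> 0" "\<forall>i<n. app n (entries A) w i = k * w i"
    using assms eigenvalue_iff_app[OF A] by blast
  have "app n (entries (c \<cdot>\<^sub>m A)) w i = c * k * w i" if "i < n" for i
    using that w(2) A by (auto simp: app_def sum_distrib_left[symmetric] mult.assoc)
  moreover have "c \<cdot>\<^sub>m A \<in> carrier_mat n n" using A by simp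
  ultimately show ?thesis using eigenvalue_iff_app w(1) by blast
qed

text \<open>The square of an eigenvalue of a symmetric \<open>A\<close> is an eigenvalue of its Gram
  matrix. The inequality bounds \<open>R\<close> from below, and so turns the upper bound on
  \<open>R\<close> into an upper bound on the rate.\<close>

lemma eig_max_le_spectral_norm:
  assumes n: "n \<ge> 1" and A: "sym_pos_def n A"
  shows "eig_max A \<le> spectral_norm A"
proof -
  have Ac: "A \<in> carrier_mat n n" and tr: "transpose_mat A = A" using A by (auto simp: sym_pos_def_def)
  note sym = sym_pos_def_sym[OF A]
  have AA: "A * A \<in> carrier_mat n n" using Ac by simp
  have symAA: "(A * A) $$ (i, j) = (A * A) $$ (j, i)" if "i < n" "j < n" for i j
    using that Ac sym by (auto simp: scalar_prod_def mult.commute intro!: sum.cong)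
  obtain v where v: "v \<in> carrier_vec n" "v \<noteq> 0\<^sub>v n" "A *\<^sub>v v = eig_max A \<cdot>\<^sub>v v"
    using eig_max_symmetric(2)[OF n Ac sym] Ac by (auto simp: eigenvalue_def eigenvector_def)
  have "(A * A) *\<^sub>v v = eig_max A \<cdot>\<^sub>v (eig_max A \<cdot>\<^sub>v v)"
    using Ac v by (simp add: assoc_mult_mat_vec[of A n n A n v] mult_mat_vec[of A n n])
  then have "eigenvalue (A * A) ((eig_max A)\<^sup>2)"
    using v Ac by (auto simp: eigenvalue_def eigenvector_def power2_eq_square smult_smult_assoc)
  then have "(eig_max A)\<^sup>2 \<le> eig_max (A * A)" using eig_max_symmetric(3)[OF n AA symAA] by blast
  moreover have "eig_max A > 0"
    using eigenvalue_pos_def[OF A] eig_max_symmetric(2)[OF n Ac sym] by blast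
  ultimately show ?thesis unfolding spectral_norm_def tr by (simp add: real_le_rsqrt)
qed

text \<open>Since \<open>mat_inv\<close> passes through an option, invertibility must first rule out
  \<open>None\<close>; uniqueness of inverses then identifies the value.\<close>

lemma mat_inv_eqI:
  assumes A: "A \<in> carrier_mat n n" and B: "B \<in> carrier_mat n n" and AB: "A * B = 1\<^sub>m n"
  shows "mat_inv A = B"
proof -
  have BA: "B * A = 1\<^sub>m n" by (rule mat_mult_left_right_inverse[OF A B AB])
  have "A \<in> Units (ring_mat TYPE(real) n ())"
    using A B AB BA by (auto simp: Units_def ring_mat_def)
  then obtain C where C: "mat_inverse A = Some C"
    using mat_inverse(1)[OF A, of "()"] by (cases "mat_inverse A") blast+
  then have CA: "C * A = 1\<^sub>m n" and Cc: "C \<in> carrier_mat n n" using mat_inverse(2)[OF A C] by auto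
  have "C = B" using assoc_mult_mat[OF Cc A B] unfolding CA AB using Cc B by simp
  then show ?thesis using C by (simp add: mat_inv_def)
qed

section \<open>Restricted eigenvalues\<close>

text \<open>\<open>T\<close> consists of \<open>k\<close> largest values, collected by repeatedly
  adding a maximum of the rest; whatever is left lies below the average over
  \<open>T\<close>.\<close>

lemma top_subset:
  fixes f :: "'b \<Rightarrow> real"
  assumes "finite F" "k \<le> card F" "k \<ge> 1"
  obtains T where "T \<subseteq> F" "card T = k"
    "\<And>x. x \<in> F - T \<Longrightarrow> real k * f x \<le> sum f T"
proof -
  have "\<exists>T. T \<subseteq> F \<and> card T = j \<and> (\<forall>x\<in>F - T. \<forall>y\<in>T. f x \<le> f y)" if "j \<le> card F" for j
    using that
  proof (induction j)
    case 0
    then show ?case by (intro exI[of _ "{}"]) auto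
  next
    case (Suc j)
    then obtain T where T: "T \<subseteq> F" "card T = j" "\<forall>x\<in>F - T. \<forall>y\<in>T. f x \<le> f y" by auto
    have fin: "finite (F - T)" "finite T" using assms(1) T(1) finite_subset by auto
    have ne: "F - T \<noteq> {}"
      using Suc.prems T assms(1) card_mono[OF fin(2), of F] by auto
    obtain z where z: "z \<in> F - T" "f z = Max (f ` (F - T))"
      using Max_in[of "f ` (F - T)"] fin ne by (metis (no_types, lifting) finite_imageI image_iff image_is_empty)
    have "f x \<le> f z" if "x \<in> F - T" for x using z that fin by simp
    then show ?case
      using T z fin by (intro exI[of _ "insert z T"]) auto
  qed
  then obtain T where T: "T \<subseteq> F" "card T = k" "\<forall>x\<in>F - T. \<forall>y\<in>T. f x \<le> f y"
    using assms(2) by blast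
  have "real k * f x \<le> sum f T" if "x \<in> F - T" for x
    using sum_bounded_below[of T "f x" f] T that by auto
  then show ?thesis using that T by blast
qed

text \<open>
  The block decomposition behind restricted isometry arguments: order the indices by decreasing
  \<open>f\<close> and cut them into blocks of size \<open>k\<close>. The entries of a block are at most the average of
  the preceding block, so its 2-norm is at most \<open>1 / sqrt k\<close> times the 1-norm of that block.
\<close>

lemma block_decomposition_aux:
  fixes f :: "'b \<Rightarrow> real" and g :: "'b set \<Rightarrow> real"
  assumes "finite F" and k: "k \<ge> 1" and "c \<ge> 0" and f0: "\<And>x. f x \<ge> 0"
    and sub: "\<And>A B. A \<subseteq> F \<Longrightarrow> B \<subseteq> F \<Longrightarrow> A \<inter> B = {} \<Longrightarrow> g (A \<union> B) \<le> g A + g B"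
    and small: "\<And>A. A \<subseteq> F \<Longrightarrow> card A \<le> k \<Longrightarrow> g A \<le> c * sqrt (\<Sum>x\<in>A. (f x)\<^sup>2)"
    and M: "\<And>x. x \<in> F \<Longrightarrow> f x \<le> M" and "M \<ge> 0"
  shows "g F \<le> c * (sqrt k * M + sum f F / sqrt k)"
  using assms(1) sub small M \<open>M \<ge> 0\<close>
proof (induction "card F" arbitrary: F M rule: less_induct)
  case less
  have block: "sqrt (\<Sum>x\<in>A. (f x)\<^sup>2) \<le> sqrt k * M" if "A \<subseteq> F" "card A \<le> k" for A
  proof -
    have "(\<Sum>x\<in>A. (f x)\<^sup>2) \<le> of_nat (card A) * M\<^sup>2"
      using that less.prems(4) f0 by (intro sum_bounded_above power_mono) auto
    also have "\<dots> \<le> real k * M\<^sup>2" using that by (intro mult_right_mono) auto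
    finally have "sqrt (\<Sum>x\<in>A. (f x)\<^sup>2) \<le> sqrt (real k * M\<^sup>2)" by simp
    then show ?thesis using less.prems(5) by (simp add: real_sqrt_mult)
  qed
  show ?case
  proof (cases "card F \<le> k")
    case True
    have "g F \<le> c * (sqrt k * M)"
      using less.prems(3)[of F] True mult_left_mono[OF block[of F] \<open>c \<ge> 0\<close>] by simp
    also have "\<dots> \<le> c * (sqrt k * M + sum f F / sqrt k)"
      using \<open>c \<ge> 0\<close> f0 by (intro mult_left_mono) (simp_all add: sum_nonneg)
    finally show ?thesis .
  next
    case False
    obtain T where T: "T \<subseteq> F" "card T = k" "\<And>x. x \<in> F - T \<Longrightarrow> real k * f x \<le> sum f T"
      using top_subset[OF less.prems(1) _ k, of f] False by (metis nat_le_linear)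
    \<comment> \<open>The average over the removed block bounds all remaining entries and is the
      \<open>M\<close> of the recursive call.\<close>
    define M' where "M' = sum f T / k"
    have finT: "finite T" using T less.prems(1) finite_subset by blast
    have "card (F - T) < card F"
      using T k less.prems(1) False by (simp add: card_Diff_subset[OF finT T(1)])
    then have "g (F - T) \<le> c * (sqrt k * M' + sum f (F - T) / sqrt k)"
    proof (rule less.hyps)
      show "f x \<le> M'" if "x \<in> F - T" for x
        using T(3)[OF that] k by (simp add: M'_def field_simps)
      show "0 \<le> M'" using f0 by (simp add: M'_def sum_nonneg)
    qed (use less.prems in \<open>auto intro: less.prems(2,3)\<close>)
    \<comment> \<open>The 1-norm of a block pays for the block after it, so the contributions add up
      to the 1-norm on all of \<open>F\<close>.\<close>
    also have "sqrt k * M' = sum f T / sqrt k"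
      using k by (simp add: M'_def field_simps)
    finally have 1: "g (F - T) \<le> c * (sum f F / sqrt k)"
      using sum.subset_diff[OF T(1) less.prems(1), of f] by (simp add: add_divide_distrib add.commute)
    have "g F \<le> g T + g (F - T)"
      using less.prems(2)[of T "F - T"] T(1) by (simp add: Un_absorb1)
    also have "g T \<le> c * (sqrt k * M)"
      using less.prems(3)[of T] T mult_left_mono[OF block[of T] \<open>c \<ge> 0\<close>] by simp
    finally show ?thesis using 1 by (simp add: distrib_left)
  qed
qed

text \<open>Setting the first block \<open>T\<close> aside removes the term with \<open>M\<close>.
  The set \<open>T\<close> is obtained before \<open>c\<close> and \<open>g\<close> are chosen,
  because one and the same \<open>T\<close> has to serve two different seminorms.\<close>

lemma block_decomposition:
  fixes f :: "'b \<Rightarrow> real"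
  assumes "finite F" and k: "k \<ge> 1" and f0: "\<And>x. f x \<ge> 0"
  obtains T where "T \<subseteq> F" "card T \<le> k"
    "\<And>c g. c \<ge> 0 \<Longrightarrow> (\<And>A B. A \<inter> B = {} \<Longrightarrow> g (A \<union> B) \<le> g A + g B) \<Longrightarrow>
       (\<And>A. card A \<le> k \<Longrightarrow> A \<subseteq> F \<Longrightarrow> g A \<le> c * sqrt (\<Sum>x\<in>A. (f x)\<^sup>2)) \<Longrightarrow>
       g (F - T) \<le> c * (sum f F / sqrt k)"
proof (cases "card F \<le> k")
  case True
  have "g (F - F) \<le> c * (sum f F / sqrt k)"
    if "c \<ge> 0" "\<And>A. card A \<le> k \<Longrightarrow> A \<subseteq> F \<Longrightarrow> g A \<le> c * sqrt (\<Sum>x\<in>A. (f x)\<^sup>2)" for c and g :: "'b set \<Rightarrow> real"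
  proof -
    have "g {} \<le> 0" using that(2)[of "{}"] by simp
    also have "0 \<le> c * (sum f F / sqrt k)" using that(1) f0 by (simp add: sum_nonneg)
    finally show ?thesis by simp
  qed
  then show ?thesis using that[of F] True by blast
next
  case False
  obtain T where T: "T \<subseteq> F" "card T = k" "\<And>x. x \<in> F - T \<Longrightarrow> real k * f x \<le> sum f T"
    using top_subset[OF assms(1) _ k, of f] False by (metis nat_le_linear)
  define M' where "M' = sum f T / k"
  have finT: "finite T" using T assms(1) finite_subset by blast
  have "g (F - T) \<le> c * (sum f F / sqrt k)"
    if "c \<ge> 0" "\<And>A B. A \<inter> B = {} \<Longrightarrow> g (A \<union> B) \<le> g A + g B"
      "\<And>A. card A \<le> k \<Longrightarrow> A \<subseteq> F \<Longrightarrow> g A \<le> c * sqrt (\<Sum>x\<in>A. (f x)\<^sup>2)" for c and g :: "'b set \<Rightarrow> real"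
  proof -
    have "g (F - T) \<le> c * (sqrt k * M' + sum f (F - T) / sqrt k)"
    proof (rule block_decomposition_aux[OF _ k that(1) f0])
      show "f x \<le> M'" if "x \<in> F - T" for x
        using T(3)[OF that] k by (simp add: M'_def field_simps)
      show "0 \<le> M'" using f0 by (simp add: M'_def sum_nonneg)
    qed (use assms(1) in \<open>auto intro: that\<close>)
    also have "sqrt k * M' = sum f T / sqrt k"
      using k by (simp add: M'_def field_simps)
    finally show ?thesis
      using sum.subset_diff[OF T(1) assms(1), of f] by (simp add: add_divide_distrib add.commute)
  qed
  then show ?thesis using that[of T] T by blast
qed

section \<open>The restricted eigenvalue inequality for matrices\<close>

context
  fixes n q p :: nat and x Y :: "nat \<Rightarrow> nat \<Rightarrow> real"
begin

text \<open>Here \<open>Y\<close> is not the response but the matrix under study, later the error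
  \<open>\<Theta> - \<Theta>0\<close>. With X the design matrix and \<open>Y\<close> set to zero
  outside \<open>T\<close>, these are the entries of X Y / sqrt n, and \<open>block_norm\<close> is
  their Frobenius norm.\<close>

definition block_resp :: "(nat \<times> nat) set \<Rightarrow> nat \<times> nat \<Rightarrow> real" where
  "block_resp T = (\<lambda>(k, j). (\<Sum>i<q. x k i * (if (i, j) \<in> T then Y i j else 0)) / sqrt (real n))"

definition block_norm :: "(nat \<times> nat) set \<Rightarrow> real" where
  "block_norm T = L2_set (block_resp T) ({..<n} \<times> {..<p})"

lemma block_resp_Un: "A \<inter> B = {} \<Longrightarrow> block_resp (A \<union> B) kj = block_resp A kj + block_resp B kj"
  unfolding block_resp_def
  by (auto simp: case_prod_beta add_divide_distrib[symmetric] sum.distrib[symmetric] distrib_left[symmetric]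
      intro!: arg_cong2[of _ _ _ _ "(/)"] sum.cong)

lemma block_norm_Un: "A \<inter> B = {} \<Longrightarrow> block_norm (A \<union> B) \<le> block_norm A + block_norm B"
  unfolding block_norm_def block_resp_Un[THEN ext] by (rule L2_set_triangle_ineq)

lemma block_norm_Un_lower:
  assumes "A \<inter> B = {}"
  shows "block_norm A \<le> block_norm (A \<union> B) + block_norm B"
proof -
  have "block_norm A = L2_set (\<lambda>kj. block_resp (A \<union> B) kj + - block_resp B kj) ({..<n} \<times> {..<p})"
    unfolding block_norm_def using assms by (simp add: block_resp_Un)
  also have "\<dots> \<le> block_norm (A \<union> B) + L2_set (\<lambda>kj. - block_resp B kj) ({..<n} \<times> {..<p})"
    unfolding block_norm_def by (rule L2_set_triangle_ineq)
  also have "L2_set (\<lambda>kj. - block_resp B kj) ({..<n} \<times> {..<p}) = block_norm B"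
    by (simp add: block_norm_def L2_set_def)
  finally show ?thesis .
qed

lemma block_norm_sq:
  "(block_norm T)\<^sup>2 = (\<Sum>j<p. (\<Sum>k<n. (dot q (x k) (\<lambda>i. if (i, j) \<in> T then Y i j else 0))\<^sup>2) / real n)"
proof -
  have "(block_norm T)\<^sup>2 = (\<Sum>kj\<in>{..<n} \<times> {..<p}. (block_resp T kj)\<^sup>2)"
    by (simp add: block_norm_def L2_set_def sum_nonneg)
  also have "\<dots> = (\<Sum>k<n. \<Sum>j<p. (dot q (x k) (\<lambda>i. if (i, j) \<in> T then Y i j else 0))\<^sup>2 / real n)"
    unfolding sum.cartesian_product block_resp_def dot_def
    by (intro sum.cong refl) (auto simp: power_divide)
  also have "\<dots> = (\<Sum>j<p. (\<Sum>k<n. (dot q (x k) (\<lambda>i. if (i, j) \<in> T then Y i j else 0))\<^sup>2) / real n)"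
    by (subst sum.swap) (simp add: sum_divide_distrib)
  finally show ?thesis .
qed

lemma block_columns:
  assumes "T \<subseteq> {..<q} \<times> {..<p}"
  shows "(\<Sum>j<p. dot q (\<lambda>i. if (i, j) \<in> T then Y i j else 0) (\<lambda>i. if (i, j) \<in> T then Y i j else 0))
    = (\<Sum>(i, j)\<in>T. (Y i j)\<^sup>2)"
proof -
  have "(\<Sum>j<p. dot q (\<lambda>i. if (i, j) \<in> T then Y i j else 0) (\<lambda>i. if (i, j) \<in> T then Y i j else 0))
      = (\<Sum>i<q. \<Sum>j<p. if (i, j) \<in> T then (Y i j)\<^sup>2 else 0)"
    unfolding dot_def by (subst sum.swap) (intro sum.cong refl, auto simp: power2_eq_square)
  also have "\<dots> = (\<Sum>ij\<in>{..<q} \<times> {..<p}. if ij \<in> T then (case ij of (i, j) \<Rightarrow> (Y i j)\<^sup>2) else 0)"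
    unfolding sum.cartesian_product by (intro sum.cong refl) auto
  also have "\<dots> = (\<Sum>(i, j)\<in>T. (Y i j)\<^sup>2)"
    using assms by (subst sum.inter_restrict[symmetric]) (auto intro!: sum.cong)
  finally show ?thesis .
qed

text \<open>Isometry for vectors carries over to matrices column by column, since each column meets
  \<open>T\<close> in at most \<open>card T\<close> rows.\<close>

lemma block_norm_bounds:
  assumes rip: "\<And>u. card {i. i < q \<and> u i \<noteq> 0} \<le> s \<Longrightarrow>
      r1 * dot q u u \<le> (\<Sum>k<n. (dot q (x k) u)\<^sup>2) / real n \<and>
      (\<Sum>k<n. (dot q (x k) u)\<^sup>2) / real n \<le> r2 * dot q u u"
    and T: "T \<subseteq> {..<q} \<times> {..<p}" "card T \<le> s"
  shows "sqrt r1 * sqrt (\<Sum>(i, j)\<in>T. (Y i j)\<^sup>2) \<le> block_norm T"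
    and "block_norm T \<le> sqrt r2 * sqrt (\<Sum>(i, j)\<in>T. (Y i j)\<^sup>2)"
proof -
  have finT: "finite T" using T(1) by (rule finite_subset) simp
  define u where "u = (\<lambda>j i. if (i, j) \<in> T then Y i j else 0)"
  have "card {i. i < q \<and> u j i \<noteq> 0} \<le> s" for j
  proof -
    have "card {i. i < q \<and> u j i \<noteq> 0} \<le> card (fst ` T)"
      using finT by (intro card_mono) (auto simp: u_def split: if_splits intro: rev_image_eqI)
    then show ?thesis using card_image_le[OF finT, of fst] T(2) by linarith
  qed
  note r = rip[OF this]
  have "r1 * (\<Sum>(i, j)\<in>T. (Y i j)\<^sup>2) \<le> (block_norm T)\<^sup>2" "(block_norm T)\<^sup>2 \<le> r2 * (\<Sum>(i, j)\<in>T. (Y i j)\<^sup>2)"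
    unfolding block_norm_sq block_columns[OF T(1), symmetric] sum_distrib_left
    using r[unfolded u_def] by (auto intro!: sum_mono)
  moreover have "block_norm T \<ge> 0" by (simp add: block_norm_def)
  ultimately show "sqrt r1 * sqrt (\<Sum>(i, j)\<in>T. (Y i j)\<^sup>2) \<le> block_norm T"
    "block_norm T \<le> sqrt r2 * sqrt (\<Sum>(i, j)\<in>T. (Y i j)\<^sup>2)"
    by (auto simp: real_sqrt_mult[symmetric] intro: real_le_lsqrt real_le_rsqrt)
qed

text \<open>Off \<open>S\<close>, all but the \<open>k\<close> largest entries form a tail whose
  image under the design is controlled by its 1-norm over sqrt k, which the cone condition makes at
  most half of the head plus half of \<open>a\<close>. The isometry is then needed only on the head
  \<open>S \<union> T\<close>, of size at most \<open>s\<close>. The slack \<open>a\<close> stands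
  for the error in \<Lambda>, because the cone couples both matrices.\<close>

lemma restricted_eigenvalue:
  fixes a :: real
  assumes rip: "\<And>u. card {i. i < q \<and> u i \<noteq> 0} \<le> s \<Longrightarrow>
      r1 * dot q u u \<le> (\<Sum>k<n. (dot q (x k) u)\<^sup>2) / real n \<and>
      (\<Sum>k<n. (dot q (x k) u)\<^sup>2) / real n \<le> r2 * dot q u u"
    and S: "S \<subseteq> {..<q} \<times> {..<p}" and k: "k \<ge> 1" "card S + k \<le> s"
    and r: "0 < r1" "r1 \<le> r2" and a: "a \<ge> 0"
    and cone: "sqrt r2 * (\<Sum>(i, j)\<in>{..<q} \<times> {..<p} - S. \<bar>Y i j\<bar>)
      \<le> sqrt r1 * (sqrt (\<Sum>(i, j)\<in>S. (Y i j)\<^sup>2) + a) / 2 * sqrt (real k)"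
  shows "sqrt r1 * (sqrt (\<Sum>(i, j)\<in>{..<q} \<times> {..<p}. (Y i j)\<^sup>2) / 3 - a) \<le> block_norm ({..<q} \<times> {..<p})"
proof -
  let ?R = "{..<q} \<times> {..<p}"
  let ?F = "?R - S"
  define f where "f = (\<lambda>(i, j). \<bar>Y i j\<bar>)"
  have fsq: "(\<Sum>(i, j)\<in>A. (Y i j)\<^sup>2) = (\<Sum>ij\<in>A. (f ij)\<^sup>2)" for A
    by (intro sum.cong refl) (auto simp: f_def)
  define nrm where "nrm = (\<lambda>A. sqrt (\<Sum>ij\<in>A. (f ij)\<^sup>2))"
  have nrm_Un: "nrm (A \<union> B) \<le> nrm A + nrm B" if "A \<inter> B = {}" for A B
  proof (cases "finite (A \<union> B)")
    case True
    then show ?thesis using that by (simp add: nrm_def sum.union_disjoint sqrt_add_le_add_sqrt sum_nonneg)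
  qed (simp add: nrm_def sum_nonneg)
  obtain T where T: "T \<subseteq> ?F" "card T \<le> k"
    and blk: "\<And>c g. c \<ge> 0 \<Longrightarrow> (\<And>A B. A \<inter> B = {} \<Longrightarrow> g (A \<union> B) \<le> g A + g B) \<Longrightarrow>
       (\<And>A. card A \<le> k \<Longrightarrow> A \<subseteq> ?F \<Longrightarrow> g A \<le> c * sqrt (\<Sum>ij\<in>A. (f ij)\<^sup>2)) \<Longrightarrow>
       g (?F - T) \<le> c * (sum f ?F / sqrt k)"
    by (rule block_decomposition[of ?F k f]) (use k in \<open>auto simp: f_def\<close>)
  have finS: "finite S" "finite T" using S T(1) finite_subset by (blast, metis finite_Diff finite_SigmaI finite_lessThan finite_subset)
  define e where "e = nrm (S \<union> T)"
  define h where "h = (e + a) / 2"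
  have "nrm S \<le> e"
    unfolding e_def nrm_def using finS by (intro real_sqrt_le_mono sum_mono2) auto
  have L1: "sqrt r2 * (sum f ?F / sqrt k) \<le> sqrt r1 * h"
  proof -
    have "sqrt r2 * sum f ?F \<le> sqrt r1 * (nrm S + a) / 2 * sqrt k"
      using cone by (simp add: fsq nrm_def) (simp add: f_def)
    also have "\<dots> \<le> sqrt r1 * h * sqrt k"
      using r \<open>nrm S \<le> e\<close> by (auto simp: h_def intro!: mult_right_mono mult_left_mono)
    finally show ?thesis using k(1) by (simp add: field_simps)
  qed
  have small: "block_norm A \<le> sqrt r2 * sqrt (\<Sum>ij\<in>A. (f ij)\<^sup>2)" if "card A \<le> k" "A \<subseteq> ?F" for A
    using block_norm_bounds(2)[OF rip, of s A] that k(2) unfolding fsq by fastforce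
  have "block_norm (?F - T) \<le> sqrt r2 * (sum f ?F / sqrt k)"
    by (rule blk) (use r small block_norm_Un in auto)
  with L1 have N2: "block_norm (?F - T) \<le> sqrt r1 * h" by simp
  \<comment> \<open>The same tail measured in the Frobenius norm, with constant 1;
    \<open>r1 \<le> r2\<close> lets \<open>L1\<close> bound it as well.\<close>
  have "nrm (?F - T) \<le> 1 * (sum f ?F / sqrt k)"
    by (rule blk) (use nrm_Un in \<open>auto simp: nrm_def\<close>)
  also have "\<dots> \<le> h"
  proof -
    have "sum f ?F / sqrt k \<ge> 0" by (auto simp: f_def intro!: divide_nonneg_nonneg sum_nonneg)
    then have "sqrt r1 * (sum f ?F / sqrt k) \<le> sqrt r2 * (sum f ?F / sqrt k)"
      using r by (intro mult_right_mono) auto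
    then show ?thesis using L1 r by (smt (verit) mult_le_cancel_left_pos real_sqrt_gt_zero)
  qed
  finally have n2: "nrm (?F - T) \<le> h" .
  have dec: "?R = (S \<union> T) \<union> (?F - T)" "(S \<union> T) \<inter> (?F - T) = {}" using S T by auto
  have "nrm ?R \<le> e + h" using nrm_Un[OF dec(2)] n2 dec(1) by (simp add: e_def)
  moreover have "sqrt r1 * e \<le> block_norm ?R + sqrt r1 * h"
  proof -
    have "card (S \<union> T) \<le> s" using card_Un_le[of S T] T(2) k(2) by linarith
    moreover have "S \<union> T \<subseteq> ?R" using S T by auto
    ultimately have "sqrt r1 * e \<le> block_norm (S \<union> T)"
      using block_norm_bounds(1)[OF rip, of s "S \<union> T"] unfolding fsq e_def nrm_def by blast
    also have "\<dots> \<le> block_norm ?R + block_norm (?F - T)"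
      using block_norm_Un_lower[OF dec(2)] dec(1) by simp
    finally show ?thesis using N2 by simp
  qed
  \<comment> \<open>With \<open>h = (e + a) / 2\<close> and the whole norm at most
    \<open>e + h\<close>, its third is at most \<open>e / 2 + a / 6\<close>, while
    \<open>e - h\<close> equals \<open>e / 2 - a / 2\<close>.\<close>
  ultimately have "sqrt r1 * (nrm ?R / 3 - a) \<le> sqrt r1 * (e - h)"
    using r a by (intro mult_left_mono) (auto simp: h_def field_simps)
  then show ?thesis
    using \<open>sqrt r1 * e \<le> block_norm ?R + sqrt r1 * h\<close> unfolding fsq nrm_def by (simp add: right_diff_distrib)
qed

end

section \<open>The prior\<close>

lemma LP_pos: "\<nu> > 0 \<Longrightarrow> LP x \<nu> > 0"
  by (simp add: LP_def)

lemma LP_le_exp_mult: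
  assumes "\<nu> > 0"
  shows "LP x \<nu> \<le> exp (\<bar>x - y\<bar> / \<nu>) * LP y \<nu>"
proof -
  have "- \<bar>x\<bar> / \<nu> \<le> \<bar>x - y\<bar> / \<nu> + - \<bar>y\<bar> / \<nu>"
    using assms by (simp add: field_simps)
  then have "exp (- \<bar>x\<bar> / \<nu>) \<le> exp (\<bar>x - y\<bar> / \<nu>) * exp (- \<bar>y\<bar> / \<nu>)"
    by (simp add: exp_add[symmetric])
  then have "1 / (2 * \<nu>) * exp (- \<bar>x\<bar> / \<nu>) \<le> 1 / (2 * \<nu>) * (exp (\<bar>x - y\<bar> / \<nu>) * exp (- \<bar>y\<bar> / \<nu>))"
    using assms by (intro mult_left_mono) auto
  then show ?thesis by (simp add: LP_def mult_ac)
qed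

text \<open>Weakening the spike's decay to the slower rate of the slab gives both components a
  common factor, which a mixture lets through.\<close>

lemma LP_decay:
  assumes "0 < \<nu>" "\<nu> \<le> \<nu>'"
  shows "LP x \<nu> \<le> exp (- \<bar>x\<bar> / \<nu>') * LP 0 \<nu>"
proof -
  have "\<bar>x\<bar> / \<nu>' \<le> \<bar>x\<bar> / \<nu>" using assms by (intro divide_left_mono) auto
  then have "exp (- \<bar>x\<bar> / \<nu>) \<le> exp (- \<bar>x\<bar> / \<nu>')" by simp
  then show ?thesis using assms by (simp add: LP_def divide_right_mono)
qed

context
  fixes \<nu>0 \<nu>1 \<eta> :: real
  assumes \<nu>: "0 < \<nu>0" "\<nu>0 < \<nu>1" and \<eta>: "0 \<le> \<eta>" "\<eta> \<le> 1"
begin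

lemma spike_slab_pos: "spike_slab \<nu>0 \<nu>1 \<eta> x > 0"
proof (cases "\<eta> = 0")
  case False
  then show ?thesis using \<nu> \<eta> unfolding spike_slab_def
    by (intro add_pos_nonneg mult_pos_pos mult_nonneg_nonneg LP_pos less_imp_le[OF LP_pos]) auto
qed (use \<nu> in \<open>simp add: spike_slab_def LP_pos\<close>)

text \<open>Each component has a log-density that is Lipschitz with constant at most 1/\<nu>0, the
  slab because its scale is the larger one; a common factor passes through the mixture.\<close>

lemma spike_slab_le_exp_mult:
  "spike_slab \<nu>0 \<nu>1 \<eta> x \<le> exp (\<bar>x - y\<bar> / \<nu>0) * spike_slab \<nu>0 \<nu>1 \<eta> y"
proof -
  have "\<bar>x - y\<bar> / \<nu>1 \<le> \<bar>x - y\<bar> / \<nu>0" using \<nu> by (intro divide_left_mono) auto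
  then have "LP x \<nu>1 \<le> exp (\<bar>x - y\<bar> / \<nu>0) * LP y \<nu>1"
    using \<nu> by (intro order_trans[OF LP_le_exp_mult mult_right_mono] less_imp_le[OF LP_pos]) auto
  moreover have "LP x \<nu>0 \<le> exp (\<bar>x - y\<bar> / \<nu>0) * LP y \<nu>0" using \<nu> by (intro LP_le_exp_mult) auto
  ultimately have "spike_slab \<nu>0 \<nu>1 \<eta> x
      \<le> \<eta> * (exp (\<bar>x - y\<bar> / \<nu>0) * LP y \<nu>1) + (1 - \<eta>) * (exp (\<bar>x - y\<bar> / \<nu>0) * LP y \<nu>0)"
    unfolding spike_slab_def using \<eta> by (intro add_mono mult_left_mono) auto
  then show ?thesis by (simp add: spike_slab_def algebra_simps)
qed

lemma spike_slab_decay: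
  "spike_slab \<nu>0 \<nu>1 \<eta> x \<le> exp (- \<bar>x\<bar> / \<nu>1) * spike_slab \<nu>0 \<nu>1 \<eta> 0"
proof -
  have "spike_slab \<nu>0 \<nu>1 \<eta> x
      \<le> \<eta> * (exp (- \<bar>x\<bar> / \<nu>1) * LP 0 \<nu>1) + (1 - \<eta>) * (exp (- \<bar>x\<bar> / \<nu>1) * LP 0 \<nu>0)"
    unfolding spike_slab_def using \<eta> \<nu> by (intro add_mono mult_left_mono LP_decay) auto
  then show ?thesis by (simp add: spike_slab_def algebra_simps)
qed

end

lemma prod_le_exp_sum_mult:
  fixes a b c :: "'b \<Rightarrow> real"
  assumes "\<And>i. i \<in> I \<Longrightarrow> 0 \<le> a i" "\<And>i. i \<in> I \<Longrightarrow> a i \<le> exp (c i) * b i"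
  shows "prod a I \<le> exp (sum c I) * prod b I"
proof (cases "finite I")
  case True
  have "prod a I \<le> (\<Prod>i\<in>I. exp (c i) * b i)" using assms by (intro prod_mono) auto
  then show ?thesis using True by (simp add: prod.distrib exp_sum)
qed simp

lemma ln_prod_diff_le:
  fixes a b c :: "'b \<Rightarrow> real"
  assumes "\<And>i. i \<in> I \<Longrightarrow> 0 < a i" "\<And>i. i \<in> I \<Longrightarrow> 0 < b i"
    "\<And>i. i \<in> I \<Longrightarrow> a i \<le> exp (c i) * b i"
  shows "ln (prod a I) - ln (prod b I) \<le> sum c I"
proof -
  have "prod a I \<le> exp (sum c I) * prod b I"
    using assms by (intro prod_le_exp_sum_mult) (auto intro: less_imp_le)
  moreover have "prod a I > 0" "prod b I > 0" using assms by (auto intro: prod_pos)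
  ultimately have "ln (prod a I) \<le> ln (exp (sum c I) * prod b I)" by simp
  then show ?thesis using \<open>prod b I > 0\<close> by (simp add: ln_mult)
qed

lemma row_prior_le_exp_mult:
  fixes A B A' B' \<rho> :: real
  assumes "A \<le> e * A'" "B \<le> e * B'" "0 \<le> \<rho>" "\<rho> \<le> 1"
  shows "\<rho> * A + (1 - \<rho>) * B \<le> e * (\<rho> * A' + (1 - \<rho>) * B')"
proof -
  have "\<rho> * A + (1 - \<rho>) * B \<le> \<rho> * (e * A') + (1 - \<rho>) * (e * B')"
    using assms by (intro add_mono mult_left_mono) auto
  then show ?thesis by (simp add: algebra_simps)
qed

text \<open>The logarithm does not distribute over the row mixture, so the bounds stay
  multiplicative until the end: both components of a row change by at most the same exponential
  factor. Outside the row support the whole row of \<open>\<Theta>0\<close> is zero, so there the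
  decay from 0 applies.\<close>

lemma ln_prior_Theta_diff_le:
  fixes \<Theta> \<Theta>0 :: "real mat"
  assumes \<nu>: "0 < \<nu>0" "\<nu>0 < \<nu>1" and \<eta>: "0 \<le> \<eta>" "\<eta> \<le> 1" and \<rho>: "0 \<le> \<rho>" "\<rho> \<le> 1"
    and dim: "\<Theta>0 \<in> carrier_mat q p"
  shows "ln (prior_Theta p q \<nu>0 \<nu>1 \<eta> \<rho> \<Theta>) - ln (prior_Theta p q \<nu>0 \<nu>1 \<eta> \<rho> \<Theta>0)
    \<le> (\<Sum>i<q. \<Sum>j<p. (if (i, j) \<in> row_supp_Theta \<Theta>0 then 1 / \<nu>0 else - (1 / \<nu>1))
         * \<bar>\<Theta> $$ (i, j) - \<Theta>0 $$ (i, j)\<bar>)"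
  unfolding prior_Theta_def
proof (rule ln_prod_diff_le)
  have pos: "0 < \<rho> * (\<Prod>j<p. spike_slab \<nu>0 \<nu>1 \<eta> (t j)) + (1 - \<rho>) * (\<Prod>j<p. LP (t j) \<nu>0)" for t
  proof -
    have "(\<Prod>j<p. spike_slab \<nu>0 \<nu>1 \<eta> (t j)) > 0" "(\<Prod>j<p. LP (t j) \<nu>0) > 0"
      using \<nu> \<eta> by (auto intro!: prod_pos spike_slab_pos LP_pos)
    then show ?thesis using \<rho>
      by (cases "\<rho> = 0") (auto intro!: add_pos_nonneg)
  qed
  show "0 < \<rho> * (\<Prod>j<p. spike_slab \<nu>0 \<nu>1 \<eta> (\<Theta> $$ (i, j))) + (1 - \<rho>) * (\<Prod>j<p. LP (\<Theta> $$ (i, j)) \<nu>0)"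
    and "0 < \<rho> * (\<Prod>j<p. spike_slab \<nu>0 \<nu>1 \<eta> (\<Theta>0 $$ (i, j))) + (1 - \<rho>) * (\<Prod>j<p. LP (\<Theta>0 $$ (i, j)) \<nu>0)" for i
    by (rule pos)+
  fix i assume i: "i \<in> {..<q}"
  let ?w = "\<lambda>j. if (i, j) \<in> row_supp_Theta \<Theta>0 then 1 / \<nu>0 else - (1 / \<nu>1)"
  have ss0: "spike_slab \<nu>0 \<nu>1 \<eta> x \<ge> 0" and lp0: "LP x \<nu>0 \<ge> 0" for x
    using spike_slab_pos[OF \<nu> \<eta>] LP_pos[OF \<nu>(1)] less_imp_le by blast+
  have entry: "spike_slab \<nu>0 \<nu>1 \<eta> (\<Theta> $$ (i, j))
        \<le> exp (?w j * \<bar>\<Theta> $$ (i, j) - \<Theta>0 $$ (i, j)\<bar>) * spike_slab \<nu>0 \<nu>1 \<eta> (\<Theta>0 $$ (i, j)) \<and>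
      LP (\<Theta> $$ (i, j)) \<nu>0 \<le> exp (?w j * \<bar>\<Theta> $$ (i, j) - \<Theta>0 $$ (i, j)\<bar>) * LP (\<Theta>0 $$ (i, j)) \<nu>0"
    if j: "j < p" for j
  proof (cases "(i, j) \<in> row_supp_Theta \<Theta>0")
    case True
    then show ?thesis
      using spike_slab_le_exp_mult[OF \<nu> \<eta>, of "\<Theta> $$ (i, j)" "\<Theta>0 $$ (i, j)"]
        LP_le_exp_mult[OF \<nu>(1), of "\<Theta> $$ (i, j)" "\<Theta>0 $$ (i, j)"] by simp
  next
    case False
    then have "row \<Theta>0 i = 0\<^sub>v p" using i j dim by (auto simp: row_supp_Theta_def)
    then have "\<Theta>0 $$ (i, j) = 0" using i j dim by (metis carrier_matD index_row(1) index_zero_vec(1) lessThan_iff)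
    then show ?thesis using False
        spike_slab_decay[OF \<nu> \<eta>, of "\<Theta> $$ (i, j)"] LP_decay[OF \<nu>(1), of \<nu>1 "\<Theta> $$ (i, j)"] \<nu>
      by simp
  qed
  show "\<rho> * (\<Prod>j<p. spike_slab \<nu>0 \<nu>1 \<eta> (\<Theta> $$ (i, j))) + (1 - \<rho>) * (\<Prod>j<p. LP (\<Theta> $$ (i, j)) \<nu>0)
    \<le> exp (\<Sum>j<p. ?w j * \<bar>\<Theta> $$ (i, j) - \<Theta>0 $$ (i, j)\<bar>) *
       (\<rho> * (\<Prod>j<p. spike_slab \<nu>0 \<nu>1 \<eta> (\<Theta>0 $$ (i, j))) + (1 - \<rho>) * (\<Prod>j<p. LP (\<Theta>0 $$ (i, j)) \<nu>0))"
    using entry ss0 lp0 \<rho> by (intro row_prior_le_exp_mult prod_le_exp_sum_mult) auto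
qed

lemma sum_strict_upper_le_half:
  fixes h :: "nat \<Rightarrow> nat \<Rightarrow> real"
  assumes sym: "\<And>i j. i < p \<Longrightarrow> j < p \<Longrightarrow> h i j = h j i" and diag: "\<And>i. i < p \<Longrightarrow> h i i \<ge> 0"
  shows "(\<Sum>(i, j)\<in>{(i, j). i < j \<and> j < p}. h i j) \<le> (\<Sum>i<p. \<Sum>j<p. h i j) / 2"
proof -
  let ?U = "{(i, j). i < j \<and> j < p}" and ?L = "{(i, j). j < i \<and> i < p}" and ?D = "{(i, j). i = j \<and> i < p}"
  have fin: "finite ?U" "finite ?L" "finite ?D"
    by (rule finite_subset[of _ "{..<p} \<times> {..<p}"], auto)+
  have "(\<Sum>i<p. \<Sum>j<p. h i j) = (\<Sum>(i, j)\<in>{..<p} \<times> {..<p}. h i j)"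
    by (simp add: sum.cartesian_product)
  also have "{..<p} \<times> {..<p} = (?U \<union> ?L) \<union> ?D" by auto
  also have "(\<Sum>(i, j)\<in>(?U \<union> ?L) \<union> ?D. h i j)
      = (\<Sum>(i, j)\<in>?U. h i j) + (\<Sum>(i, j)\<in>?L. h i j) + (\<Sum>(i, j)\<in>?D. h i j)"
    using fin by (subst sum.union_disjoint, auto)+
  also have "(\<Sum>(i, j)\<in>?L. h i j) = (\<Sum>(i, j)\<in>?U. h i j)"
    using sym by (intro sum.reindex_bij_witness[of _ prod.swap prod.swap]) auto
  finally show ?thesis using diag sum_nonneg[of ?D "\<lambda>(i, j). h i j"] by fastforce
qed

text \<open>The prior sees each symmetric pair once, hence the half of the sum over all entries. The
  diagonal has no prior term, but it lies in the support and thus has nonnegative weight, so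
  including it only enlarges the bound.\<close>

lemma ln_prior_Lambda_diff_le:
  fixes \<Lambda> \<Lambda>0 :: "real mat"
  assumes \<nu>: "0 < \<nu>0" "\<nu>0 < \<nu>1" and \<eta>: "0 \<le> \<eta>" "\<eta> \<le> 1"
    and dim: "\<Lambda>0 \<in> carrier_mat p p"
    and sym: "\<And>i j. i < p \<Longrightarrow> j < p \<Longrightarrow> \<Lambda> $$ (i, j) = \<Lambda> $$ (j, i)"
    and sym0: "\<And>i j. i < p \<Longrightarrow> j < p \<Longrightarrow> \<Lambda>0 $$ (i, j) = \<Lambda>0 $$ (j, i)"
    and diag: "\<And>i. i < p \<Longrightarrow> \<Lambda>0 $$ (i, i) \<noteq> 0"
  shows "ln (prior_Lambda p \<nu>0 \<nu>1 \<eta> \<Lambda>) - ln (prior_Lambda p \<nu>0 \<nu>1 \<eta> \<Lambda>0)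
    \<le> (\<Sum>i<p. \<Sum>j<p. (if (i, j) \<in> supp_Lambda \<Lambda>0 then 1 / \<nu>0 else - (1 / \<nu>1))
         * \<bar>\<Lambda> $$ (i, j) - \<Lambda>0 $$ (i, j)\<bar>) / 2"
proof -
  let ?h = "\<lambda>i j. (if (i, j) \<in> supp_Lambda \<Lambda>0 then 1 / \<nu>0 else - (1 / \<nu>1)) * \<bar>\<Lambda> $$ (i, j) - \<Lambda>0 $$ (i, j)\<bar>"
  have entry: "spike_slab \<nu>0 \<nu>1 \<eta> (\<Lambda> $$ (i, j)) \<le> exp (?h i j) * spike_slab \<nu>0 \<nu>1 \<eta> (\<Lambda>0 $$ (i, j))"
    if "i < j" "j < p" for i j
  proof (cases "(i, j) \<in> supp_Lambda \<Lambda>0")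
    case False
    then have "\<Lambda>0 $$ (i, j) = 0" using that dim by (auto simp: supp_Lambda_def)
    then show ?thesis using False spike_slab_decay[OF \<nu> \<eta>, of "\<Lambda> $$ (i, j)"] by simp
  qed (use spike_slab_le_exp_mult[OF \<nu> \<eta>, of "\<Lambda> $$ (i, j)" "\<Lambda>0 $$ (i, j)"] in simp)
  have "ln (prior_Lambda p \<nu>0 \<nu>1 \<eta> \<Lambda>) - ln (prior_Lambda p \<nu>0 \<nu>1 \<eta> \<Lambda>0)
      \<le> (\<Sum>(i, j)\<in>{(i, j). i < j \<and> j < p}. ?h i j)"
    unfolding prior_Lambda_def
  proof (rule ln_prod_diff_le, goal_cases)
    case (3 ij)
    then show ?case using entry[of "fst ij" "snd ij"] by (simp only: case_prod_beta) auto
  qed (auto simp: spike_slab_pos[OF \<nu> \<eta>])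
  also have "\<dots> \<le> (\<Sum>i<p. \<Sum>j<p. ?h i j) / 2"
  proof (rule sum_strict_upper_le_half)
    fix i j assume ij: "i < p" "j < p"
    then have "(i, j) \<in> supp_Lambda \<Lambda>0 \<longleftrightarrow> (j, i) \<in> supp_Lambda \<Lambda>0"
      using dim sym0[OF ij] by (simp add: supp_Lambda_def)
    then show "?h i j = ?h j i" using sym[OF ij] sym0[OF ij] by simp
  qed (use dim diag \<nu> in \<open>auto simp: supp_Lambda_def\<close>)
  finally show ?thesis .
qed

section \<open>Scalar inequalities\<close>

text \<open>The denominator interpolates: quadratic growth near 1, linear growth at infinity. For
  \<open>d \<ge> 1\<close> it equals \<open>2 * d\<close>, and for \<open>d \<le> 1\<close> it is at
  least 2. In each range the difference of the two sides is monotone away from 1, where it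
  vanishes.\<close>

lemma log_remainder_lower_bound:
  fixes d :: real
  assumes "d > 0"
  shows "(d - 1) - ln d \<ge> (d - 1)\<^sup>2 / (2 * (1 + \<bar>d - 1\<bar>))"
proof (cases "d \<ge> 1")
  case True
  let ?f = "\<lambda>d :: real. (d - 1) - ln d - (d - 1)\<^sup>2 / (2 * d)"
  have "?f 1 \<le> ?f d"
  proof (rule DERIV_nonneg_imp_nondecreasing[OF True])
    fix z :: real assume z: "1 \<le> z" "z \<le> d"
    have "(?f has_real_derivative (z - 1)\<^sup>2 / (2 * z\<^sup>2)) (at z)"
      using z by (auto intro!: derivative_eq_intros simp: field_simps power2_eq_square)
    then show "\<exists>y. (?f has_real_derivative y) (at z) \<and> 0 \<le> y" by force
  qed
  then show ?thesis using True by simp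
next
  case False
  let ?f = "\<lambda>d :: real. (d - 1) - ln d - (d - 1)\<^sup>2 / 2"
  have "?f d \<ge> ?f 1"
  proof (rule DERIV_nonpos_imp_nonincreasing[of d 1 ?f])
    fix z :: real assume z: "d \<le> z" "z \<le> 1"
    then have "z > 0" using assms by simp
    then have "(?f has_real_derivative - ((z - 1)\<^sup>2 / z)) (at z)"
      by (auto intro!: derivative_eq_intros simp: field_simps power2_eq_square)
    then show "\<exists>y. (?f has_real_derivative y) (at z) \<and> y \<le> 0" using \<open>z > 0\<close> by force
  qed (use False in simp)
  then have "(d - 1)\<^sup>2 / 2 \<le> (d - 1) - ln d" by simp
  moreover have "(d - 1)\<^sup>2 / (2 * (1 + \<bar>d - 1\<bar>)) \<le> (d - 1)\<^sup>2 / 2"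
    by (intro divide_left_mono) (auto simp: add_pos_nonneg)
  ultimately show ?thesis by linarith
qed

text \<open>
  In the direction of \<open>\<Theta>\<close> the interaction with \<open>\<Lambda>\<close> costs the factor \<open>sg / m\<close>, which is
  where the second term of the minimum in \<open>beta0\<close> comes from.
\<close>

lemma quadratic_lower_bound:
  fixes a b w Z N r1 L m sg \<beta> :: real
  assumes pos: "0 < r1" "0 < L" "0 < m" "0 < sg" "0 < \<beta>" and nn: "0 \<le> a" "0 \<le> b" "0 \<le> w" "0 \<le> Z"
    and N: "sqrt r1 * (b / 3 - a) \<le> N" "N / sqrt L \<le> Z + sqrt (1.4 * sg / m) * w"
    and a: "a \<le> L * w" and rL: "r1 * L \<le> 1 / 2"
    and \<beta>: "\<beta> \<le> r1 / (40 * L)" "\<beta> \<le> r1 / (40 * L) * (m / sg)"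
  shows "\<beta> * (a\<^sup>2 + b\<^sup>2) \<le> 4 * (w\<^sup>2 / 2 + Z\<^sup>2)"
proof -
  define A where "A = r1 / L"
  have A: "A > 0" using pos by (simp add: A_def)
  define Br where "Br = w\<^sup>2 / 2 + Z\<^sup>2"
  have Br: "Br \<ge> 0" by (simp add: Br_def)
  have "A * a\<^sup>2 \<le> A * (L * w)\<^sup>2" using A a nn by (intro mult_left_mono power_mono) auto
  also have "\<dots> = (r1 * L) * w\<^sup>2" using pos by (simp add: A_def power2_eq_square)
  also have "\<dots> \<le> 1 / 2 * w\<^sup>2" using rL by (intro mult_right_mono) auto
  finally have Aa: "A * a\<^sup>2 \<le> w\<^sup>2 / 2" by simp
  have sA: "sqrt A = sqrt r1 / sqrt L" by (simp add: A_def real_sqrt_divide)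
  have "sqrt A * (b / 3 - a) \<le> Z + sqrt (1.4 * sg / m) * w"
    using divide_right_mono[OF N(1), of "sqrt L"] N(2) pos by (simp add: sA)
  then have "sqrt A * b \<le> 3 * (Z + sqrt (1.4 * sg / m) * w + sqrt A * a)"
    by (simp add: right_diff_distrib)
  then have "(sqrt A * b)\<^sup>2 \<le> (3 * (Z + sqrt (1.4 * sg / m) * w + sqrt A * a))\<^sup>2"
    using A nn by (intro power_mono) auto
  also have "\<dots> = 9 * (Z + sqrt (1.4 * sg / m) * w + sqrt A * a)\<^sup>2"
    by (simp only: power_mult_distrib) simp
  also have "\<dots> \<le> 9 * (3 * (Z\<^sup>2 + (sqrt (1.4 * sg / m) * w)\<^sup>2 + (sqrt A * a)\<^sup>2))"
  proof -
    have "(u + v + z)\<^sup>2 \<le> 3 * (u\<^sup>2 + v\<^sup>2 + z\<^sup>2)" for u v z :: real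
      using zero_le_power2[of "u - v"] zero_le_power2[of "v - z"] zero_le_power2[of "u - z"]
      by (simp add: power2_eq_square algebra_simps)
    then show ?thesis by (intro mult_left_mono) auto
  qed
  also have "\<dots> = 27 * (Z\<^sup>2 + 1.4 * (sg / m * w\<^sup>2) + A * a\<^sup>2)"
    using A pos by (simp add: power_mult_distrib)
  also have "\<dots> \<le> 27 * (Br + 2.8 * (sg / m) * Br)"
  proof -
    have "sg / m * w\<^sup>2 \<le> sg / m * (2 * Br)"
      using pos by (intro mult_left_mono) (auto simp: Br_def)
    moreover have "Z\<^sup>2 + A * a\<^sup>2 \<le> Br" using Aa by (simp add: Br_def)
    moreover have "27 * (Z\<^sup>2 + 1.4 * t + u) \<le> 27 * (Br + 2.8 * v)" if "t \<le> 2 * v" "Z\<^sup>2 + u \<le> Br" for t u v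
      using that by simp
    ultimately show ?thesis by (simp only: mult.assoc mult.left_commute[of _ 2])
  qed
  finally have "A * b\<^sup>2 \<le> 27 * (Br + 2.8 * (sg / m) * Br)" using A by (simp add: power_mult_distrib)
  \<comment> \<open>The factor 27 is 9 from the third of \<open>b\<close> times 3 from splitting a
    square of three terms. Adding \<open>A * a\<^sup>2\<close>, which is at most \<open>Br\<close>,
    gives 28, and 27 * 2.8 = 75.6 is rounded to 76.\<close>
  then have "A * (a\<^sup>2 + b\<^sup>2) \<le> Br * (28 + 76 * (sg / m))"
  proof -
    have "0 \<le> sg / m * Br" using pos Br by simp
    moreover have "w\<^sup>2 / 2 \<le> Br" by (simp add: Br_def)
    ultimately show ?thesis
      using Aa \<open>A * b\<^sup>2 \<le> 27 * (Br + 2.8 * (sg / m) * Br)\<close> by (simp add: algebra_simps)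
  qed
  then have "\<beta> * (A * (a\<^sup>2 + b\<^sup>2)) \<le> \<beta> * (Br * (28 + 76 * (sg / m)))"
    using pos by (intro mult_left_mono) auto
  also have "\<dots> = Br * (28 * \<beta> + 76 * (\<beta> * (sg / m)))" by (simp add: algebra_simps)
  \<comment> \<open>Each of the two bounds on \<open>\<beta>\<close> absorbs one summand; together
    they cost (28 + 76) / 40 = 2.6, below the claimed 4.\<close>
  also have "\<dots> \<le> Br * (28 * (A / 40) + 76 * (A / 40))"
  proof -
    have "\<beta> * (sg / m) \<le> r1 / (40 * L) * (m / sg) * (sg / m)"
      using \<beta>(2) pos by (intro mult_right_mono) auto
    then have "\<beta> * (sg / m) \<le> A / 40" using pos by (simp add: A_def)
    moreover have "\<beta> \<le> A / 40" using \<beta>(1) by (simp add: A_def)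
    ultimately show ?thesis using Br by (intro mult_left_mono) auto
  qed
  also have "\<dots> \<le> A * (4 * Br)" using A Br by (simp add: algebra_simps)
  finally have "A * (\<beta> * (a\<^sup>2 + b\<^sup>2)) \<le> A * (4 * Br)" by (simp add: algebra_simps)
  then show ?thesis using A by (simp add: Br_def)
qed

text \<open>
  The sample size condition gives \<open>s\<^sup>2 \<le> r1 / (4 r2)\<close> and the bound on \<open>R\<close> gives
  \<open>C s / \<beta> < 2 sqrt r0\<close>; neither suffices alone, but together they bound \<open>s\<^sup>2 / \<beta>\<close>.
\<close>

lemma rate_small:
  fixes s C \<beta> r0 r1 r2 L m m3 sg :: real
  assumes pos: "0 < C" "0 < r1" "0 < L" "0 < m" "0 < m3" "0 < sg" "0 \<le> s"
    and r12: "r1 \<le> r2" and m: "m \<le> L" "m3 \<le> 3 * m" and r1L: "r1 * L \<le> 1 / 2"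
    and \<beta>_def: "\<beta> = r1 / (40 * L) * min 1 (m3 / (16 * sg))"
    and r0: "r0 \<le> 0.5 * m" "r0 \<le> 0.13 * sqrt (sg / r2)" "0 \<le> r0"
    and s: "s\<^sup>2 \<le> r1 / (4 * r2)" "C / \<beta> * s \<le> 2 * sqrt r0"
  shows "(s\<^sup>2 / \<beta>) ^ 3 \<le> 1 / C ^ 4"
proof -
  have \<beta>: "\<beta> > 0" using pos by (simp add: \<beta>_def)
  have r2: "r2 > 0" using pos r12 by simp
  define X where "X = s\<^sup>2 / \<beta>"
  have X: "X \<ge> 0" using \<beta> by (simp add: X_def)
  have "(C / \<beta> * s)\<^sup>2 \<le> (2 * sqrt r0)\<^sup>2" using s(2) pos \<beta> by (intro power_mono) auto
  then have "C\<^sup>2 / \<beta>\<^sup>2 * s\<^sup>2 \<le> 4 * r0" using r0(3) by (simp add: power_mult_distrib power_divide)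
  then have B: "X \<le> 4 / C\<^sup>2 * (r0 * \<beta>)"
    using pos \<beta> by (simp add: X_def field_simps power2_eq_square)
  show ?thesis
  proof (cases "1 \<le> m3 / (16 * sg)")
    case True
    then have \<beta>e: "\<beta> = r1 / (40 * L)" by (simp add: \<beta>_def)
    have "r0 * \<beta> \<le> (0.5 * L) * \<beta>" using r0(1) m(1) \<beta> by (intro mult_right_mono) auto
    also have "\<dots> = r1 / 80" using pos by (simp add: \<beta>e)
    finally have "4 / C\<^sup>2 * (r0 * \<beta>) \<le> 4 / C\<^sup>2 * (r1 / 80)" using pos by (intro mult_left_mono) auto
    with B have B1: "X \<le> r1 / (20 * C\<^sup>2)" by simp
    have B2: "X \<le> r2 / (20 * C\<^sup>2)"
      using B1 r12 pos by (meson divide_right_mono order_trans mult_nonneg_nonneg zero_le_numeral zero_le_power2)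
    have "r1 \<le> 1 / (2 * L)" using r1L pos by (simp add: field_simps)
    then have "r1 / (20 * C\<^sup>2) \<le> (1 / (2 * L)) / (20 * C\<^sup>2)" by (intro divide_right_mono) auto
    with B1 have B3: "X \<le> 1 / (40 * L * C\<^sup>2)" by simp
    have "X \<le> r1 / (4 * r2) / \<beta>" unfolding X_def using s(1) \<beta> by (intro divide_right_mono) auto
    then have B4: "X \<le> 10 * L / r2" using pos by (simp add: \<beta>e)
    \<comment> \<open>Three bounds on the same quantity are multiplied so that \<open>L\<close> and
      \<open>r2\<close> cancel; this is why the claim is about the third power.\<close>
    have "X * X * X \<le> (10 * L / r2) * (r2 / (20 * C\<^sup>2)) * (1 / (40 * L * C\<^sup>2))"
      using X B2 B3 B4 pos r2 by (intro mult_mono) auto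
    also have "\<dots> = 1 / (80 * C ^ 4)" using pos r2 by (simp add: field_simps power4_eq_xxxx power2_eq_square)
    also have "\<dots> \<le> 1 / C ^ 4" using pos by (simp add: field_simps)
    finally show ?thesis by (simp add: X_def power3_eq_cube)
  next
    case False
    then have \<beta>e: "\<beta> = r1 * m3 / (640 * L * sg)" by (simp add: \<beta>_def)
    have "X \<le> r1 / (4 * r2) / \<beta>" unfolding X_def using s(1) \<beta> by (intro divide_right_mono) auto
    then have A: "X \<le> 160 * L * sg / (r2 * m3)" using pos r2 by (simp add: \<beta>e field_simps)
    have "r0 * \<beta> \<le> 0.13 * sqrt (sg / r2) * \<beta>" using r0(2) \<beta> by (intro mult_right_mono) auto
    then have "4 / C\<^sup>2 * (r0 * \<beta>) \<le> 4 / C\<^sup>2 * (0.13 * sqrt (sg / r2) * \<beta>)"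
      using pos by (intro mult_left_mono) auto
    with B have "X \<le> 4 / C\<^sup>2 * (0.13 * sqrt (sg / r2) * \<beta>)" by simp
    then have "X\<^sup>2 \<le> (4 / C\<^sup>2 * (0.13 * sqrt (sg / r2) * \<beta>))\<^sup>2" using X by (intro power_mono) auto
    also have "\<dots> = 16 / C ^ 4 * (0.0169 * (sg / r2) * \<beta>\<^sup>2)"
      using pos r2 by (simp add: power_mult_distrib power_divide mult_ac)
    finally have A2: "X\<^sup>2 \<le> 16 / C ^ 4 * (0.0169 * (sg / r2) * \<beta>\<^sup>2)" .
    \<comment> \<open>The sample size bounds one factor and the bound on \<open>R\<close>, squared
      to remove the root in \<open>r0\<close>, the other two. The square of \<open>\<beta>\<close>
      supplies (m3 / sg)^2, so \<open>sg\<close> cancels and only the ratios r1 / r2 and m3 / L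
      remain.\<close>
    have "X * X\<^sup>2 \<le> (160 * L * sg / (r2 * m3)) * (16 / C ^ 4 * (0.0169 * (sg / r2) * \<beta>\<^sup>2))"
      using X A A2 pos r2 by (intro mult_mono) auto
    also have "\<dots> = 160 * 16 * 0.0169 / 640\<^sup>2 * (r1\<^sup>2 / r2\<^sup>2) * (m3 / L) / C ^ 4"
      using pos r2 by (simp add: \<beta>e field_simps power2_eq_square)
    also have "\<dots> \<le> 160 * 16 * 0.0169 / 640\<^sup>2 * 1 * 3 / C ^ 4"
    proof -
      have "r1\<^sup>2 / r2\<^sup>2 \<le> 1" using r12 pos by (simp add: power_mono)
      moreover have "m3 / L \<le> 3" using m pos by (simp add: field_simps)
      ultimately show ?thesis using pos r2 by (intro divide_right_mono mult_mono) auto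
    qed
    also have "\<dots> \<le> 1 / C ^ 4" using pos by (intro divide_right_mono) (auto simp: power2_eq_square)
    finally show ?thesis by (simp add: X_def power3_eq_cube power2_eq_square)
  qed
qed

text \<open>For \<open>w \<le> 1\<close> the factor \<open>1 + w\<close> is at most 2, and one power
  of \<open>\<delta>\<close> cancels, leaving the constant 4 * 2 * 3 * K = 24 * K. For larger
  \<open>w\<close> the bound \<open>Br \<le> 2 * w * Dg\<close> together with
  \<open>w\<^sup>2 / 2 \<le> Br\<close> gives \<open>Br \<le> 8 * Dg\<^sup>2\<close>; now both
  powers of \<open>\<delta>\<close> cancel, and what remains,
  \<open>\<beta> \<le> 288 * K\<^sup>2 * s\<^sup>2\<close> with 288 = 4 * 8 * 9, contradicts
  \<open>small\<close>.\<close>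

lemma error_bound_from_remainder:
  fixes w Br Dg \<delta> \<beta> s K C :: real
  assumes "0 \<le> w" "0 \<le> \<delta>" "0 < \<beta>" "0 \<le> s" "1 \<le> K" and C: "C = 1 + 288 * K\<^sup>2"
    and Br: "Br \<le> (1 + w) * Dg" "w\<^sup>2 / 2 \<le> Br" "\<beta> * \<delta>\<^sup>2 \<le> 4 * Br"
    and Dg: "Dg \<le> 3 * K * s * \<delta>"
    and small: "(s\<^sup>2 / \<beta>) ^ 3 \<le> 1 / C ^ 4"
  shows "\<delta> \<le> C / \<beta> * s"
proof (cases "\<delta> = 0")
  case True
  then show ?thesis using assms by simp
next
  case False
  then have \<delta>: "\<delta> > 0" using assms by simp
  have K2: "K\<^sup>2 \<ge> K" using \<open>1 \<le> K\<close> by (simp add: power2_eq_square)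
  then have C1: "C \<ge> 24 * K" "C > 1" using C \<open>1 \<le> K\<close> by auto
  have Br0: "Br \<ge> 0" using Br(2) by (smt (verit) zero_le_power2 divide_nonneg_nonneg)
  then have Dg0: "Dg \<ge> 0" using Br(1) \<open>0 \<le> w\<close> by (smt (verit) mult_pos_neg)
  show ?thesis
  proof (cases "w \<le> 1")
    case True
    have "Br \<le> 2 * Dg" using Br(1) mult_right_mono[of "1 + w" 2 Dg] True Dg0 by simp
    then have "\<beta> * \<delta>\<^sup>2 \<le> 24 * K * s * \<delta>" using Br(3) Dg by simp
    then have "\<delta> * (\<beta> * \<delta>) \<le> \<delta> * (24 * K * s)" by (simp add: power2_eq_square mult_ac)
    then have "\<beta> * \<delta> \<le> 24 * K * s" using \<delta> by simp
    also have "\<dots> \<le> C * s" using C1 \<open>0 \<le> s\<close> by (intro mult_right_mono) auto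
    finally show ?thesis using \<open>0 < \<beta>\<close> by (simp add: field_simps)
  next
    case False
    have "Br \<le> 2 * w * Dg" using Br(1) mult_right_mono[of "1 + w" "2 * w" Dg] False Dg0 by simp
    then have "Br\<^sup>2 \<le> (2 * w * Dg)\<^sup>2" using Br0 by (intro power_mono) auto
    also have "\<dots> = w\<^sup>2 / 2 * (8 * Dg\<^sup>2)" by (simp add: power_mult_distrib)
    also have "\<dots> \<le> Br * (8 * Dg\<^sup>2)" using Br(2) by (intro mult_right_mono) auto
    finally have "Br * Br \<le> Br * (8 * Dg\<^sup>2)" by (simp add: power2_eq_square)
    moreover have "Br > 0" using Br(2) False by (smt (verit) zero_less_power2 divide_pos_pos)
    ultimately have "Br \<le> 8 * Dg\<^sup>2" by simp
    also have "\<dots> \<le> 8 * (3 * K * s * \<delta>)\<^sup>2" using Dg Dg0 by (intro mult_left_mono power_mono) auto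
    finally have "\<beta> * \<delta>\<^sup>2 \<le> (288 * K\<^sup>2 * s\<^sup>2) * \<delta>\<^sup>2" using Br(3) by (simp add: power_mult_distrib)
    then have "\<beta> \<le> 288 * K\<^sup>2 * s\<^sup>2" using \<delta> by simp
    then have "1 \<le> (288 * K\<^sup>2) * (s\<^sup>2 / \<beta>)" using \<open>0 < \<beta>\<close> by (simp add: field_simps)
    moreover have "s\<^sup>2 / \<beta> \<ge> 0" using \<open>0 < \<beta>\<close> by simp
    ultimately have "s\<^sup>2 / \<beta> > 0" by (metis less_le mult_zero_right not_one_le_zero)
    \<comment> \<open>The summand 1 in \<open>C\<close> makes the inequality strict.\<close>
    then have "C * (s\<^sup>2 / \<beta>) > 1" using \<open>1 \<le> (288 * K\<^sup>2) * (s\<^sup>2 / \<beta>)\<close> 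
      unfolding C distrib_right by linarith
    then have X: "1 / C < s\<^sup>2 / \<beta>" using C1 by (simp add: pos_divide_less_eq mult.commute)
    have "(1 / C) ^ 3 < (s\<^sup>2 / \<beta>) ^ 3" using X C1 by (intro power_strict_mono) auto
    also have "\<dots> \<le> 1 / C ^ 4" by (rule small)
    also have "\<dots> \<le> 1 / C ^ 3" using C1 by (intro divide_left_mono power_increasing) auto
    finally have False by (simp add: power_divide)
    then show ?thesis ..
  qed
qed

section \<open>Derivatives of the log-likelihood\<close>

text \<open>Coordinate \<open>b\<close> of \<Theta>^T x_k, the coefficient vector of the linear term
  in the conditional density of observation \<open>k\<close>.\<close>

definition lin_pred :: "nat \<Rightarrow> (nat \<Rightarrow> nat \<Rightarrow> real) \<Rightarrow> real mat \<Rightarrow> nat \<Rightarrow> nat \<Rightarrow> real" where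
  "lin_pred q x \<Theta> k b = (\<Sum>a<q. x k a * \<Theta> $$ (a, b))"

lemma mult_entry:
  fixes A B :: "real mat"
  assumes "A \<in> carrier_mat a b" "B \<in> carrier_mat b c" "i < a" "j < c"
  shows "(A * B) $$ (i, j) = (\<Sum>k<b. A $$ (i, k) * B $$ (k, j))"
  using assms by (auto simp: scalar_prod_def atLeast0LessThan intro!: sum.cong)

lemma moment_mat_carrier: "moment_mat n a b x y \<in> carrier_mat a b"
  by (simp add: moment_mat_def)

lemma moment_mat_entry:
  "i < a \<Longrightarrow> j < b \<Longrightarrow> moment_mat n a b x y $$ (i, j) = (\<Sum>k<n. x k i * y k j) / real n"
  by (simp add: moment_mat_def)

lemma bil_moment_mat: "bil q (entries (moment_mat n q q x x)) u u = (\<Sum>k<n. (dot q (x k) u)\<^sup>2) / real n"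
proof -
  have "bil q (entries (moment_mat n q q x x)) u u
      = (\<Sum>i<q. \<Sum>j<q. (\<Sum>k<n. (x k i * u i) * (x k j * u j)) / real n)"
    unfolding bil_expand
    by (intro sum.cong refl) (simp add: moment_mat_entry sum_distrib_left sum_distrib_right mult_ac)
  also have "\<dots> = (\<Sum>i<q. \<Sum>k<n. (x k i * u i) * dot q (x k) u) / real n"
    unfolding sum_divide_distrib[symmetric] dot_def
    by (subst sum.swap) (simp add: sum_distrib_left mult_ac)
  also have "\<dots> = (\<Sum>k<n. (dot q (x k) u)\<^sup>2) / real n"
    by (subst sum.swap) (simp add: sum_distrib_right[symmetric] dot_def power2_eq_square)
  finally show ?thesis .
qed

lemma signal_mat_carrier:
  "\<Theta> \<in> carrier_mat q p \<Longrightarrow> S \<in> carrier_mat q q \<Longrightarrow> signal_mat \<Theta> S \<in> carrier_mat p p"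
  by (simp add: signal_mat_def)

lemma signal_mat_entry:
  assumes "\<Theta> \<in> carrier_mat q p" "i < p" "j < p"
  shows "signal_mat \<Theta> (moment_mat n q q x x) $$ (i, j)
    = (\<Sum>k<n. lin_pred q x \<Theta> k i * lin_pred q x \<Theta> k j) / real n"
proof -
  let ?S = "moment_mat n q q x x"
  have "signal_mat \<Theta> ?S $$ (i, j) = (\<Sum>c<q. (\<Sum>b<q. \<Theta> $$ (b, i) * ?S $$ (b, c)) * \<Theta> $$ (c, j))"
  proof -
    have c: "transpose_mat \<Theta> \<in> carrier_mat p q" "transpose_mat \<Theta> * ?S \<in> carrier_mat p q"
      using assms moment_mat_carrier[of n q q x x] by auto
    show ?thesis
      unfolding signal_mat_def mult_entry[OF c(2) assms]
      using assms by (intro sum.cong refl)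
        (simp add: mult_entry[OF c(1) moment_mat_carrier] del: index_mult_mat(1))
  qed
  also have "\<dots> = (\<Sum>c<q. \<Sum>b<q. \<Sum>k<n. (x k b * \<Theta> $$ (b, i)) * (x k c * \<Theta> $$ (c, j))) / real n"
    unfolding sum_distrib_right sum_divide_distrib
    by (intro sum.cong refl) (simp add: moment_mat_entry sum_distrib_left sum_distrib_right sum_divide_distrib mult_ac)
  also have "(\<Sum>c<q. \<Sum>b<q. \<Sum>k<n. (x k b * \<Theta> $$ (b, i)) * (x k c * \<Theta> $$ (c, j)))
      = (\<Sum>c<q. \<Sum>k<n. lin_pred q x \<Theta> k i * (x k c * \<Theta> $$ (c, j)))"
    unfolding lin_pred_def sum_distrib_right by (intro sum.cong refl sum.swap)
  also have "\<dots> = (\<Sum>k<n. lin_pred q x \<Theta> k i * lin_pred q x \<Theta> k j)"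
    by (subst sum.swap) (simp add: lin_pred_def sum_distrib_left)
  finally show ?thesis .
qed

lemma bil_signal_mat:
  assumes "\<Theta> \<in> carrier_mat q p"
  shows "bil p (entries (signal_mat \<Theta> (moment_mat n q q x x))) u u
    = (\<Sum>k<n. (dot p u (lin_pred q x \<Theta> k))\<^sup>2) / real n"
proof -
  have "bil p (entries (signal_mat \<Theta> (moment_mat n q q x x))) u u
      = bil p (entries (moment_mat n p p (lin_pred q x \<Theta>) (lin_pred q x \<Theta>))) u u"
    unfolding bil_expand
    by (intro sum.cong refl) (simp add: signal_mat_entry[OF assms] moment_mat_entry)
  then show ?thesis by (simp add: bil_moment_mat dot_commute[of p u])
qed

lemma mat_trace_mult:
  assumes "A \<in> carrier_mat a b" "B \<in> carrier_mat b a"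
  shows "mat_trace (A * B) = (\<Sum>i<a. \<Sum>j<b. A $$ (i, j) * B $$ (j, i))"
  using assms by (auto simp: mat_trace_def scalar_prod_def atLeast0LessThan intro!: sum.cong)

text \<open>The trace term becomes a sum over observations. The inverse is passed in as any right
  inverse \<open>V\<close>, so that the basis form and the rank-one update can both be
  inserted.\<close>

lemma loglik_expand:
  assumes L: "\<Lambda> \<in> carrier_mat p p" and V: "V \<in> carrier_mat p p" and LV: "\<Lambda> * V = 1\<^sub>m p"
    and T: "\<Theta> \<in> carrier_mat q p"
  shows "loglik n p q x y \<Theta> \<Lambda> = real n / 2 * (ln (Determinant.det \<Lambda>)
     - (\<Sum>a<p. \<Sum>b<p. moment_mat n p p y y $$ (a, b) * \<Lambda> $$ (b, a))
     - 2 * (\<Sum>b<p. \<Sum>a<q. moment_mat n q p x y $$ (a, b) * \<Theta> $$ (a, b))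
     - (\<Sum>k<n. bil p (entries V) (lin_pred q x \<Theta> k) (lin_pred q x \<Theta> k)) / real n)"
proof -
  let ?Syy = "moment_mat n p p y y" and ?Sxy = "moment_mat n q p x y" and ?S = "moment_mat n q q x x"
  note c = moment_mat_carrier[of n p p y y] moment_mat_carrier[of n q p x y] moment_mat_carrier[of n q q x x]
  have assoc: "V * transpose_mat \<Theta> * ?S * \<Theta> = V * signal_mat \<Theta> ?S"
    using V T c by (simp add: signal_mat_def assoc_mult_mat[of V p p _ q _ q]
        assoc_mult_mat[of V p p "transpose_mat \<Theta> * ?S" q \<Theta> p])
  note cM = signal_mat_carrier[OF T c(3)]
  have "(\<Sum>i<p. \<Sum>j<p. V $$ (i, j) * signal_mat \<Theta> ?S $$ (j, i))
      = (\<Sum>i<p. \<Sum>j<p. \<Sum>k<n. lin_pred q x \<Theta> k i * V $$ (i, j) * lin_pred q x \<Theta> k j) / real n"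
    unfolding sum_divide_distrib
    by (intro sum.cong refl) (simp add: signal_mat_entry[OF T] sum_distrib_left sum_divide_distrib mult_ac)
  also have "\<dots> = (\<Sum>k<n. bil p (entries V) (lin_pred q x \<Theta> k) (lin_pred q x \<Theta> k)) / real n"
    unfolding bil_expand by (subst (2) sum.swap) (subst sum.swap, simp add: sum.swap[of _ "{..<n}"])
  finally have q: "mat_trace (V * signal_mat \<Theta> ?S)
      = (\<Sum>k<n. bil p (entries V) (lin_pred q x \<Theta> k) (lin_pred q x \<Theta> k)) / real n"
    by (simp add: mat_trace_mult[OF V cM])
  have sxy: "mat_trace (transpose_mat ?Sxy * \<Theta>) = (\<Sum>b<p. \<Sum>a<q. ?Sxy $$ (a, b) * \<Theta> $$ (a, b))"
    using c T by (subst mat_trace_mult[of _ p q]) (auto intro!: sum.cong)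
  have "mat_trace (?Syy * \<Lambda> + 2 \<cdot>\<^sub>m (transpose_mat ?Sxy * \<Theta>) + V * signal_mat \<Theta> ?S)
     = mat_trace (?Syy * \<Lambda>) + 2 * mat_trace (transpose_mat ?Sxy * \<Theta>) + mat_trace (V * signal_mat \<Theta> ?S)"
    using L V T c cM by (auto simp: mat_trace_def sum.distrib sum_distrib_left)
  then show ?thesis
    unfolding loglik_def Let_def mat_inv_eqI[OF L V LV] assoc q sxy mat_trace_mult[OF c(1) L]
    by simp
qed

lemma deriv_loglik_Theta:
  assumes L: "\<Lambda> \<in> carrier_mat p p" and V: "V \<in> carrier_mat p p" and LV: "\<Lambda> * V = 1\<^sub>m p"
    and symV: "\<And>a b. a < p \<Longrightarrow> b < p \<Longrightarrow> V $$ (a, b) = V $$ (b, a)"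
    and T: "\<Theta> \<in> carrier_mat q p" and ij: "i < q" "j < p"
  shows "deriv (\<lambda>t. loglik n p q x y (\<Theta> + t \<cdot>\<^sub>m unit_entry_mat q p i j) \<Lambda>) 0
    = real n / 2 * (- 2 * moment_mat n q p x y $$ (i, j)
        - 2 * (\<Sum>k<n. x k i * app p (entries V) (lin_pred q x \<Theta> k) j) / real n)"
proof -
  let ?E = "unit_entry_mat q p i j" and ?F = "lin_pred q x \<Theta>" and ?S = "moment_mat n q p x y"
  \<comment> \<open>The change of the linear predictor per unit of \<open>t\<close>: moving entry
    \<open>(i, j)\<close> affects only coordinate \<open>j\<close>, with slope
    \<open>x k i\<close>.\<close>
  define g where "g = (\<lambda>k b. if b = j then x k i else 0)"
  have F: "lin_pred q x (\<Theta> + t \<cdot>\<^sub>m ?E) k b = ?F k b + t * g k b" if "b < p" for t k b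
  proof -
    have "lin_pred q x (\<Theta> + t \<cdot>\<^sub>m ?E) k b
        = (\<Sum>a<q. x k a * \<Theta> $$ (a, b) + (if a = i then t * g k b else 0))"
      using that T ij unfolding lin_pred_def g_def unit_entry_mat_def
      by (intro sum.cong refl) (auto simp: algebra_simps)
    then show ?thesis using ij by (simp add: sum.distrib lin_pred_def)
  qed
  have dg: "dot p (g k) w = x k i * w j" for k w
    using ij by (simp add: dot_def g_def if_distrib[of "\<lambda>z. z * _"] cong: if_cong)
  have bil_g: "bil p (entries V) (lin_pred q x (\<Theta> + t \<cdot>\<^sub>m ?E) k) (lin_pred q x (\<Theta> + t \<cdot>\<^sub>m ?E) k)
      = bil p (entries V) (?F k) (?F k) + 2 * t * (x k i * app p (entries V) (?F k) j)
        + t\<^sup>2 * bil p (entries V) (g k) (g k)" for t k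
  proof -
    have "bil p (entries V) (lin_pred q x (\<Theta> + t \<cdot>\<^sub>m ?E) k) (lin_pred q x (\<Theta> + t \<cdot>\<^sub>m ?E) k)
        = bil p (entries V) (\<lambda>b. ?F k b + t * g k b) (\<lambda>b. ?F k b + t * g k b)"
      by (rule bil_cong) (simp_all add: F)
    moreover have "bil p (entries V) (g k) (?F k) = x k i * app p (entries V) (?F k) j"
      unfolding bil_def by (rule dg)
    moreover have "bil p (entries V) (?F k) (g k) = bil p (entries V) (g k) (?F k)"
      using symV by (rule bil_commute)
    ultimately show ?thesis
      by (simp add: bil_add_left bil_add_right bil_scale_left bil_scale_right power2_eq_square algebra_simps)
  qed
  have Sxy: "(\<Sum>b<p. \<Sum>a<q. ?S $$ (a, b) * (\<Theta> + t \<cdot>\<^sub>m ?E) $$ (a, b))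
      = (\<Sum>b<p. \<Sum>a<q. ?S $$ (a, b) * \<Theta> $$ (a, b)) + t * ?S $$ (i, j)" for t
  proof -
    have "(\<Sum>b<p. \<Sum>a<q. ?S $$ (a, b) * (\<Theta> + t \<cdot>\<^sub>m ?E) $$ (a, b))
      = (\<Sum>b<p. \<Sum>a<q. ?S $$ (a, b) * \<Theta> $$ (a, b) + (if a = i then if b = j then t * ?S $$ (i, j) else 0 else 0))"
      using T unfolding unit_entry_mat_def by (intro sum.cong refl) (auto simp: algebra_simps)
    then show ?thesis using ij by (simp add: sum.distrib)
  qed
  define A where "A = (\<Sum>k<n. bil p (entries V) (?F k) (?F k))"
  define B where "B = (\<Sum>k<n. x k i * app p (entries V) (?F k) j)"
  define C where "C = (\<Sum>k<n. bil p (entries V) (g k) (g k))"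
  have "(\<lambda>t. loglik n p q x y (\<Theta> + t \<cdot>\<^sub>m ?E) \<Lambda>) = (\<lambda>t. real n / 2 * (ln (Determinant.det \<Lambda>)
     - (\<Sum>a<p. \<Sum>b<p. moment_mat n p p y y $$ (a, b) * \<Lambda> $$ (b, a))
     - 2 * ((\<Sum>b<p. \<Sum>a<q. ?S $$ (a, b) * \<Theta> $$ (a, b)) + t * ?S $$ (i, j))
     - (A + 2 * t * B + t\<^sup>2 * C) / real n))"
  proof
    fix t
    have "\<Theta> + t \<cdot>\<^sub>m ?E \<in> carrier_mat q p" using T by (simp add: unit_entry_mat_def)
    from loglik_expand[OF L V LV this, of n x y]
    show "loglik n p q x y (\<Theta> + t \<cdot>\<^sub>m ?E) \<Lambda> = real n / 2 * (ln (Determinant.det \<Lambda>)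
     - (\<Sum>a<p. \<Sum>b<p. moment_mat n p p y y $$ (a, b) * \<Lambda> $$ (b, a))
     - 2 * ((\<Sum>b<p. \<Sum>a<q. ?S $$ (a, b) * \<Theta> $$ (a, b)) + t * ?S $$ (i, j))
     - (A + 2 * t * B + t\<^sup>2 * C) / real n)"
      unfolding bil_g Sxy A_def B_def C_def by (simp add: sum.distrib sum_distrib_left)
  qed
  moreover have "((\<lambda>t. real n / 2 * (c1 - c2 - 2 * (c3 + t * c4) - (A + 2 * t * B + t\<^sup>2 * C) / real n))
      has_field_derivative real n / 2 * (- 2 * c4 - 2 * B / real n)) (at 0)" for c1 c2 c3 c4
    by (auto intro!: derivative_eq_intros simp: field_simps)
  ultimately show ?thesis unfolding B_def[symmetric] by (simp only: DERIV_imp_deriv)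
qed

text \<open>The cofactors along row \<open>i\<close> do not involve that row, so the determinant is
  affine in the entry, with the cofactor as slope; the adjugate identity expresses it through the
  inverse.\<close>

lemma det_add_unit_entry:
  fixes A :: "real mat"
  assumes A: "A \<in> carrier_mat p p" and V: "V \<in> carrier_mat p p" and AV: "A * V = 1\<^sub>m p"
    and ij: "i < p" "j < p"
  shows "Determinant.det (A + t \<cdot>\<^sub>m unit_entry_mat p p i j) = Determinant.det A * (1 + t * V $$ (j, i))"
proof -
  let ?E = "unit_entry_mat p p i j"
  have AE: "A + t \<cdot>\<^sub>m ?E \<in> carrier_mat p p" using A by (simp add: unit_entry_mat_def)
  have "mat_delete (A + t \<cdot>\<^sub>m ?E) i c = mat_delete A i c" if "c < p" for c
    using A ij that unfolding mat_delete_def unit_entry_mat_def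
    by (intro eq_matI) auto
  then have cof: "cofactor (A + t \<cdot>\<^sub>m ?E) i c = cofactor A i c" if "c < p" for c
    using that by (simp add: cofactor_def)
  have "Determinant.det (A + t \<cdot>\<^sub>m ?E)
      = (\<Sum>c<p. A $$ (i, c) * cofactor A i c + (if c = j then t * cofactor A i j else 0))"
    unfolding laplace_expansion_row[OF AE ij(1)]
  proof (intro sum.cong refl)
    fix c assume "c \<in> {..<p}"
    then show "(A + t \<cdot>\<^sub>m ?E) $$ (i, c) * cofactor (A + t \<cdot>\<^sub>m ?E) i c
        = A $$ (i, c) * cofactor A i c + (if c = j then t * cofactor A i j else 0)"
      using A ij unfolding cof[of c, OF lessThan_iff[THEN iffD1], OF \<open>c \<in> {..<p}\<close>]
      by (auto simp: unit_entry_mat_def algebra_simps)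
  qed
  also have "\<dots> = Determinant.det A + t * cofactor A i j"
    using ij by (simp add: sum.distrib laplace_expansion_row[OF A ij(1)])
  also have "cofactor A i j = Determinant.det A * V $$ (j, i)"
  proof -
    have "adj_mat A = (adj_mat A * A) * V"
      using adj_mat(1)[OF A] A V AV by (simp add: assoc_mult_mat[of _ p p A p V p])
    also have "\<dots> = Determinant.det A \<cdot>\<^sub>m V" 
      using adj_mat(3)[OF A] mult_smult_assoc_mat[of "1\<^sub>m p" p p V p "Determinant.det A"] V by simp
    finally have "adj_mat A $$ (j, i) = (Determinant.det A \<cdot>\<^sub>m V) $$ (j, i)" by simp
    then show ?thesis using A V ij by (simp add: adj_mat_def)
  qed
  finally show ?thesis by (simp add: algebra_simps)
qed

text \<open>The Sherman-Morrison formula for the update of a single entry.\<close>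

lemma inverse_add_unit_entry:
  fixes A :: "real mat"
  assumes A: "A \<in> carrier_mat p p" and V: "V \<in> carrier_mat p p" and AV: "A * V = 1\<^sub>m p"
    and ij: "i < p" "j < p" and t: "1 + t * V $$ (j, i) \<noteq> 0"
  shows "(A + t \<cdot>\<^sub>m unit_entry_mat p p i j) *
    mat p p (\<lambda>(a, b). V $$ (a, b) - t / (1 + t * V $$ (j, i)) * (V $$ (a, i) * V $$ (j, b))) = 1\<^sub>m p"
    (is "?A * ?V = _")
proof (rule eq_matI)
  define s where "s = t / (1 + t * V $$ (j, i))"
  have s: "t - s - t * s * V $$ (j, i) = 0" using t by (simp add: s_def field_simps)
  have AE: "?A \<in> carrier_mat p p" using A by (simp add: unit_entry_mat_def)
  have AVe: "(\<Sum>c<p. A $$ (a, c) * V $$ (c, b)) = (if a = b then 1 else 0)" if "a < p" "b < p" for a b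
    using mult_entry[OF A V that] AV that by simp
  fix a b assume "a < dim_row (1\<^sub>m p :: real mat)" "b < dim_col (1\<^sub>m p :: real mat)"
  then have ab: "a < p" "b < p" by auto
  have "(?A * ?V) $$ (a, b) = (\<Sum>c<p. ?A $$ (a, c) * ?V $$ (c, b))"
    by (rule mult_entry[OF AE _ ab]) simp
  also have "\<dots> = (\<Sum>c<p. A $$ (a, c) * V $$ (c, b) - s * V $$ (j, b) * (A $$ (a, c) * V $$ (c, i))
      + (if c = j then if a = i then t * (V $$ (j, b) - s * (V $$ (j, i) * V $$ (j, b))) else 0 else 0))"
    using ab ij A by (intro sum.cong refl) (auto simp: s_def[symmetric] unit_entry_mat_def algebra_simps)
  also have "\<dots> = (if a = b then 1 else 0) - s * V $$ (j, b) * (if a = i then 1 else 0)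
      + (if a = i then t * (V $$ (j, b) - s * (V $$ (j, i) * V $$ (j, b))) else 0)"
    using ij by (simp add: sum.distrib sum_subtractf sum_distrib_left[symmetric] AVe ab)
  also have "\<dots> = (if a = b then 1 else 0) + (if a = i then V $$ (j, b) * (t - s - t * s * V $$ (j, i)) else 0)"
    by (simp add: algebra_simps)
  also have "\<dots> = 1\<^sub>m p $$ (a, b)" unfolding s using ab by simp
  finally show "(?A * ?V) $$ (a, b) = 1\<^sub>m p $$ (a, b)" .
qed (use A in \<open>auto simp: unit_entry_mat_def\<close>)

text \<open>Off the diagonal the perturbed matrix is not symmetric, so its inverse is written out
  explicitly. The formula is established only for \<open>t\<close> near 0, where
  \<open>1 + t * v\<close> stays positive, which suffices for the derivative.\<close>

lemma deriv_loglik_Lambda: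
  assumes L: "\<Lambda> \<in> carrier_mat p p" and V: "V \<in> carrier_mat p p" and LV: "\<Lambda> * V = 1\<^sub>m p"
    and symV: "\<And>a b. a < p \<Longrightarrow> b < p \<Longrightarrow> V $$ (a, b) = V $$ (b, a)"
    and T: "\<Theta> \<in> carrier_mat q p" and ij: "i < p" "j < p" and det: "Determinant.det \<Lambda> > 0"
  shows "deriv (\<lambda>t. loglik n p q x y \<Theta> (\<Lambda> + t \<cdot>\<^sub>m unit_entry_mat p p i j)) 0
    = real n / 2 * (V $$ (j, i) - moment_mat n p p y y $$ (j, i)
        + (\<Sum>k<n. app p (entries V) (lin_pred q x \<Theta> k) i * app p (entries V) (lin_pred q x \<Theta> k) j) / real n)"
proof -
  let ?E = "unit_entry_mat p p i j" and ?F = "lin_pred q x \<Theta>" and ?S = "moment_mat n p p y y"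
  define v where "v = V $$ (j, i)"
  define Vt where "Vt = (\<lambda>t. mat p p (\<lambda>(a, b). V $$ (a, b) - t / (1 + t * v) * (V $$ (a, i) * V $$ (j, b))))"
  have Syy: "(\<Sum>a<p. \<Sum>b<p. ?S $$ (a, b) * (\<Lambda> + t \<cdot>\<^sub>m ?E) $$ (b, a))
      = (\<Sum>a<p. \<Sum>b<p. ?S $$ (a, b) * \<Lambda> $$ (b, a)) + t * ?S $$ (j, i)" for t
  proof -
    have "(\<Sum>a<p. \<Sum>b<p. ?S $$ (a, b) * (\<Lambda> + t \<cdot>\<^sub>m ?E) $$ (b, a))
      = (\<Sum>a<p. \<Sum>b<p. ?S $$ (a, b) * \<Lambda> $$ (b, a) + (if b = i then if a = j then t * ?S $$ (j, i) else 0 else 0))"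
      using L unfolding unit_entry_mat_def by (intro sum.cong refl) (auto simp: algebra_simps)
    then show ?thesis using ij by (simp add: sum.distrib)
  qed
  have bilVt: "bil p (entries (Vt t)) w w = bil p (entries V) w w
      - t / (1 + t * v) * (app p (entries V) w i * app p (entries V) w j)" for t w
  proof -
    have "bil p (entries (Vt t)) w w = (\<Sum>a<p. \<Sum>b<p. w a * V $$ (a, b) * w b
        - t / (1 + t * v) * ((V $$ (i, a) * w a) * (V $$ (j, b) * w b)))"
      unfolding bil_expand Vt_def using symV ij by (intro sum.cong refl) (auto simp: algebra_simps)
    also have "\<dots> = bil p (entries V) w w - t / (1 + t * v) * (\<Sum>a<p. \<Sum>b<p. (V $$ (i, a) * w a) * (V $$ (j, b) * w b))"
      by (simp add: sum_subtractf bil_expand sum_distrib_left)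
    also have "(\<Sum>a<p. \<Sum>b<p. (V $$ (i, a) * w a) * (V $$ (j, b) * w b)) = app p (entries V) w i * app p (entries V) w j"
      by (simp add: app_def sum_product)
    finally show ?thesis .
  qed
  define A where "A = (\<Sum>k<n. bil p (entries V) (?F k) (?F k))"
  define B where "B = (\<Sum>k<n. app p (entries V) (?F k) i * app p (entries V) (?F k) j)"
  define G where "G = (\<lambda>t. real n / 2 * (ln (Determinant.det \<Lambda> * (1 + t * v))
     - ((\<Sum>a<p. \<Sum>b<p. ?S $$ (a, b) * \<Lambda> $$ (b, a)) + t * ?S $$ (j, i))
     - 2 * (\<Sum>b<p. \<Sum>a<q. moment_mat n q p x y $$ (a, b) * \<Theta> $$ (a, b))
     - (A - t / (1 + t * v) * B) / real n))"
  have "((\<lambda>t. 1 + t * v) \<longlongrightarrow> 1 + 0 * v) (nhds 0)" by (intro tendsto_intros filterlim_ident)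
  then have "\<forall>\<^sub>F t in nhds 0. 1 + t * v > 0" by (intro order_tendstoD) auto
  then have ev: "\<forall>\<^sub>F t in nhds 0. loglik n p q x y \<Theta> (\<Lambda> + t \<cdot>\<^sub>m ?E) = G t"
  proof eventually_elim
    case (elim t)
    have LE: "\<Lambda> + t \<cdot>\<^sub>m ?E \<in> carrier_mat p p" using L by (simp add: unit_entry_mat_def)
    have "(\<Lambda> + t \<cdot>\<^sub>m ?E) * Vt t = 1\<^sub>m p"
      unfolding Vt_def v_def by (rule inverse_add_unit_entry[OF L V LV ij]) (use elim v_def in auto)
    moreover have "Vt t \<in> carrier_mat p p" by (simp add: Vt_def)
    moreover have "(\<Sum>k<n. bil p (entries V) (?F k) (?F k)
        - t / (1 + t * v) * (app p (entries V) (?F k) i * app p (entries V) (?F k) j)) = A - t / (1 + t * v) * B"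
      by (simp add: A_def B_def sum_subtractf sum_distrib_left)
    ultimately show ?case
      using loglik_expand[OF LE _ _ T, of "Vt t" n x y]
      unfolding G_def Syy bilVt det_add_unit_entry[OF L V LV ij] v_def[symmetric] by simp
  qed
  have "(G has_field_derivative real n / 2 * (v - ?S $$ (j, i) + B / real n)) (at 0)"
    unfolding G_def using det by (auto intro!: derivative_eq_intros simp: field_simps)
  then have "deriv G 0 = real n / 2 * (v - ?S $$ (j, i) + B / real n)" by (rule DERIV_imp_deriv)
  then show ?thesis using deriv_cong_ev[OF ev refl] by (simp add: B_def v_def)
qed

section \<open>The remainder of the log-likelihood\<close>

text \<open>
  If the columns \<open>P i\<close> satisfy \<open>P\<^sup>T \<Lambda> P = diag d\<close>, then \<open>basis_inv p P d\<close> is \<open>\<Lambda>\<^sup>-\<^sup>1\<close>.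
\<close>

definition basis_inv :: "nat \<Rightarrow> (nat \<Rightarrow> nat \<Rightarrow> real) \<Rightarrow> (nat \<Rightarrow> real) \<Rightarrow> real mat" where
  "basis_inv p P d = mat p p (\<lambda>(a, b). \<Sum>i<p. P i a * P i b / d i)"

lemma basis_inv_carrier: "basis_inv p P d \<in> carrier_mat p p"
  by (simp add: basis_inv_def)

lemma basis_inv_sym: "a < p \<Longrightarrow> b < p \<Longrightarrow> basis_inv p P d $$ (a, b) = basis_inv p P d $$ (b, a)"
  by (simp add: basis_inv_def mult.commute)

lemma app_basis_inv:
  assumes "a < p"
  shows "app p (entries (basis_inv p P d)) u a = (\<Sum>i<p. P i a * dot p (P i) u / d i)"
proof -
  have "app p (entries (basis_inv p P d)) u a = (\<Sum>b<p. \<Sum>i<p. P i a * (P i b * u b) / d i)"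
    unfolding app_def using assms by (intro sum.cong refl) (simp add: basis_inv_def sum_distrib_left sum_distrib_right mult_ac)
  also have "\<dots> = (\<Sum>i<p. \<Sum>b<p. P i a * (P i b * u b) / d i)" by (rule sum.swap)
  also have "\<dots> = (\<Sum>i<p. P i a * dot p (P i) u / d i)"
    by (simp add: dot_def sum_distrib_left sum_divide_distrib)
  finally show ?thesis .
qed

lemma bil_basis_inv: "bil p (entries (basis_inv p P d)) u u = (\<Sum>i<p. (dot p (P i) u)\<^sup>2 / d i)"
proof -
  have "bil p (entries (basis_inv p P d)) u u = (\<Sum>a<p. \<Sum>i<p. (P i a * u a) * dot p (P i) u / d i)"
    unfolding bil_def dot_def[of p u]
    by (intro sum.cong refl) (simp add: app_basis_inv sum_distrib_left mult_ac)
  also have "\<dots> = (\<Sum>i<p. \<Sum>a<p. (P i a * u a) * dot p (P i) u / d i)" by (rule sum.swap)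
  also have "\<dots> = (\<Sum>i<p. (dot p (P i) u)\<^sup>2 / d i)"
    by (simp add: sum_divide_distrib[symmetric] sum_distrib_right[symmetric] dot_def[symmetric] power2_eq_square)
  finally show ?thesis .
qed

lemma sum_app_mult: "(\<Sum>b<p. A a b * (\<Sum>i<p. P i b * P i c / d i)) = (\<Sum>i<p. app p A (P i) a * P i c / d i)"
  for A :: "nat \<Rightarrow> nat \<Rightarrow> real"
proof -
  have "(\<Sum>b<p. A a b * (\<Sum>i<p. P i b * P i c / d i)) = (\<Sum>b<p. \<Sum>i<p. A a b * P i b * P i c / d i)"
    by (simp add: sum_distrib_left mult_ac)
  also have "\<dots> = (\<Sum>i<p. \<Sum>b<p. A a b * P i b * P i c / d i)" by (rule sum.swap)
  also have "\<dots> = (\<Sum>i<p. app p A (P i) a * P i c / d i)"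
    by (simp add: app_def sum_distrib_right sum_divide_distrib)
  finally show ?thesis .
qed

lemma det_congruence:
  fixes A Pm :: "real mat"
  assumes A: "A \<in> carrier_mat p p" and Pm: "Pm = mat p p (\<lambda>(a, i). P i a)"
    and orth: "\<And>i j. i < p \<Longrightarrow> j < p \<Longrightarrow> bil p (entries A) (P i) (P j) = (if i = j then d i else 0)"
  shows "transpose_mat Pm * A * Pm = mat p p (\<lambda>(i, j). if i = j then d i else 0)"
    and "Determinant.det Pm * Determinant.det A * Determinant.det Pm = (\<Prod>i<p. d i)"
proof -
  have Pc: "Pm \<in> carrier_mat p p" by (simp add: Pm)
  show eq: "transpose_mat Pm * A * Pm = mat p p (\<lambda>(i, j). if i = j then d i else 0)"
  proof (rule eq_matI)
    fix i j assume "i < dim_row (mat p p (\<lambda>(i, j). if i = j then d i else 0))"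
      "j < dim_col (mat p p (\<lambda>(i, j). if i = j then d i else 0))"
    then have ij: "i < p" "j < p" by auto
    have "(transpose_mat Pm * A * Pm) $$ (i, j) = (transpose_mat Pm * (A * Pm)) $$ (i, j)"
      using A Pc by (simp add: assoc_mult_mat[of _ p p A p Pm p])
    also have "\<dots> = (\<Sum>a<p. transpose_mat Pm $$ (i, a) * (A * Pm) $$ (a, j))"
      using A Pc ij by (intro mult_entry) auto
    also have "\<dots> = (\<Sum>a<p. P i a * app p (entries A) (P j) a)"
    proof (intro sum.cong refl)
      fix a assume "a \<in> {..<p}"
      then have a: "a < p" by simp
      have "(A * Pm) $$ (a, j) = app p (entries A) (P j) a"
        using mult_entry[OF A Pc a ij(2)] a ij by (simp add: app_def Pm)
      moreover have "transpose_mat Pm $$ (i, a) = P i a" using a ij by (simp add: Pm)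
      ultimately show "transpose_mat Pm $$ (i, a) * (A * Pm) $$ (a, j) = P i a * app p (entries A) (P j) a"
        by simp
    qed
    finally show "(transpose_mat Pm * A * Pm) $$ (i, j) = mat p p (\<lambda>(i, j). if i = j then d i else 0) $$ (i, j)"
      using orth[OF ij] ij by (simp add: bil_def dot_def)
  qed (use A Pc in auto)
  have "Determinant.det (mat p p (\<lambda>(i, j). if i = j then d i else 0)) = (\<Prod>i<p. d i)"
    by (subst det_upper_triangular[of _ p])
      (auto simp: upper_triangular_def diag_mat_def prod.list_conv_set_nth atLeast0LessThan)
  moreover have "Determinant.det (transpose_mat Pm * A * Pm)
      = Determinant.det Pm * Determinant.det A * Determinant.det Pm"
    using A Pc by (simp add: det_mult[of _ p] det_transpose[of _ p])
  ultimately show "Determinant.det Pm * Determinant.det A * Determinant.det Pm = (\<Prod>i<p. d i)"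
    using eq by simp
qed

lemma simultaneous_diagonalization:
  assumes L0: "sym_pos_def p \<Lambda>0" and L: "sym_pos_def p \<Lambda>"
  shows "\<exists>P d. (\<forall>i<p. d i > 0) \<and>
    (\<forall>i<p. \<forall>j<p. bil p (entries \<Lambda>0) (P i) (P j) = (if i = j then 1 else 0)) \<and>
    (\<forall>i<p. \<forall>a<p. app p (entries \<Lambda>) (P i) a = d i * app p (entries \<Lambda>0) (P i) a) \<and>
    \<Lambda>0 * basis_inv p P (\<lambda>_. 1) = 1\<^sub>m p \<and> \<Lambda> * basis_inv p P d = 1\<^sub>m p \<and>
    Determinant.det \<Lambda>0 > 0 \<and> Determinant.det \<Lambda> = Determinant.det \<Lambda>0 * (\<Prod>i<p. d i)"
proof -
  have c: "\<Lambda>0 \<in> carrier_mat p p" "\<Lambda> \<in> carrier_mat p p" using L0 L by (auto simp: sym_pos_def_def)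
  obtain P d where
    P: "\<And>i j. i < p \<Longrightarrow> j < p \<Longrightarrow> bil p (entries \<Lambda>0) (P i) (P j) = (if i = j then 1 else 0)"
    and d: "\<And>i a. i < p \<Longrightarrow> a < p \<Longrightarrow> app p (entries \<Lambda>) (P i) a = d i * app p (entries \<Lambda>0) (P i) a"
    using generalized_eigenbasis[of p "entries \<Lambda>" "entries \<Lambda>0", OF sym_pos_def_sym[OF L]
        sym_pos_def_sym[OF L0] sym_pos_def_pd[OF L0] order_refl] by blast
  have bilL: "bil p (entries \<Lambda>) (P i) (P j) = (if i = j then d i else 0)" if ij: "i < p" "j < p" for i j
  proof -
    have "bil p (entries \<Lambda>) (P i) (P j) = d j * bil p (entries \<Lambda>0) (P i) (P j)"
      using d[OF ij(2)] by (rule bil_eigen)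
    then show ?thesis using P[OF ij] by simp
  qed
  have ne: "\<exists>a<p. P i a \<noteq> 0" if "i < p" for i
  proof (rule ccontr)
    assume "\<not> ?thesis"
    then have "bil p (entries \<Lambda>0) (P i) (P i) = 0" by (simp add: bil_expand)
    then show False using P[OF that that] by simp
  qed
  have dpos: "d i > 0" if "i < p" for i
    using sym_pos_def_pd[OF L ne[OF that]] bilL[OF that that] by simp
  define Pm where "Pm = mat p p (\<lambda>(a, i). P i a)"
  have Pc: "Pm \<in> carrier_mat p p" by (simp add: Pm_def)
  have "transpose_mat Pm * \<Lambda>0 * Pm = 1\<^sub>m p"
    unfolding one_mat_def by (rule det_congruence(1)[where d = "\<lambda>_. 1", OF c(1) Pm_def P])
  \<comment> \<open>One-sided inverses of square matrices are two-sided; used twice, this moves both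
    factors \<open>Pm\<close> to the right of \<open>\<Lambda>0\<close>.\<close>
  then have "Pm * (transpose_mat Pm * \<Lambda>0) = 1\<^sub>m p"
    using Pc c by (intro mat_mult_left_right_inverse[of "transpose_mat Pm * \<Lambda>0" p Pm]) auto
  then have "(Pm * transpose_mat Pm) * \<Lambda>0 = 1\<^sub>m p"
    using Pc c by (simp add: assoc_mult_mat[of Pm p p "transpose_mat Pm" p \<Lambda>0 p])
  then have "\<Lambda>0 * (Pm * transpose_mat Pm) = 1\<^sub>m p"
    using Pc c by (intro mat_mult_left_right_inverse[of "Pm * transpose_mat Pm" p \<Lambda>0]) auto
  moreover have "Pm * transpose_mat Pm = basis_inv p P (\<lambda>_. 1)"
  proof (rule eq_matI)
    fix a b assume "a < dim_row (basis_inv p P (\<lambda>_. 1))" "b < dim_col (basis_inv p P (\<lambda>_. 1))"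
    then have ab: "a < p" "b < p" by (auto simp: basis_inv_def)
    then show "(Pm * transpose_mat Pm) $$ (a, b) = basis_inv p P (\<lambda>_. 1) $$ (a, b)"
      using mult_entry[OF Pc _ ab, of "transpose_mat Pm"] by (simp add: Pm_def basis_inv_def)
  qed (auto simp: Pm_def basis_inv_def)
  ultimately have inv0: "\<Lambda>0 * basis_inv p P (\<lambda>_. 1) = 1\<^sub>m p" by simp
  \<comment> \<open>The eigenvalue \<open>d i\<close> produced by \<open>\<Lambda>\<close> on
    \<open>P i\<close> cancels the divisor in \<open>basis_inv\<close>.\<close>
  have "\<Lambda> * basis_inv p P d = \<Lambda>0 * basis_inv p P (\<lambda>_. 1)"
  proof (rule eq_matI)
    fix a b assume "a < dim_row (\<Lambda>0 * basis_inv p P (\<lambda>_. 1))" "b < dim_col (\<Lambda>0 * basis_inv p P (\<lambda>_. 1))"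
    then have ab: "a < p" "b < p" using c by (auto simp: basis_inv_def)
    have "(\<Lambda> * basis_inv p P d) $$ (a, b) = (\<Sum>i<p. app p (entries \<Lambda>) (P i) a * P i b / d i)"
      using mult_entry[OF c(2) basis_inv_carrier ab, of P d] ab
        sum_app_mult[of "entries \<Lambda>" a P b d p] by (simp add: basis_inv_def)
    also have "\<dots> = (\<Sum>i<p. app p (entries \<Lambda>0) (P i) a * P i b / 1)"
      using d ab dpos by (intro sum.cong refl) force
    also have "\<dots> = (\<Lambda>0 * basis_inv p P (\<lambda>_. 1)) $$ (a, b)"
      using mult_entry[OF c(1) basis_inv_carrier ab, of P "\<lambda>_. 1"] ab
        sum_app_mult[of "entries \<Lambda>0" a P b "\<lambda>_. 1" p] by (simp add: basis_inv_def)
    finally show "(\<Lambda> * basis_inv p P d) $$ (a, b) = (\<Lambda>0 * basis_inv p P (\<lambda>_. 1)) $$ (a, b)" .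
  qed (use c in \<open>auto simp: basis_inv_def\<close>)
  with inv0 have inv: "\<Lambda> * basis_inv p P d = 1\<^sub>m p" by simp
  \<comment> \<open>Only the square of this determinant enters, so the orientation of the basis is
    irrelevant.\<close>
  define D where "D = Determinant.det Pm"
  have "D * Determinant.det \<Lambda>0 * D = 1"
    using det_congruence(2)[where d = "\<lambda>_. 1", OF c(1) Pm_def P] by (simp add: D_def)
  moreover have detL: "D * Determinant.det \<Lambda> * D = (\<Prod>i<p. d i)"
    unfolding D_def by (rule det_congruence(2)[OF c(2) Pm_def bilL])
  ultimately have D: "D\<^sup>2 * Determinant.det \<Lambda>0 = 1" by (simp add: power2_eq_square mult_ac)
  then have "D \<noteq> 0" by auto
  have "D\<^sup>2 > 0" using \<open>D \<noteq> 0\<close> by simp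
  then have "Determinant.det \<Lambda>0 > 0" using D zero_less_mult_pos[of "D\<^sup>2" "Determinant.det \<Lambda>0"] by simp
  moreover have "D\<^sup>2 * Determinant.det \<Lambda> = D\<^sup>2 * (Determinant.det \<Lambda>0 * (\<Prod>i<p. d i))"
    using detL D by (simp add: power2_eq_square mult_ac)
  then have "Determinant.det \<Lambda> = Determinant.det \<Lambda>0 * (\<Prod>i<p. d i)" using \<open>D \<noteq> 0\<close> by simp
  ultimately show ?thesis using dpos P d inv0 inv by blast
qed

text \<open>The differential of the log-likelihood at \<open>(\<Theta>0, \<Lambda>0)\<close> applied
  to the error. As symmetric entries count as separate variables in the gradient, the pairing runs
  over all entries.\<close>

definition grad_dir ::
  "nat \<Rightarrow> nat \<Rightarrow> nat \<Rightarrow> (nat \<Rightarrow> nat \<Rightarrow> real) \<Rightarrow> (nat \<Rightarrow> nat \<Rightarrow> real) \<Rightarrow>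
   real mat \<Rightarrow> real mat \<Rightarrow> real mat \<Rightarrow> real mat \<Rightarrow> real" where
  "grad_dir n p q x y \<Theta>0 \<Lambda>0 \<Theta> \<Lambda> =
     (\<Sum>i<q. \<Sum>j<p. grad_Theta n p q x y \<Theta>0 \<Lambda>0 $$ (i, j) * (\<Theta> - \<Theta>0) $$ (i, j)) +
     (\<Sum>i<p. \<Sum>j<p. grad_Lambda n p q x y \<Theta>0 \<Lambda>0 $$ (i, j) * (\<Lambda> - \<Lambda>0) $$ (i, j))"

lemma lin_pred_diff:
  assumes "\<Theta> \<in> carrier_mat q p" "\<Theta>0 \<in> carrier_mat q p" "b < p"
  shows "lin_pred q x \<Theta> k b = lin_pred q x \<Theta>0 k b + lin_pred q x (\<Theta> - \<Theta>0) k b"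
proof -
  have "lin_pred q x (\<Theta> - \<Theta>0) k b = (\<Sum>a<q. x k a * \<Theta> $$ (a, b) - x k a * \<Theta>0 $$ (a, b))"
    unfolding lin_pred_def using assms by (intro sum.cong refl) (auto simp: algebra_simps)
  then show ?thesis by (simp add: lin_pred_def sum_subtractf)
qed

lemma sum_swap_weighted:
  "(\<Sum>i<a. \<Sum>j<b. (\<Sum>k<n. f k i * g k j) * h i j) = (\<Sum>k<n. \<Sum>i<a. \<Sum>j<b. f k i * h i j * (g k j :: real))"
proof -
  have "(\<Sum>i<a. \<Sum>j<b. (\<Sum>k<n. f k i * g k j) * h i j) = (\<Sum>i<a. \<Sum>j<b. \<Sum>k<n. f k i * h i j * g k j)"
    by (simp add: sum_distrib_left sum_distrib_right mult_ac)
  also have "\<dots> = (\<Sum>i<a. \<Sum>k<n. \<Sum>j<b. f k i * h i j * g k j)" by (intro sum.cong refl sum.swap)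
  also have "\<dots> = (\<Sum>k<n. \<Sum>i<a. \<Sum>j<b. f k i * h i j * g k j)" by (rule sum.swap)
  finally show ?thesis .
qed

text \<open>The terms with the responses are linear in the parameters and cancel against the
  gradient. What is left decouples over the basis vectors, and completing a square in each
  coordinate gives the exact formula.\<close>

lemma loglik_remainder:
  assumes T0: "\<Theta>0 \<in> carrier_mat q p" and T: "\<Theta> \<in> carrier_mat q p"
    and L0: "\<Lambda>0 \<in> carrier_mat p p" and L: "\<Lambda> \<in> carrier_mat p p"
    and d: "\<And>i. i < p \<Longrightarrow> d i > 0"
    and P: "\<And>i j. i < p \<Longrightarrow> j < p \<Longrightarrow> bil p (entries \<Lambda>0) (P i) (P j) = (if i = j then 1 else 0)"
    and LP: "\<And>i a. i < p \<Longrightarrow> a < p \<Longrightarrow> app p (entries \<Lambda>) (P i) a = d i * app p (entries \<Lambda>0) (P i) a"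
    and inv0: "\<Lambda>0 * basis_inv p P (\<lambda>_. 1) = 1\<^sub>m p" and inv: "\<Lambda> * basis_inv p P d = 1\<^sub>m p"
    and det0: "Determinant.det \<Lambda>0 > 0" and det: "Determinant.det \<Lambda> = Determinant.det \<Lambda>0 * (\<Prod>i<p. d i)"
  shows "loglik n p q x y \<Theta>0 \<Lambda>0 - loglik n p q x y \<Theta> \<Lambda> + grad_dir n p q x y \<Theta>0 \<Lambda>0 \<Theta> \<Lambda>
    = real n / 2 * ((\<Sum>i<p. (d i - 1) - ln (d i)) +
       (\<Sum>k<n. \<Sum>i<p. (dot p (P i) (lin_pred q x (\<Theta> - \<Theta>0) k)
          - (d i - 1) * dot p (P i) (lin_pred q x \<Theta>0 k))\<^sup>2 / d i) / real n)"
proof -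
  define V where "V = basis_inv p P (\<lambda>_. 1)"
  note V = basis_inv_carrier[of p P "\<lambda>_. 1", folded V_def]
  note symV = basis_inv_sym[of _ p _ P "\<lambda>_. 1", folded V_def]
  let ?Syy = "moment_mat n p p y y" and ?Sxy = "moment_mat n q p x y"
  let ?F = "lin_pred q x \<Theta>0" and ?G = "lin_pred q x (\<Theta> - \<Theta>0)"
  let ?D = "\<Lambda> - \<Lambda>0" and ?DT = "\<Theta> - \<Theta>0"
  define f g where "f = (\<lambda>k i. dot p (P i) (?F k))" and "g = (\<lambda>k i. dot p (P i) (?G k))"
  \<comment> \<open>This is \<Lambda>0^(-1) \<Theta>0^T x_k, the conditional mean up to sign; its
    coefficients in the basis \<open>P\<close> are the numbers \<open>f k i\<close>.\<close>
  define Y where "Y = (\<lambda>k. app p (entries V) (?F k))"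
  have Yexp: "Y k a = (\<Sum>i<p. f k i * P i a)" if "a < p" for k a
    using app_basis_inv[OF that, of P "\<lambda>_. 1"] by (simp add: Y_def V_def f_def mult.commute)
  have appD: "app p (entries ?D) (P i) a = (d i - 1) * app p (entries \<Lambda>0) (P i) a" if ia: "i < p" "a < p" for i a
  proof -
    have "app p (entries ?D) (P i) a = app p (entries \<Lambda>) (P i) a - app p (entries \<Lambda>0) (P i) a"
      using L L0 ia unfolding app_def sum_subtractf[symmetric]
      by (intro sum.cong refl) (auto simp: algebra_simps)
    then show ?thesis using LP[OF ia] by (simp add: algebra_simps)
  qed
  have bilD: "bil p (entries ?D) u (P j) = (d j - 1) * bil p (entries \<Lambda>0) u (P j)" if "j < p" for u j
    using appD[OF that] by (rule bil_eigen)
  have bilDP: "bil p (entries ?D) (P i) (P j) = (if i = j then d i - 1 else 0)" if "i < p" "j < p" for i j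
    using bilD[of j "P i"] P that by simp
  have bilY: "bil p (entries ?D) (Y k) (Y k) = (\<Sum>i<p. (d i - 1) * (f k i)\<^sup>2)" for k
  proof -
    have "bil p (entries ?D) (Y k) (Y k) = bil p (entries ?D) (Y k) (\<lambda>a. \<Sum>j<p. f k j * P j a)"
      by (rule bil_cong) (auto simp: Yexp)
    also have "\<dots> = (\<Sum>j<p. f k j * bil p (entries ?D) (Y k) (P j))"
      by (simp add: bil_def app_sum app_scale dot_sum_right dot_scale_right)
    also have "\<dots> = (\<Sum>j<p. (d j - 1) * (f k j)\<^sup>2)"
    proof (intro sum.cong refl)
      fix j assume j: "j \<in> {..<p}"
      have "bil p (entries ?D) (Y k) (P j) = bil p (entries ?D) (\<lambda>a. \<Sum>i<p. f k i * P i a) (P j)"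
        by (rule bil_cong) (auto simp: Yexp)
      also have "\<dots> = (\<Sum>i<p. f k i * bil p (entries ?D) (P i) (P j))"
        unfolding bil_def by (simp add: dot_commute[of p _ "app p (entries ?D) (P j)"] dot_sum_right dot_scale_right)
      also have "\<dots> = (\<Sum>i<p. if i = j then f k j * (d j - 1) else 0)"
        using j by (intro sum.cong refl) (auto simp: bilDP)
      finally show "f k j * bil p (entries ?D) (Y k) (P j) = (d j - 1) * (f k j)\<^sup>2"
        using j by (simp add: power2_eq_square)
    qed
    finally show ?thesis .
  qed
  have dotY: "dot p (?G k) (Y k) = (\<Sum>i<p. f k i * g k i)" for k
  proof -
    have "dot p (?G k) (Y k) = dot p (?G k) (\<lambda>a. \<Sum>i<p. f k i * P i a)"
      by (rule dot_cong) (auto simp: Yexp)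
    then show ?thesis by (simp add: dot_sum_right dot_scale_right g_def dot_commute)
  qed
  have VD: "(\<Sum>i<p. \<Sum>j<p. V $$ (j, i) * ?D $$ (i, j)) = (\<Sum>i<p. d i - 1)"
  proof -
    have "(\<Sum>i<p. \<Sum>j<p. V $$ (j, i) * ?D $$ (i, j))
        = (\<Sum>i<p. \<Sum>j<p. (\<Sum>k<p. P k i * P k j) * ?D $$ (i, j))"
      by (intro sum.cong refl) (simp add: V_def basis_inv_def mult_ac)
    also have "\<dots> = (\<Sum>k<p. bil p (entries ?D) (P k) (P k))"
      unfolding sum_swap_weighted bil_expand ..
    finally show ?thesis by (simp add: bilDP)
  qed
  define SD where "SD = (\<Sum>a<p. \<Sum>b<p. ?Syy $$ (a, b) * ?D $$ (b, a))"
  define XD where "XD = (\<Sum>b<p. \<Sum>a<q. ?Sxy $$ (a, b) * ?DT $$ (a, b))"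
  have gradT: "(\<Sum>i<q. \<Sum>j<p. grad_Theta n p q x y \<Theta>0 \<Lambda>0 $$ (i, j) * ?DT $$ (i, j))
      = real n / 2 * (- 2 * XD - 2 * (\<Sum>k<n. \<Sum>i<p. f k i * g k i) / real n)"
  proof -
    have "(\<Sum>i<q. \<Sum>j<p. grad_Theta n p q x y \<Theta>0 \<Lambda>0 $$ (i, j) * ?DT $$ (i, j))
      = (\<Sum>i<q. \<Sum>j<p. real n / 2 * (- 2 * (?Sxy $$ (i, j) * ?DT $$ (i, j))
          - 2 * ((\<Sum>k<n. x k i * Y k j) * ?DT $$ (i, j)) / real n))"
      by (intro sum.cong refl)
        (simp add: grad_Theta_def deriv_loglik_Theta[OF L0 V inv0[folded V_def] symV T0] Y_def
          left_diff_distrib algebra_simps diff_divide_distrib)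
    also have "\<dots> = real n / 2 * (- 2 * (\<Sum>i<q. \<Sum>j<p. ?Sxy $$ (i, j) * ?DT $$ (i, j))
        - 2 * (\<Sum>i<q. \<Sum>j<p. (\<Sum>k<n. x k i * Y k j) * ?DT $$ (i, j)) / real n)"
      by (simp add: sum_distrib_left sum_subtractf sum_divide_distrib right_diff_distrib sum_negf)
    also have "(\<Sum>i<q. \<Sum>j<p. (\<Sum>k<n. x k i * Y k j) * ?DT $$ (i, j)) = (\<Sum>k<n. dot p (?G k) (Y k))"
      unfolding sum_swap_weighted unfolding dot_def lin_pred_def sum_distrib_right
      by (rule sum.cong[OF refl], rule sum.swap)
    also have "(\<Sum>i<q. \<Sum>j<p. ?Sxy $$ (i, j) * ?DT $$ (i, j)) = XD"
      unfolding XD_def by (rule sum.swap)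
    finally show ?thesis by (simp add: dotY)
  qed
  have gradL: "(\<Sum>i<p. \<Sum>j<p. grad_Lambda n p q x y \<Theta>0 \<Lambda>0 $$ (i, j) * ?D $$ (i, j))
      = real n / 2 * ((\<Sum>i<p. d i - 1) - SD + (\<Sum>k<n. \<Sum>i<p. (d i - 1) * (f k i)\<^sup>2) / real n)"
  proof -
    have "(\<Sum>i<p. \<Sum>j<p. grad_Lambda n p q x y \<Theta>0 \<Lambda>0 $$ (i, j) * ?D $$ (i, j))
      = (\<Sum>i<p. \<Sum>j<p. real n / 2 * (V $$ (j, i) * ?D $$ (i, j) - ?Syy $$ (j, i) * ?D $$ (i, j)
          + ((\<Sum>k<n. Y k i * Y k j) * ?D $$ (i, j)) / real n))"
      by (intro sum.cong refl)
        (simp add: grad_Lambda_def deriv_loglik_Lambda[OF L0 V inv0[folded V_def] symV T0 _ _ det0] Y_def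
          left_diff_distrib algebra_simps diff_divide_distrib add_divide_distrib)
    also have "\<dots> = real n / 2 * ((\<Sum>i<p. \<Sum>j<p. V $$ (j, i) * ?D $$ (i, j))
        - (\<Sum>i<p. \<Sum>j<p. ?Syy $$ (j, i) * ?D $$ (i, j))
        + (\<Sum>i<p. \<Sum>j<p. (\<Sum>k<n. Y k i * Y k j) * ?D $$ (i, j)) / real n)"
      by (simp add: sum_distrib_left[symmetric] sum_subtractf sum.distrib sum_divide_distrib[symmetric])
    also have "(\<Sum>i<p. \<Sum>j<p. (\<Sum>k<n. Y k i * Y k j) * ?D $$ (i, j)) = (\<Sum>k<n. bil p (entries ?D) (Y k) (Y k))"
      unfolding sum_swap_weighted bil_expand ..
    also have "(\<Sum>i<p. \<Sum>j<p. ?Syy $$ (j, i) * ?D $$ (i, j)) = SD"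
      unfolding SD_def by (rule sum.swap)
    finally show ?thesis by (simp add: VD bilY)
  qed
  have F: "dot p (P i) (?F k) = f k i" for k i by (simp add: f_def)
  have F': "dot p (P i) (lin_pred q x \<Theta> k) = f k i + g k i" for k i
  proof -
    have "dot p (P i) (lin_pred q x \<Theta> k) = dot p (P i) (\<lambda>b. ?F k b + ?G k b)"
      by (rule dot_cong) (auto simp: lin_pred_diff[OF T T0])
    then show ?thesis by (simp add: dot_add_right f_def g_def)
  qed
  have Syy: "(\<Sum>a<p. \<Sum>b<p. ?Syy $$ (a, b) * \<Lambda> $$ (b, a)) = (\<Sum>a<p. \<Sum>b<p. ?Syy $$ (a, b) * \<Lambda>0 $$ (b, a)) + SD"
    unfolding SD_def sum.distrib[symmetric] using L L0 by (intro sum.cong refl) (auto simp: algebra_simps)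
  have Sxy: "(\<Sum>b<p. \<Sum>a<q. ?Sxy $$ (a, b) * \<Theta> $$ (a, b)) = (\<Sum>b<p. \<Sum>a<q. ?Sxy $$ (a, b) * \<Theta>0 $$ (a, b)) + XD"
    unfolding XD_def sum.distrib[symmetric] using T T0 by (intro sum.cong refl) (auto simp: algebra_simps)
  have lndet: "ln (Determinant.det \<Lambda>) = ln (Determinant.det \<Lambda>0) + (\<Sum>i<p. ln (d i))"
  proof -
    have "(\<Prod>i<p. d i) > 0" using d by (intro prod_pos) auto
    moreover have "ln (\<Prod>i<p. d i) = (\<Sum>i<p. ln (d i))"
    proof (rule ln_prod)
      fix i assume "i \<in> {..<p}"
      then show "d i \<noteq> 0" using d[of i] by simp
    qed simp
    ultimately show ?thesis
      unfolding det using ln_mult_pos[OF det0, of "\<Prod>i<p. d i"] by linarith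
  qed
  \<comment> \<open>The completed square: quadratic terms of the two log-likelihoods, then the
    contributions of the \<Lambda> and \<Theta> gradients.\<close>
  have id: "(f k i + g k i)\<^sup>2 / d i - (f k i)\<^sup>2 + (d i - 1) * (f k i)\<^sup>2 - 2 * (f k i * g k i)
      = (g k i - (d i - 1) * f k i)\<^sup>2 / d i" if "i < p" for k i
    using d[OF that] by (simp add: field_simps power2_eq_square)
  have rem: "(\<Sum>k<n. \<Sum>i<p. (g k i - (d i - 1) * f k i)\<^sup>2 / d i)
      = (\<Sum>k<n. \<Sum>i<p. (f k i + g k i)\<^sup>2 / d i) - (\<Sum>k<n. \<Sum>i<p. (f k i)\<^sup>2)
        + (\<Sum>k<n. \<Sum>i<p. (d i - 1) * (f k i)\<^sup>2) - 2 * (\<Sum>k<n. \<Sum>i<p. f k i * g k i)"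
    unfolding sum_distrib_left sum_subtractf[symmetric] sum.distrib[symmetric]
    by (intro sum.cong refl) (simp add: id)
  have "loglik n p q x y \<Theta>0 \<Lambda>0 - loglik n p q x y \<Theta> \<Lambda> + grad_dir n p q x y \<Theta>0 \<Lambda>0 \<Theta> \<Lambda>
    = real n / 2 * ((\<Sum>i<p. d i - 1) - (\<Sum>i<p. ln (d i)) +
       (\<Sum>k<n. \<Sum>i<p. (g k i - (d i - 1) * f k i)\<^sup>2 / d i) / real n)"
    unfolding loglik_expand[OF L0 V inv0[folded V_def] T0] loglik_expand[OF L basis_inv_carrier inv T]
      grad_dir_def gradT gradL Syy Sxy lndet rem V_def bil_basis_inv F F'
    by (simp add: algebra_simps add_divide_distrib diff_divide_distrib)
  then show ?thesis by (simp add: f_def g_def sum_subtractf)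
qed

section \<open>Constants and restricted isometry\<close>

lemma quad_form_signal_mat:
  assumes T: "\<Theta> \<in> carrier_mat q p" and S: "S \<in> carrier_mat q q" and v: "v \<in> carrier_vec p"
  shows "quad_form (signal_mat \<Theta> S) v = quad_form S (\<Theta> *\<^sub>v v)"
proof -
  have "signal_mat \<Theta> S = transpose_mat \<Theta> * (S * \<Theta>)" using T S by (simp add: signal_mat_def)
  then have "signal_mat \<Theta> S *\<^sub>v v = transpose_mat \<Theta> *\<^sub>v (S *\<^sub>v (\<Theta> *\<^sub>v v))"
    using T S v assoc_mult_mat_vec[of "transpose_mat \<Theta>" p q "S * \<Theta>" p v] assoc_mult_mat_vec[of S q q \<Theta> p v]
    by simp
  then show ?thesis
    using T S v transpose_vec_mult_scalar[OF T v, of "S *\<^sub>v (\<Theta> *\<^sub>v v)"]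
    by (simp add: quad_form_def comm_scalar_prod[of v p] comm_scalar_prod[of _ q])
qed

lemma signal_mat_symmetric:
  assumes T: "\<Theta> \<in> carrier_mat q p" and S: "S \<in> carrier_mat q q" "transpose_mat S = S"
    and "i < p" "j < p"
  shows "signal_mat \<Theta> S $$ (i, j) = signal_mat \<Theta> S $$ (j, i)"
proof -
  have "transpose_mat (signal_mat \<Theta> S) = signal_mat \<Theta> S"
    using T S transpose_mult[of "transpose_mat \<Theta>" p q "S * \<Theta>" p] transpose_mult[of S q q \<Theta> p]
    by (simp add: signal_mat_def)
  moreover have "transpose_mat (signal_mat \<Theta> S) $$ (j, i) = signal_mat \<Theta> S $$ (i, j)"
    using assms signal_mat_carrier[OF T S(1)] by auto
  ultimately show ?thesis by simp
qed

text \<open>A vanishing signal is possible at this stage; strict positivity is obtained in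
  \<open>rate_conditions\<close> from the bound on \<open>R\<close>.\<close>

lemma eig_max_signal_mat_nonneg:
  assumes p: "p \<ge> 1" and T: "\<Theta> \<in> carrier_mat q p" and S: "sym_pos_def q S"
  shows "eig_max (signal_mat \<Theta> S) \<ge> 0"
proof -
  have Sc: "S \<in> carrier_mat q q" "transpose_mat S = S" using S by (auto simp: sym_pos_def_def)
  note c = signal_mat_carrier[OF T Sc(1)]
  have "eigenvalue (signal_mat \<Theta> S) (eig_max (signal_mat \<Theta> S))"
    by (rule eig_max_symmetric(2)[OF p c signal_mat_symmetric[OF T Sc]])
  then obtain w where w: "\<exists>i<p. w i \<noteq> 0"
    "\<forall>i<p. app p (entries (signal_mat \<Theta> S)) w i = eig_max (signal_mat \<Theta> S) * w i"
    using eigenvalue_iff_app[OF c] by blast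
  have "eig_max (signal_mat \<Theta> S) * dot p w w = quad_form (signal_mat \<Theta> S) (vec p w)"
    using bil_eigenvector[OF w(2)[rule_format]] quad_form_vec[OF c] by simp
  also have "\<dots> = quad_form S (\<Theta> *\<^sub>v vec p w)" by (rule quad_form_signal_mat[OF T Sc(1)]) simp
  also have "\<dots> \<ge> 0"
  proof (cases "\<Theta> *\<^sub>v vec p w = 0\<^sub>v q")
    case True
    then show ?thesis using Sc by (simp add: quad_form_def)
  next
    case False
    then show ?thesis using S T by (auto simp: sym_pos_def_def intro: less_imp_le)
  qed
  finally show ?thesis using dot_pos[OF w(1)] by (simp add: zero_le_mult_iff)
qed

lemma sym_pos_def_diag_pos:
  assumes "sym_pos_def p A" "i < p"
  shows "A $$ (i, i) > 0"
proof -
  have "bil p (entries A) (\<lambda>j. if j = i then 1 else 0) (\<lambda>j. if j = i then 1 else 0) = A $$ (i, i)"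
    using assms(2) by (simp add: bil_expand if_distrib[of "\<lambda>z. z * _"] if_distrib[of "\<lambda>z. _ * z"] cong: if_cong)
  moreover have "\<exists>j<p. (if j = i then 1 else 0 :: real) \<noteq> 0" using assms(2) by auto
  ultimately show ?thesis using sym_pos_def_pd[OF assms(1), of "\<lambda>j. if j = i then 1 else 0"] by simp
qed

lemma finite_supports:
  "finite (row_supp_Theta \<Theta>)" "finite (supp_Lambda \<Lambda>)"
proof -
  show "finite (row_supp_Theta \<Theta>)"
    by (rule finite_subset[of _ "{..<dim_row \<Theta>} \<times> {..<dim_col \<Theta>}"]) (auto simp: row_supp_Theta_def)
  show "finite (supp_Lambda \<Lambda>)"
    by (rule finite_subset[of _ "{..<dim_row \<Lambda>} \<times> {..<dim_col \<Lambda>}"]) (auto simp: supp_Lambda_def)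
qed

lemma card_S_row: "card (S_row \<Theta> \<Lambda>) = card (row_supp_Theta \<Theta>) + card (supp_Lambda \<Lambda>)"
  by (simp add: S_row_def card_Plus finite_supports)

text \<open>The diagonal of a positive definite matrix lies in its support. This keeps the rate and
  the block length positive.\<close>

lemma card_S_row_pos:
  assumes "sym_pos_def p \<Lambda>" "p \<ge> 1"
  shows "card (S_row \<Theta> \<Lambda>) \<ge> 1"
proof -
  have "(0, 0) \<in> supp_Lambda \<Lambda>"
    using assms sym_pos_def_diag_pos[OF assms(1), of 0] by (auto simp: supp_Lambda_def sym_pos_def_def)
  then have "card (supp_Lambda \<Lambda>) \<noteq> 0" using finite_supports(2) by (metis card_0_eq empty_iff)
  then show ?thesis by (simp add: card_S_row)
qed

lemma eig_max_pos_def: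
  assumes "n \<ge> 1" "sym_pos_def n A"
  shows "eig_max A > 0" "eig_min A > 0" "eig_min A \<le> eig_max A"
    "bil n (entries A) u u \<le> eig_max A * dot n u u" "bil n (entries A) u u \<ge> eig_min A * dot n u u"
proof -
  have A: "A \<in> carrier_mat n n" using assms(2) by (simp add: sym_pos_def_def)
  note M = eig_max_symmetric[OF assms(1) A sym_pos_def_sym[OF assms(2)]]
  note m = eig_min_symmetric[OF assms(1) A sym_pos_def_sym[OF assms(2)]]
  show "eig_max A > 0" "eig_min A > 0" using eigenvalue_pos_def[OF assms(2)] M(2) m(2) by auto
  show "eig_min A \<le> eig_max A" using m(3) M(2) by blast
  show "bil n (entries A) u u \<le> eig_max A * dot n u u" "bil n (entries A) u u \<ge> eig_min A * dot n u u"
    using M(1) m(1) by auto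
qed

lemma eig_min_smult_pos_def:
  assumes n: "n \<ge> 1" and A: "sym_pos_def n A" and c: "c > 0"
  shows "0 < eig_min (c \<cdot>\<^sub>m A)" "eig_min (c \<cdot>\<^sub>m A) \<le> c * eig_min A"
proof -
  have Ac: "A \<in> carrier_mat n n" using A by (simp add: sym_pos_def_def)
  then have cA: "c \<cdot>\<^sub>m A \<in> carrier_mat n n" by simp
  have sym: "(c \<cdot>\<^sub>m A) $$ (i, j) = (c \<cdot>\<^sub>m A) $$ (j, i)" if "i < n" "j < n" for i j
    using that Ac sym_pos_def_sym[OF A that] by simp
  note m = eig_min_symmetric[OF n cA sym]
  have "eigenvalue (c \<cdot>\<^sub>m A) (c * eig_min A)"
    by (rule eigenvalue_smult[OF Ac eig_min_symmetric(2)[OF n Ac sym_pos_def_sym[OF A]]])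
  then show "eig_min (c \<cdot>\<^sub>m A) \<le> c * eig_min A" using m(3) by blast
  have "eigenvalue (inverse c \<cdot>\<^sub>m (c \<cdot>\<^sub>m A)) (inverse c * eig_min (c \<cdot>\<^sub>m A))"
    by (rule eigenvalue_smult[OF cA m(2)])
  moreover have "inverse c \<cdot>\<^sub>m (c \<cdot>\<^sub>m A) = A" using c Ac by (intro eq_matI) auto
  ultimately have "inverse c * eig_min (c \<cdot>\<^sub>m A) > 0" using eigenvalue_pos_def[OF A] by simp
  then show "0 < eig_min (c \<cdot>\<^sub>m A)" using c by (simp add: zero_less_mult_iff)
qed

text \<open>Dropping the factor \<open>alpha_const\<close> squared, which is at least 1, leaves what
  the sample size condition needs in order to bound the squared rate by a ratio of
  \<open>rho1\<close> and \<open>rho2\<close>.\<close>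

lemma s0_const_ge:
  assumes "0 < \<nu>0" "\<nu>0 < \<nu>1" "0 < rho1 \<Lambda>0 Sig0" "0 < rho2 Sig0"
  shows "4 * (rho2 Sig0 / rho1 \<Lambda>0 Sig0) * real (card (S_row \<Theta>0 \<Lambda>0)) \<le> real (s0_const \<nu>0 \<nu>1 \<Theta>0 \<Lambda>0 Sig0)"
proof -
  define t where "t = 4 * (rho2 Sig0 / rho1 \<Lambda>0 Sig0) * real (card (S_row \<Theta>0 \<Lambda>0))"
  have t: "t \<ge> 0" using assms by (simp add: t_def)
  have "alpha_const \<nu>0 \<nu>1 \<ge> 1" using assms by (simp add: alpha_const_def)
  then have "(alpha_const \<nu>0 \<nu>1)\<^sup>2 \<ge> 1" by simp
  then have "t \<le> t * (alpha_const \<nu>0 \<nu>1)\<^sup>2" using t by (simp add: mult_le_cancel_left1)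
  also have "\<dots> \<le> real (nat \<lceil>t * (alpha_const \<nu>0 \<nu>1)\<^sup>2\<rceil>)" by (rule real_nat_ceiling_ge)
  also have "\<dots> \<le> real (s0_const \<nu>0 \<nu>1 \<Theta>0 \<Lambda>0 Sig0)"
    unfolding s0_const_def t_def by (simp add: mult_ac)
  finally show ?thesis by (simp add: t_def)
qed

lemma basic_constants:
  assumes pq: "p \<ge> 1" "q \<ge> 1" and L: "sym_pos_def p \<Lambda>0" and Sig: "sym_pos_def q Sig0"
  shows "0 < rho1 \<Lambda>0 Sig0" "rho1 \<Lambda>0 Sig0 \<le> rho2 Sig0" "rho1 \<Lambda>0 Sig0 * eig_max \<Lambda>0 \<le> 1 / 2"
    "rho1 \<Lambda>0 Sig0 \<le> 0.5 * eig_min Sig0"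
proof -
  note l = eig_max_pos_def[OF pq(1) L] and s = eig_max_pos_def[OF pq(2) Sig]
  show "0 < rho1 \<Lambda>0 Sig0" using l s by (simp add: rho1_def)
  show "rho1 \<Lambda>0 Sig0 \<le> 0.5 * eig_min Sig0" by (simp add: rho1_def)
  then show "rho1 \<Lambda>0 Sig0 \<le> rho2 Sig0" using s(1,2,3) by (simp add: rho2_def)
  have "rho1 \<Lambda>0 Sig0 \<le> 0.5 * inverse (eig_max \<Lambda>0)" by (simp add: rho1_def)
  then have "rho1 \<Lambda>0 Sig0 * eig_max \<Lambda>0 \<le> 0.5 * inverse (eig_max \<Lambda>0) * eig_max \<Lambda>0"
    using l(1) by (intro mult_right_mono) auto
  then show "rho1 \<Lambda>0 Sig0 * eig_max \<Lambda>0 \<le> 1 / 2" using l(1) by simp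
qed

lemma rate_conditions:
  assumes pq: "p \<ge> 1" "q \<ge> 1" and n: "n \<ge> 1" and \<nu>: "0 < \<nu>0" "\<nu>0 < \<nu>1"
    and par: "(\<Theta>0, \<Lambda>0) \<in> param_space p q R" and Sig: "sym_pos_def q Sig0"
    and ss: "sample_size_cond e0 n p q (s0_const \<nu>0 \<nu>1 \<Theta>0 \<Lambda>0 Sig0)" and e0: "0 < e0" "e0 < 1"
    and R: "R < 2 * eig_max \<Lambda>0 * sqrt (r0_const \<Theta>0 \<Lambda>0 Sig0) / eps_rate C n p q \<Theta>0 \<Lambda>0 Sig0"
    and C: "C > 0"
  defines "s \<equiv> sqrt (real (card (S_row \<Theta>0 \<Lambda>0)) * ln (real (p + q)) / real n)"
  shows "eig_max (signal_mat \<Theta>0 Sig0) > 0" "beta0 \<Theta>0 \<Lambda>0 Sig0 > 0"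
    "(s\<^sup>2 / beta0 \<Theta>0 \<Lambda>0 Sig0) ^ 3 \<le> 1 / C ^ 4"
proof -
  have T: "\<Theta>0 \<in> carrier_mat q p" and L: "sym_pos_def p \<Lambda>0" and sn: "spectral_norm \<Lambda>0 < R"
    using par by (auto simp: param_space_def)
  note l = eig_max_pos_def[OF pq(1) L] and b = basic_constants[OF pq L Sig]
  let ?r0 = "r0_const \<Theta>0 \<Lambda>0 Sig0" and ?sg = "eig_max (signal_mat \<Theta>0 Sig0)" and ?\<beta> = "beta0 \<Theta>0 \<Lambda>0 Sig0"
    and ?L = "eig_max \<Lambda>0" and ?cS = "real (card (S_row \<Theta>0 \<Lambda>0))" and ?r1 = "rho1 \<Lambda>0 Sig0" and ?r2 = "rho2 Sig0"
    and ?ln = "ln (real (p + q))" and ?s0 = "s0_const \<nu>0 \<nu>1 \<Theta>0 \<Lambda>0 Sig0"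
  have r2: "?r2 > 0" using b by linarith
  have cS: "?cS > 0" using card_S_row_pos[OF L pq(1)] by (simp add: Suc_le_eq)
  have ln: "?ln > 0" using pq by simp
  have spos: "s > 0" using cS ln n by (simp add: s_def)
  have LR: "?L < R" using eig_max_le_spectral_norm[OF pq(1) L] sn by simp
  have eps: "eps_rate C n p q \<Theta>0 \<Lambda>0 Sig0 = C / ?\<beta> * s" by (simp add: eps_rate_def s_def)
  have m3: "eig_min (3 \<cdot>\<^sub>m \<Lambda>0) > 0" "eig_min (3 \<cdot>\<^sub>m \<Lambda>0) \<le> 3 * eig_min \<Lambda>0"
    using eig_min_smult_pos_def[OF pq(1) L, of 3] by auto
  show sg: "?sg > 0"
  proof (rule ccontr)
    assume "\<not> ?sg > 0"
    then have "?sg = 0" using eig_max_signal_mat_nonneg[OF pq(1) T Sig] by simp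
    \<comment> \<open>Then the numerator in the bound on \<open>R\<close> is zero, so
      \<open>R < 0\<close> whatever the denominator, contrary to \<open>R\<close> exceeding the
      largest eigenvalue of \<open>\<Lambda>0\<close>.\<close>
    then have "?r0 = 0" using l(2) by (simp add: r0_const_def)
    then show False using R LR l(1) by simp
  qed
  show \<beta>: "?\<beta> > 0" using b(1) l(1) sg m3(1) by (simp add: beta0_def)
  have r0pos: "?r0 > 0" using l(2) sg r2 by (simp add: r0_const_def)
  have ep: "C / ?\<beta> * s > 0" using C \<beta> spos by simp
  \<comment> \<open>The true \<open>\<Lambda>0\<close> lies in the parameter space, so
    \<open>?L < R\<close>; the factor \<open>?L\<close> cancels and a bound on the rate
    remains.\<close>
  have "?L < 2 * ?L * sqrt ?r0 / (C / ?\<beta> * s)" using R LR unfolding eps by linarith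
  then have "?L * (C / ?\<beta> * s) < 2 * ?L * sqrt ?r0" using ep by (simp only: pos_less_divide_eq)
  then have "?L * (C / ?\<beta> * s) < ?L * (2 * sqrt ?r0)" by (simp only: mult_ac)
  then have h2: "C / ?\<beta> * s \<le> 2 * sqrt ?r0" using l(1) by (simp only: mult_less_cancel_left_pos)
  have h1: "s\<^sup>2 \<le> ?r1 / (4 * ?r2)"
  proof -
    \<comment> \<open>Dividing by \<open>e0 < 1\<close> only enlarges, so the sample size condition
      may be used with 1 in place of \<open>e0\<close>.\<close>
    have "real (p + ?s0) * ?ln \<le> real (p + ?s0) * ?ln / e0"
      using e0 ln by (simp add: pos_le_divide_eq mult_left_le)
    then have "real (p + ?s0) * ?ln < real n" using ss by (simp add: sample_size_cond_def)
    moreover have "real ?s0 * ?ln \<le> real (p + ?s0) * ?ln" using ln by (intro mult_right_mono) auto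
    moreover have "4 * (?r2 / ?r1) * ?cS * ?ln \<le> real ?s0 * ?ln"
      using s0_const_ge[OF \<nu> b(1) r2] ln by (intro mult_right_mono) auto
    ultimately have "4 * (?r2 / ?r1) * ?cS * ?ln \<le> real n" by linarith
    then have "?cS * ?ln / real n \<le> ?r1 / (4 * ?r2)" using b(1) r2 n by (simp add: field_simps)
    moreover have "s\<^sup>2 = ?cS * ?ln / real n" unfolding s_def using cS ln by (intro real_sqrt_pow2) auto
    ultimately show ?thesis by simp
  qed
  show "(s\<^sup>2 / ?\<beta>) ^ 3 \<le> 1 / C ^ 4"
  proof (rule rate_small[where ?r0.0 = ?r0 and ?r1.0 = ?r1 and ?r2.0 = ?r2 and L = ?L and m = "eig_min \<Lambda>0"
        and ?m3.0 = "eig_min (3 \<cdot>\<^sub>m \<Lambda>0)" and sg = ?sg])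
    show "?\<beta> = ?r1 / (40 * ?L) * min 1 (eig_min (3 \<cdot>\<^sub>m \<Lambda>0) / (16 * ?sg))" by (simp add: beta0_def)
    show "?r0 \<le> 0.5 * eig_min \<Lambda>0" "?r0 \<le> 0.13 * sqrt (?sg / ?r2)" by (simp_all add: r0_const_def)
  qed (use C b l m3 sg r0pos spos h1 h2 in auto)
qed

text \<open>On the reals, \<open>Inf\<close> and \<open>Sup\<close> bound the members of a set only
  if the set is bounded, so this is shown first, from the extreme eigenvalues. The factors 0.5 and
  1.5 are those built into \<open>rho1\<close> and \<open>rho2\<close>.\<close>

lemma sparse_RIP_bounds:
  assumes pq: "p \<ge> 1" "q \<ge> 1" and L: "sym_pos_def p \<Lambda>0" and Sig: "sym_pos_def q Sig0"
    and S: "S \<in> carrier_mat q q" "\<And>u. bil q (entries S) u u \<ge> 0"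
    and rip: "sparse_RIP q s S Sig0 \<Theta>0" and u: "card {i. i < q \<and> u i \<noteq> 0} \<le> s"
  shows "rho1 \<Lambda>0 Sig0 * dot q u u \<le> bil q (entries S) u u"
    and "bil q (entries S) u u \<le> rho2 Sig0 * dot q u u"
proof -
  have Sc: "Sig0 \<in> carrier_mat q q" using Sig by (simp add: sym_pos_def_def)
  note sg = eig_max_pos_def[OF pq(2) Sig] and b = basic_constants[OF pq L Sig]
  have "rho1 \<Lambda>0 Sig0 * dot q u u \<le> bil q (entries S) u u \<and> bil q (entries S) u u \<le> rho2 Sig0 * dot q u u"
  proof (cases "\<exists>i<q. u i \<noteq> 0")
    case False
    then show ?thesis by (simp add: bil_expand dot_def)
  next
    case True
    let ?Q = "sparse_ratios q s S Sig0"
    obtain c where c: "c > 0" "\<And>u. \<bar>bil q (entries S) u u\<bar> \<le> c * dot q u u" using bil_bound by blast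
    have "\<exists>w. (\<exists>i<q. w i \<noteq> 0) \<and> z = bil q (entries S) w w / bil q (entries Sig0) w w" if z: "z \<in> ?Q" for z
    proof -
      obtain v where v: "v \<in> carrier_vec q" "v \<noteq> 0\<^sub>v q" "z = quad_form S v / quad_form Sig0 v"
        using z by (auto simp: sparse_ratios_def)
      have "vec q (\<lambda>i. v $ i) = v" using v(1) by auto
      then have "z = bil q (entries S) (\<lambda>i. v $ i) (\<lambda>i. v $ i) / bil q (entries Sig0) (\<lambda>i. v $ i) (\<lambda>i. v $ i)"
        using v(3) quad_form_vec[OF S(1), of "\<lambda>i. v $ i"] quad_form_vec[OF Sc, of "\<lambda>i. v $ i"] by simp
      moreover have "\<exists>i<q. v $ i \<noteq> 0" using v(1,2) by (metis carrier_vecD eq_vecI index_zero_vec)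
      ultimately show ?thesis by (intro exI[of _ "\<lambda>i. v $ i"]) auto
    qed
    note Q = this
    have bdd: "bdd_below ?Q" "bdd_above ?Q"
    proof -
      show "bdd_below ?Q"
      proof (rule bdd_belowI)
        fix z assume "z \<in> ?Q"
        then obtain w where "\<exists>i<q. w i \<noteq> 0" "z = bil q (entries S) w w / bil q (entries Sig0) w w" using Q by blast
        then show "0 \<le> z" using S(2) sym_pos_def_pd[OF Sig] by (simp add: less_imp_le)
      qed
      show "bdd_above ?Q"
      proof (rule bdd_aboveI)
        fix z assume "z \<in> ?Q"
        then obtain w where w: "\<exists>i<q. w i \<noteq> 0" "z = bil q (entries S) w w / bil q (entries Sig0) w w" using Q by blast
        have "bil q (entries S) w w \<le> c * dot q w w" using c(2)[of w] by simp
        also have "\<dots> \<le> c * (bil q (entries Sig0) w w / eig_min Sig0)"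
          using sg(5)[of w] sg(2) c(1) by (intro mult_left_mono) (auto simp: field_simps)
        finally have "bil q (entries S) w w \<le> (c / eig_min Sig0) * bil q (entries Sig0) w w" by simp
        then show "z \<le> c / eig_min Sig0"
          using w sym_pos_def_pd[OF Sig w(1)] by (simp only: pos_divide_le_eq)
      qed
    qed
    have "vec q u \<noteq> 0\<^sub>v q" using True by (metis index_vec index_zero_vec(1))
    moreover have "l0_norm (vec q u) \<le> s"
    proof -
      have "{i. i < dim_vec (vec q u) \<and> vec q u $ i \<noteq> 0} = {i. i < q \<and> u i \<noteq> 0}" by auto
      then show ?thesis using u by (simp add: l0_norm_def)
    qed
    ultimately have mem: "bil q (entries S) u u / bil q (entries Sig0) u u \<in> ?Q"
      unfolding sparse_ratios_def
      by (intro CollectI exI[of _ "vec q u"]) (simp add: quad_form_vec[OF S(1)] quad_form_vec[OF Sc])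
    have B: "bil q (entries Sig0) u u > 0" by (rule sym_pos_def_pd[OF Sig True])
    have "0.5 \<le> bil q (entries S) u u / bil q (entries Sig0) u u"
      using rip cInf_lower[OF mem bdd(1)] unfolding sparse_RIP_def by (blast intro: order_trans)
    then have lo: "0.5 * bil q (entries Sig0) u u \<le> bil q (entries S) u u" using B by (simp only: pos_le_divide_eq)
    have "bil q (entries S) u u / bil q (entries Sig0) u u \<le> 1.5"
      using rip cSup_upper[OF mem bdd(2)] unfolding sparse_RIP_def by (blast intro: order_trans)
    then have up: "bil q (entries S) u u \<le> 1.5 * bil q (entries Sig0) u u" using B by (simp only: pos_divide_le_eq)
    have "rho1 \<Lambda>0 Sig0 * dot q u u \<le> 0.5 * eig_min Sig0 * dot q u u"
      using b(4) dot_nonneg by (intro mult_right_mono) auto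
    also have "\<dots> \<le> 0.5 * bil q (entries Sig0) u u" using sg(5)[of u] by simp
    finally show ?thesis using lo up sg(4)[of u] by (simp add: rho2_def)
  qed
  then show "rho1 \<Lambda>0 Sig0 * dot q u u \<le> bil q (entries S) u u"
    and "bil q (entries S) u u \<le> rho2 Sig0 * dot q u u" by auto
qed

section \<open>Bounds in the diagonalizing basis\<close>

text \<open>The sum on the right is the form of \<Lambda>0^(-1) at \<open>r\<close>. With z =
  \<Lambda>0^(-1) r, Cauchy-Schwarz in the form \<open>\<Lambda>0\<close> bounds the square of |r|^2
  by the product of the forms at r and at z.\<close>

lemma basis_dot_bound:
  assumes p: "p \<ge> 1" and L: "sym_pos_def p \<Lambda>0" and inv: "\<Lambda>0 * basis_inv p P (\<lambda>_. 1) = 1\<^sub>m p"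
    and up: "\<And>u. bil p (entries \<Lambda>0) u u \<le> c * dot p u u"
  shows "dot p r r \<le> c * (\<Sum>i<p. (dot p (P i) r)\<^sup>2)"
proof -
  let ?V = "basis_inv p P (\<lambda>_. 1)"
  have Lc: "\<Lambda>0 \<in> carrier_mat p p" using L by (simp add: sym_pos_def_def)
  define z where "z = app p (entries ?V) r"
  have Lz: "app p (entries \<Lambda>0) z a = r a" if a: "a < p" for a
  proof -
    have "app p (entries \<Lambda>0) z a = (\<Sum>b<p. \<Sum>e<p. \<Lambda>0 $$ (a, b) * ?V $$ (b, e) * r e)"
      by (simp add: z_def app_def sum_distrib_left mult.assoc)
    also have "\<dots> = (\<Sum>e<p. (\<Sum>b<p. \<Lambda>0 $$ (a, b) * ?V $$ (b, e)) * r e)"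
      unfolding sum_distrib_right by (rule sum.swap)
    also have "\<dots> = (\<Sum>e<p. if e = a then r e else 0)"
    proof (intro sum.cong refl)
      fix e assume "e \<in> {..<p}"
      then have e: "e < p" by simp
      show "(\<Sum>b<p. \<Lambda>0 $$ (a, b) * ?V $$ (b, e)) * r e = (if e = a then r e else 0)"
        using mult_entry[OF Lc basis_inv_carrier a e, of P "\<lambda>_. 1", symmetric] a e unfolding inv by simp
    qed
    finally show ?thesis using a by simp
  qed
  have zz: "bil p (entries \<Lambda>0) z z = (\<Sum>i<p. (dot p (P i) r)\<^sup>2)"
  proof -
    have "bil p (entries \<Lambda>0) z z = dot p z r" unfolding bil_def by (rule dot_cong) (auto simp: Lz)
    also have "\<dots> = bil p (entries ?V) r r" unfolding bil_def z_def by (rule dot_commute)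
    finally show ?thesis by (simp add: bil_basis_inv)
  qed
  have rz: "bil p (entries \<Lambda>0) r z = dot p r r" unfolding bil_def by (rule dot_cong) (auto simp: Lz)
  have psd: "bil p (entries \<Lambda>0) u u \<ge> 0" for u
  proof (cases "\<exists>i<p. u i \<noteq> 0")
    case True
    then show ?thesis using sym_pos_def_pd[OF L] by (simp add: less_imp_le)
  qed (simp add: bil_expand)
  have "(dot p r r)\<^sup>2 \<le> bil p (entries \<Lambda>0) r r * (\<Sum>i<p. (dot p (P i) r)\<^sup>2)"
    using psd_cauchy_schwarz[OF sym_pos_def_sym[OF L] psd, of r z] by (simp add: rz zz)
  also have "\<dots> \<le> (c * dot p r r) * (\<Sum>i<p. (dot p (P i) r)\<^sup>2)"
    by (intro mult_right_mono up sum_nonneg) auto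
  finally have "dot p r r * dot p r r \<le> dot p r r * (c * (\<Sum>i<p. (dot p (P i) r)\<^sup>2))"
    by (simp add: power2_eq_square mult_ac)
  \<comment> \<open>Cancelling \<open>dot p r r\<close> fails when it is zero. Then only
    \<open>c \<ge> 0\<close> is needed, which any nonzero vector shows; one exists because
    \<open>p \<ge> 1\<close>.\<close>
  moreover have "c * (\<Sum>i<p. (dot p (P i) r)\<^sup>2) \<ge> 0" if "dot p r r = 0"
  proof -
    define u where "u = (\<lambda>i :: nat. 1 :: real)"
    have "0 \<le> c * dot p u u" using up[of u] psd[of u] by simp
    moreover have "dot p u u > 0" using p by (simp add: dot_def u_def)
    ultimately have "c \<ge> 0" by (simp add: zero_le_mult_iff)
    then show ?thesis by (simp add: sum_nonneg)
  qed
  ultimately show ?thesis using dot_nonneg[of p r] by (cases "dot p r r = 0") auto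
qed

text \<open>The basis bound is used twice, each time at the price of one factor \<open>c\<close>: on
  the rows of \<open>D\<close>, whose products with \<open>P i\<close> are the entries of w_i
  \<Lambda>0 P_i, and then on the vectors \<Lambda>0 P_i themselves, whose products with the basis
  are 0 or 1.\<close>

lemma Lambda_diff_bound:
  assumes p: "p \<ge> 1" and L: "sym_pos_def p \<Lambda>0" and inv: "\<Lambda>0 * basis_inv p P (\<lambda>_. 1) = 1\<^sub>m p"
    and up: "\<And>u. bil p (entries \<Lambda>0) u u \<le> c * dot p u u" and c: "c \<ge> 0"
    and P: "\<And>i j. i < p \<Longrightarrow> j < p \<Longrightarrow> bil p (entries \<Lambda>0) (P i) (P j) = (if i = j then 1 else 0)"
    and D: "\<And>i a. i < p \<Longrightarrow> a < p \<Longrightarrow> app p D (P i) a = w i * app p (entries \<Lambda>0) (P i) a"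
  shows "(\<Sum>a<p. \<Sum>b<p. (D a b)\<^sup>2) \<le> c\<^sup>2 * (\<Sum>i<p. (w i)\<^sup>2)"
proof -
  note bd = basis_dot_bound[OF p L inv up]
  have "(\<Sum>a<p. \<Sum>b<p. (D a b)\<^sup>2) = (\<Sum>a<p. dot p (D a) (D a))"
    by (simp add: dot_def power2_eq_square)
  also have "\<dots> \<le> (\<Sum>a<p. c * (\<Sum>i<p. (dot p (P i) (D a))\<^sup>2))" by (intro sum_mono bd)
  also have "\<dots> = (\<Sum>a<p. \<Sum>i<p. c * (w i * app p (entries \<Lambda>0) (P i) a)\<^sup>2)"
  proof -
    have "dot p (P i) (D a) = app p D (P i) a" for i a by (simp add: dot_def app_def mult.commute)
    then show ?thesis unfolding sum_distrib_left by (intro sum.cong refl) (simp add: D)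
  qed
  also have "\<dots> = (\<Sum>i<p. c * (w i)\<^sup>2 * dot p (app p (entries \<Lambda>0) (P i)) (app p (entries \<Lambda>0) (P i)))"
    by (subst sum.swap) (simp add: dot_def sum_distrib_left power2_eq_square mult_ac)
  also have "\<dots> \<le> (\<Sum>i<p. c * (w i)\<^sup>2 * c)"
  proof (intro sum_mono mult_left_mono)
    fix i assume "i \<in> {..<p}"
    then have i: "i < p" by simp
    have "(\<Sum>j<p. (dot p (P j) (app p (entries \<Lambda>0) (P i)))\<^sup>2) = (\<Sum>j<p. if j = i then 1 else 0)"
      using P i unfolding bil_def[symmetric] by (intro sum.cong refl) auto
    then show "dot p (app p (entries \<Lambda>0) (P i)) (app p (entries \<Lambda>0) (P i)) \<le> c"
      using bd[of "app p (entries \<Lambda>0) (P i)"] i by simp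
  qed (use c in auto)
  finally show ?thesis by (simp add: sum_distrib_left power2_eq_square mult_ac)
qed

text \<open>The remainder controls only the mixed quantity \<open>g - w * f\<close>. The triangle
  inequality recovers \<open>g\<close>, the effect of the error in \<Theta>, at the cost of the
  signal \<open>f\<close> times the size of \<open>w\<close>.\<close>

lemma response_lower_bound:
  fixes f g :: "nat \<Rightarrow> nat \<Rightarrow> real" and h w :: "nat \<Rightarrow> real"
  assumes h: "\<And>k. h k \<le> L * (\<Sum>i<p. (g k i)\<^sup>2)" and L: "L > 0"
    and f: "\<And>i. i < p \<Longrightarrow> (\<Sum>k<n. (f k i)\<^sup>2) / real n \<le> \<tau>" and \<tau>: "\<tau> \<ge> 0"
  shows "sqrt ((\<Sum>k<n. h k) / real n) / sqrt L
    \<le> sqrt ((\<Sum>k<n. \<Sum>i<p. (g k i - w i * f k i)\<^sup>2) / real n) + sqrt \<tau> * sqrt (\<Sum>i<p. (w i)\<^sup>2)"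
proof -
  let ?R = "{..<n} \<times> {..<p}"
  have L2: "L2_set (\<lambda>(k, i). F k i / sqrt (real n)) ?R = sqrt ((\<Sum>k<n. \<Sum>i<p. (F k i)\<^sup>2) / real n)" for F
    unfolding L2_set_def sum.cartesian_product sum_divide_distrib
    by (intro arg_cong[of _ _ sqrt] sum.cong refl) (auto simp: power_divide)
  have "(\<Sum>k<n. h k) / real n / L \<le> (\<Sum>k<n. \<Sum>i<p. (g k i)\<^sup>2) / real n"
  proof -
    have "(\<Sum>k<n. h k) \<le> L * (\<Sum>k<n. \<Sum>i<p. (g k i)\<^sup>2)"
      unfolding sum_distrib_left[of L] using h by (auto intro!: sum_mono simp: sum_distrib_left)
    then have "(\<Sum>k<n. h k) / L \<le> (\<Sum>k<n. \<Sum>i<p. (g k i)\<^sup>2)" using L by (simp add: pos_divide_le_eq mult.commute)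
    then have "(\<Sum>k<n. h k) / L / real n \<le> (\<Sum>k<n. \<Sum>i<p. (g k i)\<^sup>2) / real n" by (rule divide_right_mono) simp
    then show ?thesis by (simp add: mult.commute)
  qed
  then have "sqrt ((\<Sum>k<n. h k) / real n) / sqrt L \<le> L2_set (\<lambda>(k, i). g k i / sqrt (real n)) ?R"
    unfolding L2 by (simp add: real_sqrt_divide[symmetric])
  also have "(\<lambda>(k, i). g k i / sqrt (real n)) = (\<lambda>ki. (case ki of (k, i) \<Rightarrow> (g k i - w i * f k i) / sqrt (real n)) +
      (case ki of (k, i) \<Rightarrow> w i * f k i / sqrt (real n)))"
    by (auto simp: fun_eq_iff add_divide_distrib[symmetric])
  also have "L2_set \<dots> ?R \<le> L2_set (\<lambda>(k, i). (g k i - w i * f k i) / sqrt (real n)) ?R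
      + L2_set (\<lambda>(k, i). w i * f k i / sqrt (real n)) ?R"
    by (rule L2_set_triangle_ineq)
  also have "L2_set (\<lambda>(k, i). w i * f k i / sqrt (real n)) ?R \<le> sqrt (\<tau> * (\<Sum>i<p. (w i)\<^sup>2))"
    unfolding L2
  proof (rule real_sqrt_le_mono)
    have "(\<Sum>k<n. \<Sum>i<p. (w i * f k i)\<^sup>2) / real n = (\<Sum>i<p. (w i)\<^sup>2 * ((\<Sum>k<n. (f k i)\<^sup>2) / real n))"
      by (subst sum.swap) (simp add: sum_divide_distrib sum_distrib_left power_mult_distrib)
    also have "\<dots> \<le> (\<Sum>i<p. (w i)\<^sup>2 * \<tau>)" using f by (intro sum_mono mult_left_mono) auto
    finally show "(\<Sum>k<n. \<Sum>i<p. (w i * f k i)\<^sup>2) / real n \<le> \<tau> * (\<Sum>i<p. (w i)\<^sup>2)"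
      by (simp add: sum_distrib_left mult.commute)
  qed
  finally show ?thesis unfolding L2 by (simp add: real_sqrt_mult)
qed

text \<open>Each \<open>d i\<close> differs from 1 by at most \<open>\<omega>\<close>, so the one
  factor \<open>1 + \<omega>\<close> removes both the divisors \<open>d i\<close> and the
  denominators of the logarithmic bound. It is bounded near \<open>\<Lambda>0\<close> and makes the
  growth linear far away.\<close>

lemma remainder_ge_quadratic:
  fixes d :: "nat \<Rightarrow> real" and u :: "nat \<Rightarrow> nat \<Rightarrow> real"
  assumes d: "\<And>i. i < p \<Longrightarrow> d i > 0"
  defines "\<omega> \<equiv> sqrt (\<Sum>i<p. (d i - 1)\<^sup>2)"
  shows "\<omega>\<^sup>2 / 2 + (\<Sum>k<n. \<Sum>i<p. (u k i)\<^sup>2) / real n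
    \<le> (1 + \<omega>) * ((\<Sum>i<p. (d i - 1) - ln (d i)) + (\<Sum>k<n. \<Sum>i<p. (u k i)\<^sup>2 / d i) / real n)"
proof -
  have w: "\<bar>d i - 1\<bar> \<le> \<omega>" if "i < p" for i
  proof -
    have "(d i - 1)\<^sup>2 \<le> (\<Sum>i<p. (d i - 1)\<^sup>2)" using that by (intro member_le_sum) auto
    then show ?thesis unfolding \<omega>_def by (intro real_le_rsqrt) simp
  qed
  have \<omega>: "\<omega> \<ge> 0" "\<omega>\<^sup>2 = (\<Sum>i<p. (d i - 1)\<^sup>2)" by (simp_all add: \<omega>_def sum_nonneg)
  have 1: "(d i - 1)\<^sup>2 / 2 \<le> (1 + \<omega>) * ((d i - 1) - ln (d i))" if i: "i < p" for i
  proof -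
    have "(d i - 1)\<^sup>2 / (2 * (1 + \<omega>)) \<le> (d i - 1)\<^sup>2 / (2 * (1 + \<bar>d i - 1\<bar>))"
      using w[OF i] \<omega> by (intro divide_left_mono) (auto simp: add_pos_nonneg)
    also have "\<dots> \<le> (d i - 1) - ln (d i)" by (rule log_remainder_lower_bound[OF d[OF i]])
    finally show ?thesis using \<omega> by (simp add: field_simps)
  qed
  have 2: "(u k i)\<^sup>2 \<le> (1 + \<omega>) * ((u k i)\<^sup>2 / d i)" if i: "i < p" for k i
  proof -
    have "d i \<le> 1 + \<omega>" using w[OF i] by simp
    then have "(u k i)\<^sup>2 * d i \<le> (u k i)\<^sup>2 * (1 + \<omega>)" by (intro mult_left_mono) auto
    then show ?thesis using d[OF i] by (simp add: field_simps)
  qed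
  have "\<omega>\<^sup>2 / 2 \<le> (1 + \<omega>) * (\<Sum>i<p. (d i - 1) - ln (d i))"
    unfolding \<omega>(2) sum_divide_distrib sum_distrib_left using 1 by (intro sum_mono) auto
  moreover have "(\<Sum>k<n. \<Sum>i<p. (u k i)\<^sup>2) \<le> (1 + \<omega>) * (\<Sum>k<n. \<Sum>i<p. (u k i)\<^sup>2 / d i)"
    unfolding sum_distrib_left using 2 by (intro sum_mono) auto
  then have "(\<Sum>k<n. \<Sum>i<p. (u k i)\<^sup>2) / real n \<le> (1 + \<omega>) * (\<Sum>k<n. \<Sum>i<p. (u k i)\<^sup>2 / d i) / real n"
    by (rule divide_right_mono) simp
  ultimately show ?thesis by (simp add: distrib_left)
qed

lemma abs_le_max_abs:
  assumes "i < dim_row A" "j < dim_col A"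
  shows "\<bar>A $$ (i, j)\<bar> \<le> max_abs A"
proof -
  have "{\<bar>A $$ (i, j)\<bar> | i j. i < dim_row A \<and> j < dim_col A}
      = (\<lambda>(i, j). \<bar>A $$ (i, j)\<bar>) ` ({..<dim_row A} \<times> {..<dim_col A})" by auto
  then have "finite {\<bar>A $$ (i, j)\<bar> | i j. i < dim_row A \<and> j < dim_col A}" by simp
  then show ?thesis unfolding max_abs_def using assms by (intro Max_ge) auto
qed

lemma grad_dir_le:
  "grad_dir n p q x y \<Theta>0 \<Lambda>0 \<Theta> \<Lambda> \<le> grad_sup_norm n p q x y \<Theta>0 \<Lambda>0 *
    ((\<Sum>i<q. \<Sum>j<p. \<bar>(\<Theta> - \<Theta>0) $$ (i, j)\<bar>) + (\<Sum>i<p. \<Sum>j<p. \<bar>(\<Lambda> - \<Lambda>0) $$ (i, j)\<bar>))"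
proof -
  let ?g = "grad_sup_norm n p q x y \<Theta>0 \<Lambda>0"
  have le: "G $$ (i, j) * h \<le> ?g * \<bar>h\<bar>" if "max_abs G \<le> ?g" "i < dim_row G" "j < dim_col G" for G i j h
  proof -
    have "G $$ (i, j) * h \<le> \<bar>G $$ (i, j)\<bar> * \<bar>h\<bar>" by (metis abs_ge_self abs_mult)
    also have "\<dots> \<le> ?g * \<bar>h\<bar>" using abs_le_max_abs[OF that(2,3)] that(1) by (intro mult_right_mono) auto
    finally show ?thesis .
  qed
  have 1: "max_abs (grad_Theta n p q x y \<Theta>0 \<Lambda>0) \<le> ?g" and 2: "max_abs (grad_Lambda n p q x y \<Theta>0 \<Lambda>0) \<le> ?g"
    by (simp_all add: grad_sup_norm_def)
  show ?thesis
    unfolding grad_dir_def distrib_left sum_distrib_left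
    by (intro add_mono sum_mono le[OF 1] le[OF 2]) (auto simp: grad_Theta_def grad_Lambda_def)
qed

lemma sum_split_support:
  fixes h :: "nat \<Rightarrow> nat \<Rightarrow> real"
  assumes "S \<subseteq> {..<a} \<times> {..<b}"
  shows "(\<Sum>i<a. \<Sum>j<b. (if (i, j) \<in> S then c1 else c2) * h i j)
    = c1 * (\<Sum>(i, j)\<in>S. h i j) + c2 * (\<Sum>(i, j)\<in>{..<a} \<times> {..<b} - S. h i j)"
proof -
  let ?R = "{..<a} \<times> {..<b}"
  have "(\<Sum>i<a. \<Sum>j<b. (if (i, j) \<in> S then c1 else c2) * h i j)
      = (\<Sum>(i, j)\<in>?R. (if (i, j) \<in> S then c1 else c2) * h i j)"
    by (simp add: sum.cartesian_product)
  also have "\<dots> = (\<Sum>(i, j)\<in>?R - S. (if (i, j) \<in> S then c1 else c2) * h i j)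
      + (\<Sum>(i, j)\<in>S. (if (i, j) \<in> S then c1 else c2) * h i j)"
    using assms by (intro sum.subset_diff) auto
  also have "(\<Sum>(i, j)\<in>?R - S. (if (i, j) \<in> S then c1 else c2) * h i j) = c2 * (\<Sum>(i, j)\<in>?R - S. h i j)"
    unfolding sum_distrib_left by (intro sum.cong refl) auto
  also have "(\<Sum>(i, j)\<in>S. (if (i, j) \<in> S then c1 else c2) * h i j) = c1 * (\<Sum>(i, j)\<in>S. h i j)"
    unfolding sum_distrib_left by (intro sum.cong refl) auto
  finally show ?thesis by simp
qed

lemma sum_abs_le_sqrt_card:
  fixes h :: "nat \<Rightarrow> nat \<Rightarrow> real"
  shows "(\<Sum>(i, j)\<in>S. \<bar>h i j\<bar>) \<le> sqrt (real (card S)) * sqrt (\<Sum>(i, j)\<in>S. (h i j)\<^sup>2)"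
proof -
  have "(\<Sum>ij\<in>S. 1 * (case ij of (i, j) \<Rightarrow> \<bar>h i j\<bar>))\<^sup>2
      \<le> (\<Sum>ij\<in>S. 1\<^sup>2) * (\<Sum>ij\<in>S. (case ij of (i, j) \<Rightarrow> \<bar>h i j\<bar>)\<^sup>2)"
    by (rule Cauchy_Schwarz_ineq_sum)
  also have "(\<Sum>ij\<in>S. (case ij of (i, j) \<Rightarrow> \<bar>h i j\<bar>)\<^sup>2) = (\<Sum>(i, j)\<in>S. (h i j)\<^sup>2)"
    by (intro sum.cong refl) auto
  finally have "(\<Sum>(i, j)\<in>S. \<bar>h i j\<bar>)\<^sup>2 \<le> real (card S) * (\<Sum>(i, j)\<in>S. (h i j)\<^sup>2)" by simp
  then show ?thesis unfolding real_sqrt_mult[symmetric] by (rule real_le_rsqrt)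
qed

text \<open>With a = 1/\<nu>0 and b = 1/\<nu>1, the gradient costs at most b/2 per unit. Off the
  support the prior pays b for \<Theta> and b/2 for \<Lambda>, leaving b/2 and nothing. On the
  support the total gain is at most a + b/2, hence at most 3a/2. The ratio of a + b/2 to b/2 is
  exactly \<open>alpha_const\<close>.\<close>

lemma prior_penalty:
  fixes TS TC LS LC l l0 gd g :: real
  assumes \<nu>: "0 < \<nu>0" "\<nu>0 < \<nu>1" and nn: "0 \<le> TS" "0 \<le> TC" "0 \<le> LS" "0 \<le> LC"
    and hpd: "l0 - l \<le> (1 / \<nu>0 * TS + - (1 / \<nu>1) * TC) + (1 / \<nu>0 * LS + - (1 / \<nu>1) * LC) / 2"
    and gd: "gd \<le> g * ((TS + TC) + (LS + LC))" and g: "1 / \<nu>1 > 2 * g"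
    and X: "X = l0 - l + gd" "X \<ge> 0"
  shows "X \<le> 3 / (2 * \<nu>0) * (TS + LS)" "TC \<le> alpha_const \<nu>0 \<nu>1 * (TS + LS)"
proof -
  define a b where "a = 1 / \<nu>0" and "b = 1 / \<nu>1"
  have ab: "0 < b" "b < a" using \<nu> by (auto simp: a_def b_def divide_strict_left_mono)
  have "g * ((TS + TC) + (LS + LC)) \<le> b / 2 * ((TS + TC) + (LS + LC))"
    using g nn by (intro mult_right_mono) (auto simp: b_def)
  then have X1: "X \<le> (b / 2 + a) * (TS + LS) - b / 2 * TC"
  proof -
    have "0 \<le> a * LS" using nn ab by simp
    then show ?thesis
      using gd hpd X(1) \<open>g * _ \<le> _\<close> by (simp add: a_def[symmetric] b_def[symmetric] algebra_simps add_divide_distrib diff_divide_distrib)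
  qed
  have "b / 2 * (TS + LS) \<le> a / 2 * (TS + LS)" using ab nn by (intro mult_right_mono) auto
  moreover have "0 \<le> b / 2 * TC" using ab nn by simp
  moreover have "(b / 2 + a) * (TS + LS) = b / 2 * (TS + LS) + a * (TS + LS)" by (rule distrib_right)
  moreover have "3 / 2 * a * (TS + LS) = a / 2 * (TS + LS) + a * (TS + LS)" by (simp add: algebra_simps)
  ultimately have "X \<le> 3 / 2 * a * (TS + LS)" using X1 by linarith
  then show "X \<le> 3 / (2 * \<nu>0) * (TS + LS)" by (simp add: a_def)
  have "b / 2 * TC \<le> (b / 2 + a) * (TS + LS)" using X1 X(2) by simp
  also have "b / 2 + a = b / 2 * alpha_const \<nu>0 \<nu>1"
    using \<nu> by (simp add: alpha_const_def a_def b_def field_simps)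
  finally have "b / 2 * TC \<le> b / 2 * (alpha_const \<nu>0 \<nu>1 * (TS + LS))" by (simp only: mult.assoc)
  then show "TC \<le> alpha_const \<nu>0 \<nu>1 * (TS + LS)" using ab by (simp only: mult_le_cancel_left_pos half_gt_zero)
qed

section \<open>Concentration of the posterior\<close>

lemma HPD_error_bound:
  assumes n: "n \<ge> 1" and pq: "p \<ge> 1" "q \<ge> 1" and \<nu>: "0 < \<nu>0" "\<nu>0 < \<nu>1"
    and \<eta>: "0 \<le> \<eta>" "\<eta> \<le> 1" and \<rho>: "0 \<le> \<rho>" "\<rho> \<le> 1"
    and par: "(\<Theta>0, \<Lambda>0) \<in> param_space p q R" and Sig: "sym_pos_def q Sig0"
    and ss: "sample_size_cond e0 n p q (s0_const \<nu>0 \<nu>1 \<Theta>0 \<Lambda>0 Sig0)" and e0: "0 < e0" "e0 < 1"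
    and R: "R < 2 * eig_max \<Lambda>0 * sqrt (r0_const \<Theta>0 \<Lambda>0 Sig0) / eps_rate C n p q \<Theta>0 \<Lambda>0 Sig0"
    and rip: "sparse_RIP q (s0_const \<nu>0 \<nu>1 \<Theta>0 \<Lambda>0 Sig0) (moment_mat n q q x x) Sig0 \<Theta>0"
    and grad: "1 / \<nu>1 > 2 * grad_sup_norm n p q x y \<Theta>0 \<Lambda>0"
    and K: "1 \<le> K" "1 / (real n * \<nu>0) \<le> K * sqrt (ln (real (p + q)) / real n)"
    and C: "C = 1 + 288 * K\<^sup>2"
    and hpd: "(\<Theta>, \<Lambda>) \<in> HPD n p q x y \<nu>0 \<nu>1 \<eta> \<rho> R \<Theta>0 \<Lambda>0"
  shows "pair_frob_dist (\<Theta>, \<Lambda>) (\<Theta>0, \<Lambda>0) \<le> eps_rate C n p q \<Theta>0 \<Lambda>0 Sig0"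
proof -
  have T0: "\<Theta>0 \<in> carrier_mat q p" and L0: "sym_pos_def p \<Lambda>0" using par by (auto simp: param_space_def)
  have T: "\<Theta> \<in> carrier_mat q p" and L: "sym_pos_def p \<Lambda>"
    and post: "neg_log_post n p q x y \<nu>0 \<nu>1 \<eta> \<rho> \<Theta> \<Lambda> \<le> neg_log_post n p q x y \<nu>0 \<nu>1 \<eta> \<rho> \<Theta>0 \<Lambda>0"
    using hpd by (auto simp: HPD_def param_space_def)
  have c0: "\<Lambda>0 \<in> carrier_mat p p" and c: "\<Lambda> \<in> carrier_mat p p" using L0 L by (auto simp: sym_pos_def_def)
  have Cpos: "C > 0" by (simp add: C add_pos_nonneg)
  define s where "s = sqrt (real (card (S_row \<Theta>0 \<Lambda>0)) * ln (real (p + q)) / real n)"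
  note rate = rate_conditions[OF pq n \<nu> par Sig ss e0 R Cpos, folded s_def]
  let ?sg = "eig_max (signal_mat \<Theta>0 Sig0)" and ?\<beta> = "beta0 \<Theta>0 \<Lambda>0 Sig0" and ?L = "eig_max \<Lambda>0"
    and ?m = "eig_min \<Lambda>0" and ?r1 = "rho1 \<Lambda>0 Sig0" and ?r2 = "rho2 Sig0" and ?S = "moment_mat n q q x x"
    and ?s0 = "s0_const \<nu>0 \<nu>1 \<Theta>0 \<Lambda>0 Sig0" and ?F = "lin_pred q x \<Theta>0" and ?G = "lin_pred q x (\<Theta> - \<Theta>0)"
    and ?DT = "\<Theta> - \<Theta>0" and ?DL = "\<Lambda> - \<Lambda>0" and ?RT = "{..<q} \<times> {..<p}" and ?RL = "{..<p} \<times> {..<p}"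
    and ?S1 = "row_supp_Theta \<Theta>0" and ?S2 = "supp_Lambda \<Lambda>0"
  note l = eig_max_pos_def[OF pq(1) L0] and bc = basic_constants[OF pq L0 Sig]
  obtain P d where d: "\<And>i. i < p \<Longrightarrow> d i > 0"
    and P: "\<And>i j. i < p \<Longrightarrow> j < p \<Longrightarrow> bil p (entries \<Lambda>0) (P i) (P j) = (if i = j then 1 else 0)"
    and LP: "\<And>i a. i < p \<Longrightarrow> a < p \<Longrightarrow> app p (entries \<Lambda>) (P i) a = d i * app p (entries \<Lambda>0) (P i) a"
    and inv0: "\<Lambda>0 * basis_inv p P (\<lambda>_. 1) = 1\<^sub>m p" and inv: "\<Lambda> * basis_inv p P d = 1\<^sub>m p"
    and det0: "Determinant.det \<Lambda>0 > 0" and det: "Determinant.det \<Lambda> = Determinant.det \<Lambda>0 * (\<Prod>i<p. d i)"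
    using simultaneous_diagonalization[OF L0 L] by blast
  define f g where "f = (\<lambda>k i. dot p (P i) (?F k))" and "g = (\<lambda>k i. dot p (P i) (?G k))"
  define \<omega> where "\<omega> = sqrt (\<Sum>i<p. (d i - 1)\<^sup>2)"
  define Z2 where "Z2 = (\<Sum>k<n. \<Sum>i<p. (g k i - (d i - 1) * f k i)\<^sup>2) / real n"
  define Dg where "Dg = (\<Sum>i<p. (d i - 1) - ln (d i))
    + (\<Sum>k<n. \<Sum>i<p. (g k i - (d i - 1) * f k i)\<^sup>2 / d i) / real n"
  define a b where "a = sqrt (\<Sum>i<p. \<Sum>j<p. (?DL $$ (i, j))\<^sup>2)" and "b = sqrt (\<Sum>i<q. \<Sum>j<p. (?DT $$ (i, j))\<^sup>2)"
  define \<delta> where "\<delta> = sqrt (a\<^sup>2 + b\<^sup>2)"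
  have nn: "0 \<le> a" "0 \<le> b" "0 \<le> \<omega>" "0 \<le> Z2" "0 \<le> \<delta>"
    by (simp_all add: a_def b_def \<omega>_def Z2_def \<delta>_def sum_nonneg)
  have dist: "pair_frob_dist (\<Theta>, \<Lambda>) (\<Theta>0, \<Lambda>0) = \<delta>"
    using T T0 c c0 by (simp add: pair_frob_dist_def frob_norm_def \<delta>_def a_def b_def sum_nonneg add.commute)
  have eps: "eps_rate C n p q \<Theta>0 \<Lambda>0 Sig0 = C / ?\<beta> * s" by (simp add: eps_rate_def s_def)
  have bR: "b = sqrt (\<Sum>(i, j)\<in>?RT. (?DT $$ (i, j))\<^sup>2)" by (simp add: b_def sum.cartesian_product)
  have aR: "a = sqrt (\<Sum>(i, j)\<in>?RL. (?DL $$ (i, j))\<^sup>2)" by (simp add: a_def sum.cartesian_product)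
  have S1: "?S1 \<subseteq> ?RT" and S2: "?S2 \<subseteq> ?RL"
    using T0 c0 by (auto simp: row_supp_Theta_def supp_Lambda_def)
  have Br1: "\<omega>\<^sup>2 / 2 + Z2 \<le> (1 + \<omega>) * Dg"
    unfolding \<omega>_def Z2_def Dg_def by (rule remainder_ge_quadratic[OF d])
  have Dg0: "Dg \<ge> 0"
  proof -
    have "0 \<le> (1 + \<omega>) * Dg" by (rule order_trans[OF _ Br1]) (use nn in simp)
    then show ?thesis using nn(3) by (simp add: zero_le_mult_iff)
  qed
  have rem: "loglik n p q x y \<Theta>0 \<Lambda>0 - loglik n p q x y \<Theta> \<Lambda> + grad_dir n p q x y \<Theta>0 \<Lambda>0 \<Theta> \<Lambda> = real n / 2 * Dg"
    unfolding Dg_def f_def g_def by (rule loglik_remainder[OF T0 T c0 c d P LP inv0 inv det0 det])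

  \<comment> \<open>Upper bound on the remainder from the prior\<close>
  define TS TC where "TS = (\<Sum>(i, j)\<in>?S1. \<bar>?DT $$ (i, j)\<bar>)" and "TC = (\<Sum>(i, j)\<in>?RT - ?S1. \<bar>?DT $$ (i, j)\<bar>)"
  define LS LC where "LS = (\<Sum>(i, j)\<in>?S2. \<bar>?DL $$ (i, j)\<bar>)" and "LC = (\<Sum>(i, j)\<in>?RL - ?S2. \<bar>?DL $$ (i, j)\<bar>)"
  have nn': "0 \<le> TS" "0 \<le> TC" "0 \<le> LS" "0 \<le> LC"
    by (auto simp: TS_def TC_def LS_def LC_def intro!: sum_nonneg)
  have priT: "ln (prior_Theta p q \<nu>0 \<nu>1 \<eta> \<rho> \<Theta>) - ln (prior_Theta p q \<nu>0 \<nu>1 \<eta> \<rho> \<Theta>0)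
      \<le> 1 / \<nu>0 * TS + - (1 / \<nu>1) * TC"
  proof -
    have "(\<Sum>i<q. \<Sum>j<p. (if (i, j) \<in> ?S1 then 1 / \<nu>0 else - (1 / \<nu>1)) * \<bar>\<Theta> $$ (i, j) - \<Theta>0 $$ (i, j)\<bar>)
        = (\<Sum>i<q. \<Sum>j<p. (if (i, j) \<in> ?S1 then 1 / \<nu>0 else - (1 / \<nu>1)) * \<bar>?DT $$ (i, j)\<bar>)"
      using T T0 by (intro sum.cong refl) auto
    then show ?thesis
      using ln_prior_Theta_diff_le[OF \<nu> \<eta> \<rho> T0, of \<Theta>] sum_split_support[OF S1] by (simp add: TS_def TC_def)
  qed
  have priL: "ln (prior_Lambda p \<nu>0 \<nu>1 \<eta> \<Lambda>) - ln (prior_Lambda p \<nu>0 \<nu>1 \<eta> \<Lambda>0)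
      \<le> (1 / \<nu>0 * LS + - (1 / \<nu>1) * LC) / 2"
  proof -
    have "(\<Sum>i<p. \<Sum>j<p. (if (i, j) \<in> ?S2 then 1 / \<nu>0 else - (1 / \<nu>1)) * \<bar>\<Lambda> $$ (i, j) - \<Lambda>0 $$ (i, j)\<bar>)
        = (\<Sum>i<p. \<Sum>j<p. (if (i, j) \<in> ?S2 then 1 / \<nu>0 else - (1 / \<nu>1)) * \<bar>?DL $$ (i, j)\<bar>)"
      using c c0 by (intro sum.cong refl) auto
    moreover have "\<Lambda>0 $$ (i, i) \<noteq> 0" if "i < p" for i using sym_pos_def_diag_pos[OF L0 that] by simp
    ultimately show ?thesis
      using ln_prior_Lambda_diff_le[OF \<nu> \<eta> c0 sym_pos_def_sym[OF L] sym_pos_def_sym[OF L0]]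
        sum_split_support[OF S2] by (simp add: LS_def LC_def)
  qed
  have "(\<Sum>i<q. \<Sum>j<p. \<bar>?DT $$ (i, j)\<bar>) = TS + TC" "(\<Sum>i<p. \<Sum>j<p. \<bar>?DL $$ (i, j)\<bar>) = LS + LC"
    using sum_split_support[OF S1, of 1 1 "\<lambda>i j. \<bar>?DT $$ (i, j)\<bar>"]
      sum_split_support[OF S2, of 1 1 "\<lambda>i j. \<bar>?DL $$ (i, j)\<bar>"]
    by (simp_all add: TS_def TC_def LS_def LC_def)
  note gd = grad_dir_le[of n p q x y \<Theta>0 \<Lambda>0 \<Theta> \<Lambda>, unfolded this]
  have hpd': "loglik n p q x y \<Theta>0 \<Lambda>0 - loglik n p q x y \<Theta> \<Lambda>
      \<le> (1 / \<nu>0 * TS + - (1 / \<nu>1) * TC) + (1 / \<nu>0 * LS + - (1 / \<nu>1) * LC) / 2"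
    using post priT priL unfolding neg_log_post_def by linarith
  have X0: "0 \<le> real n / 2 * Dg" using Dg0 by simp
  note pen = prior_penalty[OF \<nu> nn' hpd' gd grad rem[symmetric] X0]

  define cS where "cS = real (card (S_row \<Theta>0 \<Lambda>0))"
  have cS: "cS \<ge> 1" using card_S_row_pos[OF L0 pq(1)] by (simp add: cS_def)
  \<comment> \<open>The cone condition must be stated with the norm on the support rather than the
    full norm \<open>b\<close>, as \<open>restricted_eigenvalue\<close> expects it.\<close>
  define t where "t = sqrt (\<Sum>(i, j)\<in>?S1. (?DT $$ (i, j))\<^sup>2)"
  have tb: "t \<le> b" unfolding t_def bR using S1 by (intro real_sqrt_le_mono sum_mono2) auto
  have t0: "t \<ge> 0" by (auto simp: t_def intro!: sum_nonneg)
  have la: "sqrt (\<Sum>(i, j)\<in>?S2. (?DL $$ (i, j))\<^sup>2) \<le> a"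
    unfolding aR using S2 by (intro real_sqrt_le_mono sum_mono2) auto
  define c1 c2 where "c1 = real (card ?S1)" and "c2 = real (card ?S2)"
  have c12: "cS = c1 + c2" "0 \<le> c1" "0 \<le> c2" by (simp_all add: cS_def c1_def c2_def card_S_row)
  have TS: "TS \<le> sqrt c1 * t" unfolding TS_def c1_def t_def by (rule sum_abs_le_sqrt_card)
  have LS: "LS \<le> sqrt c2 * a"
  proof -
    have "LS \<le> sqrt c2 * sqrt (\<Sum>(i, j)\<in>?S2. (?DL $$ (i, j))\<^sup>2)"
      unfolding LS_def c2_def by (rule sum_abs_le_sqrt_card)
    also have "\<dots> \<le> sqrt c2 * a" using la c12 by (intro mult_left_mono) auto
    finally show ?thesis .
  qed
  have sum1: "TS + LS \<le> sqrt cS * (t + a)"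
  proof -
    have "sqrt c1 * t \<le> sqrt cS * t" "sqrt c2 * a \<le> sqrt cS * a"
      using c12 t0 nn by (auto intro!: mult_right_mono)
    then show ?thesis using TS LS by (simp add: distrib_left)
  qed
  \<comment> \<open>\<open>sum1\<close> feeds the cone condition, where the two errors stay
    separate; here one Cauchy-Schwarz over both supports gives the joint error that enters the
    rate.\<close>
  have sum2: "TS + LS \<le> sqrt cS * \<delta>"
  proof -
    have "(sqrt c1 * t + sqrt c2 * a)\<^sup>2 \<le> (c1 + c2) * (t\<^sup>2 + a\<^sup>2)"
    proof -
      have "0 \<le> (sqrt c1 * a - sqrt c2 * t)\<^sup>2" by simp
      then show ?thesis using c12 by (simp add: power2_sum power2_diff power_mult_distrib algebra_simps)
    qed
    also have "\<dots> \<le> cS * (a\<^sup>2 + b\<^sup>2)"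
      unfolding c12(1) using tb t0 c12 by (intro mult_left_mono) (auto intro: power_mono)
    finally have "sqrt c1 * t + sqrt c2 * a \<le> sqrt (cS * (a\<^sup>2 + b\<^sup>2))" by (rule real_le_rsqrt)
    then show ?thesis using TS LS by (simp add: \<delta>_def real_sqrt_mult)
  qed
  have Dgs: "Dg \<le> 3 * K * s * \<delta>"
  proof -
    have "real n / 2 * Dg \<le> 3 / (2 * \<nu>0) * (sqrt cS * \<delta>)"
      by (rule order_trans[OF pen(1) mult_left_mono[OF sum2]]) (use \<nu> in simp)
    then have "Dg \<le> 3 * (1 / (real n * \<nu>0)) * (sqrt cS * \<delta>)" using n \<nu> by (simp add: field_simps)
    also have "\<dots> \<le> 3 * (K * sqrt (ln (real (p + q)) / real n)) * (sqrt cS * \<delta>)"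
      using K(2) nn cS by (intro mult_right_mono mult_left_mono) auto
    also have "\<dots> = 3 * K * s * \<delta>"
      by (simp add: s_def cS_def[symmetric] real_sqrt_mult real_sqrt_divide)
    finally show ?thesis .
  qed

  \<comment> \<open>Lower bound on the remainder from the restricted isometry\<close>
  define N where "N = block_norm n q p x (entries ?DT) ?RT"
  have psdS: "bil q (entries ?S) u u \<ge> 0" for u
    by (simp add: bil_moment_mat sum_nonneg)
  have ripF: "?r1 * dot q u u \<le> (\<Sum>k<n. (dot q (x k) u)\<^sup>2) / real n \<and>
      (\<Sum>k<n. (dot q (x k) u)\<^sup>2) / real n \<le> ?r2 * dot q u u"
    if "card {i. i < q \<and> u i \<noteq> 0} \<le> ?s0" for u
    using sparse_RIP_bounds[OF pq L0 Sig moment_mat_carrier psdS rip that] by (simp add: bil_moment_mat)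
  have r2: "?r2 > 0" using bc by linarith
  have N1: "sqrt ?r1 * (b / 3 - a) \<le> N"
    unfolding bR N_def
  proof (rule restricted_eigenvalue[OF ripF S1])
    \<comment> \<open>The second summand of \<open>s0_const\<close>. The first summand also counts
      the support of \<open>\<Lambda>0\<close>, so it leaves room for \<open>?S1\<close>.\<close>
    let ?k = "nat \<lceil>4 * (?r2 / ?r1) * (alpha_const \<nu>0 \<nu>1)\<^sup>2 * cS\<rceil>"
    have \<alpha>: "alpha_const \<nu>0 \<nu>1 \<ge> 1" using \<nu> by (simp add: alpha_const_def)
    have kpos: "4 * (?r2 / ?r1) * (alpha_const \<nu>0 \<nu>1)\<^sup>2 * cS > 0" using bc(1) r2 \<alpha> cS by simp
    show "?k \<ge> 1" using kpos by linarith
    show "card ?S1 + ?k \<le> ?s0" by (simp add: s0_const_def cS_def card_S_row)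
    show "0 < ?r1" "?r1 \<le> ?r2" "0 \<le> a" using bc nn by auto
    have "4 * (?r2 / ?r1) * (alpha_const \<nu>0 \<nu>1)\<^sup>2 * cS \<le> real ?k" by (rule real_nat_ceiling_ge)
    then have "sqrt (4 * (?r2 / ?r1) * (alpha_const \<nu>0 \<nu>1)\<^sup>2 * cS) \<le> sqrt (real ?k)" by simp
    \<comment> \<open>The root of the factor 4 in \<open>s0_const\<close> is the 2 that matches the
      division by 2 in the cone hypothesis.\<close>
    then have k: "2 * (sqrt ?r2 / sqrt ?r1) * alpha_const \<nu>0 \<nu>1 * sqrt cS \<le> sqrt (real ?k)"
      using \<alpha> by (simp add: real_sqrt_mult real_sqrt_divide)
    have "sqrt ?r2 * TC \<le> sqrt ?r2 * (alpha_const \<nu>0 \<nu>1 * (sqrt cS * (t + a)))"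
      by (rule mult_left_mono[OF order_trans[OF pen(2) mult_left_mono[OF sum1]]]) (use \<alpha> r2 in auto)
    also have "\<dots> = sqrt ?r1 * (t + a) / 2 * (2 * (sqrt ?r2 / sqrt ?r1) * alpha_const \<nu>0 \<nu>1 * sqrt cS)"
      using bc(1) by simp
    also have "\<dots> \<le> sqrt ?r1 * (t + a) / 2 * sqrt (real ?k)"
      using k bc(1) t0 nn by (intro mult_left_mono) auto
    finally show "sqrt ?r2 * (\<Sum>(i, j)\<in>?RT - ?S1. \<bar>?DT $$ (i, j)\<bar>)
        \<le> sqrt ?r1 * (sqrt (\<Sum>(i, j)\<in>?S1. (?DT $$ (i, j))\<^sup>2) + a) / 2 * sqrt (real ?k)"
      by (simp add: TC_def t_def)
  qed
  have N_eq: "N = sqrt ((\<Sum>k<n. dot p (?G k) (?G k)) / real n)"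
  proof -
    have col: "dot q (x k) (\<lambda>i. if (i, j) \<in> ?RT then ?DT $$ (i, j) else 0) = ?G k j" if "j < p" for k j
      using that by (auto simp: dot_def lin_pred_def intro!: sum.cong)
    have "N\<^sup>2 = (\<Sum>j<p. (\<Sum>k<n. (?G k j)\<^sup>2) / real n)"
      unfolding N_def block_norm_sq
    proof (intro sum.cong refl)
      fix j assume "j \<in> {..<p}"
      then have j: "j < p" by simp
      show "(\<Sum>k<n. (dot q (x k) (\<lambda>i. if (i, j) \<in> ?RT then ?DT $$ (i, j) else 0))\<^sup>2) / real n
          = (\<Sum>k<n. (?G k j)\<^sup>2) / real n"
        unfolding col[OF j] ..
    qed
    also have "\<dots> = (\<Sum>k<n. dot p (?G k) (?G k)) / real n"
      unfolding sum_divide_distrib[symmetric] dot_def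
      by (subst sum.swap) (simp add: power2_eq_square)
    finally have "N\<^sup>2 = (\<Sum>k<n. dot p (?G k) (?G k)) / real n" .
    moreover have "N \<ge> 0" by (simp add: N_def block_norm_def)
    ultimately show ?thesis by (metis real_sqrt_unique)
  qed
  \<comment> \<open>\<open>P i\<close> has unit length in the form \<open>\<Lambda>0\<close>, so its
    squared Euclidean length is at most \<open>1 / ?m\<close>; the factor 1.4 is the signal part of
    \<open>sparse_RIP\<close>.\<close>
  have sig: "(\<Sum>k<n. (f k i)\<^sup>2) / real n \<le> 1.4 * ?sg / ?m" if i: "i < p" for i
  proof -
    have sym: "signal_mat \<Theta>0 ?S $$ (i, j) = signal_mat \<Theta>0 ?S $$ (j, i)" if "i < p" "j < p" for i j
      using that by (simp add: signal_mat_entry[OF T0] mult.commute)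
    have "(\<Sum>k<n. (f k i)\<^sup>2) / real n = bil p (entries (signal_mat \<Theta>0 ?S)) (P i) (P i)"
      by (simp add: bil_signal_mat[OF T0] f_def)
    also have "\<dots> \<le> eig_max (signal_mat \<Theta>0 ?S) * dot p (P i) (P i)"
      by (rule eig_max_symmetric(1)[OF pq(1) signal_mat_carrier[OF T0 moment_mat_carrier] sym])
    also have "\<dots> \<le> (1.4 * ?sg) * dot p (P i) (P i)"
    proof (rule mult_right_mono)
      have "eig_max (signal_mat \<Theta>0 ?S) / ?sg \<le> 1.4" using rip by (simp add: sparse_RIP_def)
      then show "eig_max (signal_mat \<Theta>0 ?S) \<le> 1.4 * ?sg" using rate(1) by (simp only: pos_divide_le_eq)
    qed (rule dot_nonneg)
    also have "\<dots> \<le> (1.4 * ?sg) * (1 / ?m)"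
    proof (rule mult_left_mono)
      have "?m * dot p (P i) (P i) \<le> 1" using l(5)[of "P i"] P[OF i i] by simp
      then show "dot p (P i) (P i) \<le> 1 / ?m" using l(2) by (simp add: field_simps)
    qed (use rate(1) in simp)
    finally show ?thesis by simp
  qed
  have N2: "N / sqrt ?L \<le> sqrt Z2 + sqrt (1.4 * ?sg / ?m) * \<omega>"
    unfolding N_eq Z2_def \<omega>_def
  proof (rule response_lower_bound[OF _ l(1) sig])
    show "dot p (?G k) (?G k) \<le> ?L * (\<Sum>i<p. (g k i)\<^sup>2)" for k
      unfolding g_def by (rule basis_dot_bound[OF pq(1) L0 inv0 l(4)])
    show "0 \<le> 1.4 * ?sg / ?m" using rate(1) l(2) by simp
  qed
  have aw: "a \<le> ?L * \<omega>"
  proof -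
    have "app p (entries ?DL) (P i) e = (d i - 1) * app p (entries \<Lambda>0) (P i) e" if ie: "i < p" "e < p" for i e
    proof -
      have "app p (entries ?DL) (P i) e = app p (entries \<Lambda>) (P i) e - app p (entries \<Lambda>0) (P i) e"
        using c c0 ie unfolding app_def sum_subtractf[symmetric]
        by (intro sum.cong refl) (auto simp: algebra_simps)
      then show ?thesis using LP[OF ie] by (simp add: algebra_simps)
    qed
    then have "(\<Sum>i<p. \<Sum>j<p. (?DL $$ (i, j))\<^sup>2) \<le> ?L\<^sup>2 * (\<Sum>i<p. (d i - 1)\<^sup>2)"
      using l(1) by (intro Lambda_diff_bound[OF pq(1) L0 inv0 l(4) _ P]) auto
    then have "a \<le> sqrt (?L\<^sup>2 * (\<Sum>i<p. (d i - 1)\<^sup>2))" unfolding a_def by simp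
    then show ?thesis using l(1) by (simp add: \<omega>_def real_sqrt_mult)
  qed
  have m3: "0 < eig_min (3 \<cdot>\<^sub>m \<Lambda>0)" "eig_min (3 \<cdot>\<^sub>m \<Lambda>0) \<le> 3 * ?m"
    using eig_min_smult_pos_def[OF pq(1) L0, of 3] by auto
  have b1: "?\<beta> \<le> ?r1 / (40 * ?L)" and b2: "?\<beta> \<le> ?r1 / (40 * ?L) * (?m / ?sg)"
  proof -
    have "?\<beta> \<le> ?r1 / (40 * ?L) * 1"
      unfolding beta0_def using bc(1) l(1) by (intro mult_left_mono) auto
    then show "?\<beta> \<le> ?r1 / (40 * ?L)" by simp
    have "min 1 (eig_min (3 \<cdot>\<^sub>m \<Lambda>0) / (16 * ?sg)) \<le> eig_min (3 \<cdot>\<^sub>m \<Lambda>0) / (16 * ?sg)" by simp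
    \<comment> \<open>The minimal eigenvalue of three times \<open>\<Lambda>0\<close> is at most
      \<open>3 * ?m\<close>, which the divisor 16 more than compensates.\<close>
    also have "\<dots> \<le> ?m / ?sg" using m3 l(2) rate(1) by (simp add: field_simps)
    finally show "?\<beta> \<le> ?r1 / (40 * ?L) * (?m / ?sg)"
      unfolding beta0_def using bc(1) l(1) by (intro mult_left_mono) auto
  qed
  have "?\<beta> * (a\<^sup>2 + b\<^sup>2) \<le> 4 * (\<omega>\<^sup>2 / 2 + (sqrt Z2)\<^sup>2)"
    by (rule quadratic_lower_bound[OF bc(1) l(1) l(2) rate(1) rate(2) nn(1,2,3) _ N1 N2 aw bc(3) b1 b2])
      (use nn in simp)
  then have Br3: "?\<beta> * \<delta>\<^sup>2 \<le> 4 * (\<omega>\<^sup>2 / 2 + Z2)" using nn by (simp add: \<delta>_def)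
  have "\<delta> \<le> C / ?\<beta> * s"
  proof (rule error_bound_from_remainder[OF nn(3,5) rate(2) _ K(1) C Br1 _ Br3 Dgs rate(3)])
    show "0 \<le> s" using pq by (simp add: s_def)
    show "\<omega>\<^sup>2 / 2 \<le> \<omega>\<^sup>2 / 2 + Z2" using nn by simp
  qed
  then show ?thesis unfolding dist eps .
qed

text \<open>\<open>s0_const\<close> contains the size of the support, so the sample size condition
  for every \<open>e\<close> says that the quantity under the root vanishes; the lower bound on
  \<open>beta0\<close> keeps the prefactor bounded.\<close>

lemma eps_rate_tendsto_0:
  fixes p q :: "nat \<Rightarrow> nat"
  assumes pq: "\<And>n. p n \<ge> 1" "\<And>n. q n \<ge> 1" and C: "C > 0"
    and ss: "\<And>e. e \<in> {0<..<1} \<Longrightarrow> \<forall>\<^sub>F n in sequentially.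
      sample_size_cond e n (p n) (q n) (s0_const (\<nu>0 n) (\<nu>1 n) (\<Theta>0 n) (\<Lambda>0 n) (Sig0 n))"
    and b: "b > 0" "\<forall>\<^sub>F n in sequentially. beta0 (\<Theta>0 n) (\<Lambda>0 n) (Sig0 n) \<ge> b"
  shows "(\<lambda>n. eps_rate C n (p n) (q n) (\<Theta>0 n) (\<Lambda>0 n) (Sig0 n)) \<longlonglongrightarrow> 0"
proof -
  define r where "r = (\<lambda>n. real (card (S_row (\<Theta>0 n) (\<Lambda>0 n))) * ln (real (p n + q n)) / real n)"
  have ln: "ln (real (p n + q n)) \<ge> 0" for n using pq[of n] by simp
  have r0: "r n \<ge> 0" for n using ln by (simp add: r_def)
  have "r \<longlonglongrightarrow> 0"
  proof (rule order_tendstoI)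
    fix a :: real assume "a < 0"
    then show "\<forall>\<^sub>F n in sequentially. a < r n" using r0 by (intro always_eventually allI) (meson less_le_trans)
  next
    fix a :: real assume a: "0 < a"
    \<comment> \<open>The sample size condition is available only for \<open>e\<close> below
      1.\<close>
    define e where "e = min a (1 / 2)"
    have e: "e \<in> {0<..<1}" "e \<le> a" using a by (auto simp: e_def)
    show "\<forall>\<^sub>F n in sequentially. r n < a"
      using ss[OF e(1)] eventually_gt_at_top[of 0]
    proof eventually_elim
      case (elim n)
      let ?s0 = "s0_const (\<nu>0 n) (\<nu>1 n) (\<Theta>0 n) (\<Lambda>0 n) (Sig0 n)"
      have "real (card (S_row (\<Theta>0 n) (\<Lambda>0 n))) * ln (real (p n + q n)) \<le> real (p n + ?s0) * ln (real (p n + q n))"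
        using ln by (intro mult_right_mono) (auto simp: s0_const_def)
      also have "\<dots> < e * real n"
        using elim e(1) by (simp add: sample_size_cond_def field_simps)
      finally have "r n < e" using elim by (simp add: r_def field_simps)
      then show ?case using e(2) by simp
    qed
  qed
  then have "(\<lambda>n. C / b * sqrt (r n)) \<longlonglongrightarrow> C / b * sqrt 0" by (intro tendsto_intros)
  then have lim: "(\<lambda>n. C / b * sqrt (r n)) \<longlonglongrightarrow> 0" by simp
  show ?thesis
  proof (rule tendsto_sandwich[OF _ _ tendsto_const lim])
    show "\<forall>\<^sub>F n in sequentially. 0 \<le> eps_rate C n (p n) (q n) (\<Theta>0 n) (\<Lambda>0 n) (Sig0 n)"
      using b(2)
    proof eventually_elim
      case (elim n)
      then show ?case using b(1) C r0[of n] by (simp add: eps_rate_def r_def)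
    qed
    show "\<forall>\<^sub>F n in sequentially. eps_rate C n (p n) (q n) (\<Theta>0 n) (\<Lambda>0 n) (Sig0 n) \<le> C / b * sqrt (r n)"
      using b(2)
    proof eventually_elim
      case (elim n)
      have "eps_rate C n (p n) (q n) (\<Theta>0 n) (\<Lambda>0 n) (Sig0 n) = C / beta0 (\<Theta>0 n) (\<Lambda>0 n) (Sig0 n) * sqrt (r n)"
        by (simp add: eps_rate_def r_def)
      also have "\<dots> \<le> C / b * sqrt (r n)"
        using elim b(1) C r0[of n] by (intro mult_right_mono divide_left_mono) auto
      finally show ?case .
    qed
  qed
qed

theorem theorem1:
  fixes p q :: "nat \<Rightarrow> nat" and \<nu>0 \<nu>1 :: "nat \<Rightarrow> real"
  assumes "\<And>n. p n \<ge> 1" and "\<And>n. q n \<ge> 1"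
    and "\<And>n. 0 < \<nu>0 n" and "\<And>n. \<nu>0 n < \<nu>1 n"
    and "(\<lambda>n. 1 / (real n * \<nu>0 n)) \<in> O(\<lambda>n. sqrt (ln (real (p n + q n)) / real n))"
    and "(\<lambda>n. 1 / (real n * \<nu>1 n)) \<in> O(\<lambda>n. sqrt (ln (real (p n + q n)) / real n))"
  shows "\<exists>C>0. \<forall>(M :: nat \<Rightarrow> 'a measure)
            (X :: nat \<Rightarrow> nat \<Rightarrow> 'a \<Rightarrow> nat \<Rightarrow> real) (Y :: nat \<Rightarrow> nat \<Rightarrow> 'a \<Rightarrow> nat \<Rightarrow> real)
            (\<Theta>0 :: nat \<Rightarrow> real mat) (\<Lambda>0 :: nat \<Rightarrow> real mat) (Sig0 :: nat \<Rightarrow> real mat)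
            (\<eta> :: nat \<Rightarrow> real) (\<rho> :: nat \<Rightarrow> real) (R :: nat \<Rightarrow> real) (e0 :: real) (\<delta>0 :: real).
      0 < e0 \<and> e0 < 1 \<and> 0 < \<delta>0 \<and> \<delta>0 < 1 \<and>
      (\<forall>\<^sub>F n in sequentially.
         \<eta> n \<in> {0..1} \<and> \<rho> n \<in> {0..1} \<and>
         (\<Theta>0 n, \<Lambda>0 n) \<in> param_space (p n) (q n) (R n) \<and>
         sym_pos_def (q n) (Sig0 n) \<and>
         data_model (M n) n (p n) (q n) (X n) (Y n) (\<Theta>0 n) (\<Lambda>0 n) (Sig0 n) \<and>
         sample_size_cond e0 n (p n) (q n) (s0_const (\<nu>0 n) (\<nu>1 n) (\<Theta>0 n) (\<Lambda>0 n) (Sig0 n)) \<and>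
         R n < 2 * eig_max (\<Lambda>0 n) * sqrt (r0_const (\<Theta>0 n) (\<Lambda>0 n) (Sig0 n))
                 / eps_rate C n (p n) (q n) (\<Theta>0 n) (\<Lambda>0 n) (Sig0 n) \<and>
         with_prob_at_least (M n) (1 - \<delta>0) (\<lambda>\<omega>.
           sparse_RIP (q n) (s0_const (\<nu>0 n) (\<nu>1 n) (\<Theta>0 n) (\<Lambda>0 n) (Sig0 n))
             (moment_mat n (q n) (q n) (\<lambda>i. X n i \<omega>) (\<lambda>i. X n i \<omega>)) (Sig0 n) (\<Theta>0 n) \<and>
           1 / \<nu>1 n > 2 * grad_sup_norm n (p n) (q n) (\<lambda>i. X n i \<omega>) (\<lambda>i. Y n i \<omega>) (\<Theta>0 n) (\<Lambda>0 n)))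
      \<longrightarrow>
      (\<forall>\<^sub>F n in sequentially.
         with_prob_at_least (M n) (1 - \<delta>0) (\<lambda>\<omega>.
           \<forall>(\<Theta>, \<Lambda>) \<in> HPD n (p n) (q n) (\<lambda>i. X n i \<omega>) (\<lambda>i. Y n i \<omega>)
                          (\<nu>0 n) (\<nu>1 n) (\<eta> n) (\<rho> n) (R n) (\<Theta>0 n) (\<Lambda>0 n).
             pair_frob_dist (\<Theta>, \<Lambda>) (\<Theta>0 n, \<Lambda>0 n)
               \<le> eps_rate C n (p n) (q n) (\<Theta>0 n) (\<Lambda>0 n) (Sig0 n))) \<and>
      ((\<forall>e\<in>{0<..<1}. \<forall>\<^sub>F n in sequentially.
          sample_size_cond e n (p n) (q n) (s0_const (\<nu>0 n) (\<nu>1 n) (\<Theta>0 n) (\<Lambda>0 n) (Sig0 n))) \<and>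
       (\<exists>b>0. \<forall>\<^sub>F n in sequentially. beta0 (\<Theta>0 n) (\<Lambda>0 n) (Sig0 n) \<ge> b) \<longrightarrow>
       (\<lambda>n. eps_rate C n (p n) (q n) (\<Theta>0 n) (\<Lambda>0 n) (Sig0 n)) \<longlonglongrightarrow> 0)"
proof -
  obtain c where c: "c > 0" "\<forall>\<^sub>F n in sequentially. norm (1 / (real n * \<nu>0 n))
      \<le> c * norm (sqrt (ln (real (p n + q n)) / real n))"
    using assms(5) by (auto elim: landau_o.bigE)
  \<comment> \<open>Having \<open>1 \<le> K\<close> makes \<open>288 * K\<^sup>2\<close> dominate
    \<open>24 * K\<close> too, so that one \<open>C\<close> covers both the quadratic and the linear
    regime.\<close>
  define K where "K = max 1 c"
  define C where "C = 1 + 288 * K\<^sup>2"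
  have "C > 0" by (simp add: C_def add_pos_nonneg)
  have K: "1 \<le> K" "c \<le> K" by (simp_all add: K_def)
  have ev: "\<forall>\<^sub>F n in sequentially. 1 / (real n * \<nu>0 n) \<le> K * sqrt (ln (real (p n + q n)) / real n)"
    using c(2)
  proof eventually_elim
    case (elim n)
    have "0 \<le> sqrt (ln (real (p n + q n)) / real n)" using assms(1,2)[of n] by simp
    then have "c * norm (sqrt (ln (real (p n + q n)) / real n)) \<le> K * sqrt (ln (real (p n + q n)) / real n)"
      using K(2) by (simp add: mult_right_mono)
    then show ?case using elim assms(3)[of n] by simp
  qed
  show ?thesis
  proof (intro exI[of _ C] conjI allI impI)
    show "C > 0" by fact
  next
    fix M :: "nat \<Rightarrow> 'a measure" and X Y :: "nat \<Rightarrow> nat \<Rightarrow> 'a \<Rightarrow> nat \<Rightarrow> real"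
      and \<Theta>0 \<Lambda>0 Sig0 :: "nat \<Rightarrow> real mat" and \<eta> \<rho> R :: "nat \<Rightarrow> real" and e0 \<delta>0 :: real
    let ?s0 = "\<lambda>n. s0_const (\<nu>0 n) (\<nu>1 n) (\<Theta>0 n) (\<Lambda>0 n) (Sig0 n)"
    let ?eps = "\<lambda>n. eps_rate C n (p n) (q n) (\<Theta>0 n) (\<Lambda>0 n) (Sig0 n)"
    assume H: "0 < e0 \<and> e0 < 1 \<and> 0 < \<delta>0 \<and> \<delta>0 < 1 \<and>
      (\<forall>\<^sub>F n in sequentially.
         \<eta> n \<in> {0..1} \<and> \<rho> n \<in> {0..1} \<and>
         (\<Theta>0 n, \<Lambda>0 n) \<in> param_space (p n) (q n) (R n) \<and>
         sym_pos_def (q n) (Sig0 n) \<and>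
         data_model (M n) n (p n) (q n) (X n) (Y n) (\<Theta>0 n) (\<Lambda>0 n) (Sig0 n) \<and>
         sample_size_cond e0 n (p n) (q n) (?s0 n) \<and>
         R n < 2 * eig_max (\<Lambda>0 n) * sqrt (r0_const (\<Theta>0 n) (\<Lambda>0 n) (Sig0 n)) / ?eps n \<and>
         with_prob_at_least (M n) (1 - \<delta>0) (\<lambda>\<omega>.
           sparse_RIP (q n) (?s0 n)
             (moment_mat n (q n) (q n) (\<lambda>i. X n i \<omega>) (\<lambda>i. X n i \<omega>)) (Sig0 n) (\<Theta>0 n) \<and>
           1 / \<nu>1 n > 2 * grad_sup_norm n (p n) (q n) (\<lambda>i. X n i \<omega>) (\<lambda>i. Y n i \<omega>) (\<Theta>0 n) (\<Lambda>0 n)))"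
    then have e0: "0 < e0" "e0 < 1" by auto
    show "\<forall>\<^sub>F n in sequentially. with_prob_at_least (M n) (1 - \<delta>0) (\<lambda>\<omega>.
           \<forall>(\<Theta>, \<Lambda>) \<in> HPD n (p n) (q n) (\<lambda>i. X n i \<omega>) (\<lambda>i. Y n i \<omega>)
                          (\<nu>0 n) (\<nu>1 n) (\<eta> n) (\<rho> n) (R n) (\<Theta>0 n) (\<Lambda>0 n).
             pair_frob_dist (\<Theta>, \<Lambda>) (\<Theta>0 n, \<Lambda>0 n) \<le> ?eps n)"
      using conjunct2[OF conjunct2[OF conjunct2[OF conjunct2[OF H]]]] ev eventually_ge_at_top[of 1]
    proof eventually_elim
      case (elim n)
      then obtain E where E: "E \<in> sets (M n)" "measure (M n) E \<ge> 1 - \<delta>0"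
        "\<And>\<omega>. \<omega> \<in> E \<Longrightarrow> sparse_RIP (q n) (?s0 n)
             (moment_mat n (q n) (q n) (\<lambda>i. X n i \<omega>) (\<lambda>i. X n i \<omega>)) (Sig0 n) (\<Theta>0 n)"
        "\<And>\<omega>. \<omega> \<in> E \<Longrightarrow> 1 / \<nu>1 n > 2 * grad_sup_norm n (p n) (q n) (\<lambda>i. X n i \<omega>) (\<lambda>i. Y n i \<omega>) (\<Theta>0 n) (\<Lambda>0 n)"
        unfolding with_prob_at_least_def by blast
      \<comment> \<open>The event on which isometry and gradient bound hold also witnesses the
        conclusion, so the set of good outcomes need not be measurable.\<close>
      show ?case
        unfolding with_prob_at_least_def
      proof (intro bexI[of _ E] conjI ballI)
        show "1 - \<delta>0 \<le> measure (M n) E" "E \<in> sets (M n)" by fact+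
        fix \<omega> z assume \<omega>: "\<omega> \<in> E" and z: "z \<in> HPD n (p n) (q n) (\<lambda>i. X n i \<omega>) (\<lambda>i. Y n i \<omega>)
                          (\<nu>0 n) (\<nu>1 n) (\<eta> n) (\<rho> n) (R n) (\<Theta>0 n) (\<Lambda>0 n)"
        obtain \<Theta> \<Lambda> where [simp]: "z = (\<Theta>, \<Lambda>)" by (cases z)
        have "pair_frob_dist (\<Theta>, \<Lambda>) (\<Theta>0 n, \<Lambda>0 n) \<le> ?eps n"
          by (rule HPD_error_bound[where K = K and x = "\<lambda>i. X n i \<omega>" and y = "\<lambda>i. Y n i \<omega>" and R = "R n"
                and ?\<nu>0.0 = "\<nu>0 n" and ?\<nu>1.0 = "\<nu>1 n" and \<eta> = "\<eta> n" and \<rho> = "\<rho> n" and ?e0.0 = e0])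
            (use elim e0 assms(1-4)[of n] E(3,4)[OF \<omega>] K C_def z in auto)
        then show "case z of (\<Theta>, \<Lambda>) \<Rightarrow> pair_frob_dist (\<Theta>, \<Lambda>) (\<Theta>0 n, \<Lambda>0 n) \<le> ?eps n" by simp
      qed
    qed
    assume lim: "(\<forall>e\<in>{0<..<1}. \<forall>\<^sub>F n in sequentially. sample_size_cond e n (p n) (q n) (?s0 n)) \<and>
       (\<exists>b>0. \<forall>\<^sub>F n in sequentially. beta0 (\<Theta>0 n) (\<Lambda>0 n) (Sig0 n) \<ge> b)"
    then obtain b where b: "b > 0" "\<forall>\<^sub>F n in sequentially. beta0 (\<Theta>0 n) (\<Lambda>0 n) (Sig0 n) \<ge> b" by blast
    show "?eps \<longlonglongrightarrow> 0"
      by (rule eps_rate_tendsto_0[where ?\<nu>0.0 = \<nu>0 and ?\<nu>1.0 = \<nu>1, OF assms(1,2) \<open>C > 0\<close> _ b]) (use lim in blast)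
  qed
qed

end
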